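(* Let $\lambda=\Lambda_0$. In each of the types $E_6^{(2)}$ and $F_4^{(1)}$ there exists an isomorphism of affine crystals $$\mathcal Z(\lambda)\stackrel{\sim}{\longrightarrow}B(\mathcal F(\lambda))\quad\text{with}\quad Y_\lambda\longmapsto (b_k(m_k))_{k=0}^\infty,$$ where $\mathcal Z(\lambda)$ is the affine crystal of proper Young walls, $Y_\lambda$ is the ground-state wall, $B(\mathcal F(\lambda))$ is the crystal of the level $1$ Fock space, and $(b_k(m_k))_{k=0}^{\infty}=(\emptyset(k))_{k=0}^\infty$ is the ground-state sequence for the Fock space.
   Context: **Cartan data.** $I=\{0,1,2,3,4\}$, $a_{ij}=\langle h_i,\alpha_j\rangle$, $a_{ii}=2$; the nonzero off-diagonal entries are: for $E_6^{(2)}$, $a_{01}=a_{10}=a_{12}=a_{21}=-1$, $a_{23}=-2$, $a_{32}=-1$, $a_{34}=a_{43}=-1$; for $F_4^{(1)}$, $a_{01}=a_{10}=a_{12}=a_{21}=-1$, $a_{23}=-1$, $a_{32}=-2$, $a_{34}=a_{43}=-1$. $P$ is the affine weight lattice, $\delta$ the null root, $\overline P=\bigoplus_i\mathbb Z\Lambda_i\subset P$ the classical weights. Affine (resp. classical) crystals are Kashiwara crystals with weights in $P$ (resp. $\overline P$). **Perfect crystals.** Write $(a_1a_2a_3a_4)=\sum a_i\alpha_i$. Type $E_6^{(2)}$: $\Phi^+=\{(1000),(0100),(1100),(0110),(1110),(0111),(1111),(1210),(1211),(1221),(1321),(2321)\}$, $\theta=(2321)$, $B=\{x_{\pm\alpha}:\alpha\in\Phi^+\}\cup\{r_1,r_2\}\cup\{\emptyset\}$.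 Type $F_4^{(1)}$: $\Phi^+=\{(1000),(0100),(0010),(0001),(1100),(0110),(0011),(1110),(0120),(0111),(1120),(1111),(0121),(1220),(1121),(0122),(1221),(1122),(1231),(1222),(1232),(1242),(1342),(2342)\}$, $\theta=(2342)$, $B'=\{x_{\pm\alpha}:\alpha\in\Phi^+\}\cup\{r_1,r_2,r_3,r_4\}\cup\{\emptyset\}$. With $\Phi^-=-\Phi^+$, the arrows ($b\xrightarrow{i}b'$ means $\tilde f_ib=b'$) are: for $i\ne0$, $x_\alpha\xrightarrow{i}x_\beta$ iff $\alpha-\alpha_i=\beta$ ($\alpha,\beta\in\Phi^+\cup\Phi^-$), and $x_{\alpha_i}\xrightarrow{i}r_i\xrightarrow{i}x_{-\alpha_i}$ when $\alpha_i\in\Phi^+$; for $i=0$, $x_\alpha\xrightarrow{0}x_\beta$ iff $\alpha+\theta=\beta$ ($\alpha,\beta\ne\pm\theta$), and $x_{-\theta}\xrightarrow{0}\emptyset\xrightarrow{0}x_\theta$. $\mathrm{wt}(x_\alpha)=\alpha$, $\mathrm{wt}(r_i)=\mathrm{wt}(\emptyset)=0$ in $\overline P$ (where $\alpha_i$ is read as $\sum_ja_{ji}\Lambda_j$), and $\varepsilon_i,\varphi_i$ are string lengths. Tensor products: $\tilde f_i(a\otimes b)=\tilde f_ia\otimes b$ if $\varphi_i(a)>\varepsilon_i(b)$ and $a\otimes\tilde f_ib$ if $\varphi_i(a)\le\varepsilon_i(b)$; $\tilde e_i(a\otimes b)=\tilde e_ia\otimes b$ if $\varphi_i(a)\ge\varepsilon_i(b)$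 and $a\otimes\tilde e_ib$ otherwise; $\varepsilon_i(a\otimes b)=\max(\varepsilon_i(a),\varepsilon_i(b)-\langle h_i,\mathrm{wt}(a)\rangle)$, $\varphi_i(a\otimes b)=\max(\varphi_i(b),\varphi_i(a)+\langle h_i,\mathrm{wt}(b)\rangle)$. The energy function $H:B\otimes B\to\mathbb Z$ is the unique function with $H(\emptyset\otimes\emptyset)=0$ such that, whenever $\tilde f_i(a\otimes b)\ne0$, $H(\tilde f_i(a\otimes b))-H(a\otimes b)$ equals $0$ if $i\ne0$, $-1$ if $i=0$ and $\varphi_0(a)>\varepsilon_0(b)$, $+1$ if $i=0$ and $\varphi_0(a)\le\varepsilon_0(b)$. $H':B'\otimes B'\to\mathbb Z$ is defined likewise. The affinization $B^{\mathrm{aff}}=\{b(n):b\in B,n\in\mathbb Z\}$ has $\tilde e_i(b(n))=(\tilde e_ib)(n-\delta_{i0})$, $\tilde f_i(b(n))=(\tilde f_ib)(n+\delta_{i0})$, $\varepsilon_i,\varphi_i$ as for $b$, $\mathrm{wt}(b(n))=\mathrm{wt}(b)-n\delta$, and $H^{\mathrm{aff}}(a(m)\otimes b(n))=H(a\otimes b)+m-n$ (similarly for $B'$, $H'$). **Fock space crystal.** $\mathcal F(\lambda)$ is the Fock space of Kashiwara–Miwa–Petersen–Yung built from the good module with crystal basis $B$ (resp. $B'$). Its ground-state sequence is $(\emptyset(k))_{k=0}^\infty$. Its crystal basis $B(\mathcal F(\lambda))$ is the set of sequences $\mathbf p=(p_k(n_k))_{k=0}^\infty$ in $B^{\mathrm{aff}}$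 (resp. $B'^{\mathrm{aff}}$), thought of as $\cdots\otimes p_1(n_1)\otimes p_0(n_0)$, with $p_k(n_k)=\emptyset(k)$ for $k\gg0$ and $H^{\mathrm{aff}}(p_{k+1}(n_{k+1})\otimes p_k(n_k))<2$ for all $k\ge0$ (with $(H')^{\mathrm{aff}}$ in type $F_4^{(1)}$). If $p_k(n_k)=\emptyset(k)$ for all $k\ge r$ and $\mathbf p'=p_{r-1}(n_{r-1})\otimes\cdots\otimes p_0(n_0)$, then $\tilde e_i$ and $\tilde f_i$ act on $\mathbf p$ through the tensor product rule on $p_r(n_r)\otimes\mathbf p'$, $\varepsilon_i(\mathbf p)=\max(\varepsilon_i(\mathbf p')-\varphi_i(\emptyset),0)$, $\varphi_i(\mathbf p)=\varphi_i(\mathbf p')+\max(\varphi_i(\emptyset)-\varepsilon_i(\mathbf p'),0)$, and $\mathrm{wt}(\mathbf p)=\lambda+\sum_{k\ge0}\big(\mathrm{wt}(p_k)-(n_k-k)\delta\big)$. **Young column patterns.** A pattern is an infinite vertical stack of colored blocks arranged in rows indexed by $\mathbb Z$ from bottom to top. It is invariant under the shift by four rows combined with the $180^\circ$ rotation around the vertical axis; this symmetry $\sigma$ sends a block with index $m$ to the block with the same letter and index $m+1$. "$x$ on $y$" means block $x$ rests on block $y$ (so $y$ must be present for there to be no empty space below $x$); $i$-block means a block of color $i$. *Type $E_6^{(2)}$*, for every $m\in\mathbb Z$: row $4m$: $c_m$ (color 3), $a_m$ (color 1); row $4m+1$: $b_m,b'_m$ (color 2); row $4m+2$: $a'_m$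 (color 1), $c'_m$ (color 3); row $4m+3$: $z_m$ (color 0), $b''_m$ (color 2), $d_m$ (color 4). Support: $b_m$ on $c_m$; $b'_m$ on $c_m,a_m$; $a'_m$ on $b_m$; $c'_m$ on $b_m,b'_m$; $z_m$ on $a'_m$; $b''_m$ on $a'_m,c'_m$; $d_m$ on $c'_m$; $a_{m+1}$ on $z_m,b''_m$; $c_{m+1}$ on $b''_m,d_m$. *Type $F_4^{(1)}$*, for every $m\in\mathbb Z$: row $4m$: $c^1_m$ (color 3), $d^1_m$ (color 4), $a^1_m$ (color 1); row $4m+1$: $c^2_m$ (color 3), $b^1_m$ (color 2); row $4m+2$: $b^2_m$ (color 2), $c^3_m$ (color 3); row $4m+3$ (a double-height row): $a^2_m$ (color 1), $c^4_m$ (color 3), $d^2_m$ (color 4), $z_m$ (color 0), $b^3_m$ (color 2). Support: $c^2_m$ on $c^1_m,d^1_m$; $b^1_m$ on $c^1_m,a^1_m$; $b^2_m$ on $c^2_m$; $c^3_m$ on $b^1_m$; $a^2_m$ on $b^2_m$; $c^4_m$ on $b^2_m,c^3_m$; $d^2_m$ on $c^3_m$; $z_m$ on $a^2_m$; $b^3_m$ on $a^2_m,c^4_m$; $c^1_{m+1}$ on $b^3_m,c^4_m,d^2_m$; $d^1_{m+1}$ on $c^4_m,d^2_m$; $a^1_{m+1}$ on $z_m,b^3_m$. **Young columns.** A pre-Young column is a nonempty set of blocks of the pattern whose height is bounded above and which contains, with any block, all blocks it rests on. A block of it is free if removing it leaves a pre-Young column. A pre-Young column is exceptional if its highest nonempty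 row contains precisely one free $2$-block and the column contains a free $1$-block (up to $\sigma$ the only one is: all blocks of index $\le0$ together with $a_1,c_1,b_1$ in type $E_6^{(2)}$, and with $c^1_1,d^1_1,a^1_1,c^2_1,b^2_1$ in type $F_4^{(1)}$). A Young column is a non-exceptional pre-Young column. Two Young columns are equivalent if they are related by vertical shift and $180^\circ$ rotation, i.e. by a power of $\sigma$. Let $C$ (resp. $C'$) be the set of equivalence classes in type $E_6^{(2)}$ (resp. $F_4^{(1)}$). Some classes have names. *Type $E_6^{(2)}$:* let $D$ be the set of all blocks of index $\le-1$ and $c_0,a_0,b_0,b'_0,a'_0,c'_0,b''_0$; $y_\emptyset$ is the class of $D\cup\{d_0,c_1,b_1,a'_1,z_1\}$, $y_{r_1}$ of $D\cup\{z_0,d_0,c_1,b_1,a'_1\}$, $y_{r_2}$ of $D\cup\{z_0,a_1,b'_1,d_0,c_1\}$. *Type $F_4^{(1)}$:* let $D$ be the set of all blocks of index $\le-1$ and all blocks of index $0$ except $z_0,d^2_0$; $y_\emptyset$ is the class of $D\cup\{d^2_0,c^1_1,d^1_1,c^2_1,b^2_1,a^2_1,z_1\}$, $y_{r_1}$ of $D\cup\{z_0,d^2_0,c^1_1,d^1_1,c^2_1,b^2_1,a^2_1\}$, $y_{r_2}$ of $D\cup\{z_0,a^1_1,b^1_1,d^2_0,c^1_1,d^1_1,c^2_1\}$, $y_{r_3}$ of $D\cup\{z_0,a^1_1,b^1_1,c^3_1,d^2_0,c^1_1,d^1_1\}$, $y_{r_4}$ of $D\cup\{z_0,a^1_1,b^1_1,c^3_1,d^2_1,d^2_0,c^1_1\}$.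 **Crystal operators on Young columns.** An $i$-block in a Young column $y$ is removable if removing it gives a Young column; an $i$-block of the pattern not in $y$ is addable if adding it gives a Young column. $\tilde f_i$ adds an addable $i$-block if one exists (the higher one if there are two), else gives $0$; moreover $\tilde f_i(y)=0$ if $y\in y_{r_j}$, $j\ne i$. $\tilde e_i$ removes a removable $i$-block if one exists (the lower one if there are two), else gives $0$; moreover $\tilde e_i(y)=0$ if $y\in y_{r_j}$, $j\neq i$. $\varphi_i(y)=\max\{n:\tilde f_i^ny\ne0\}$, $\varepsilon_i(y)=\max\{n:\tilde e_i^ny\neq0\}$. These descend to classical crystals $C$, $C'$, isomorphic to $B$, $B'$ respectively by an isomorphism $\phi$ with $\phi(y_\emptyset)=\emptyset$; through it $H,H'$ are regarded as functions on $C\otimes C$, $C'\otimes C'$. **Young walls.** The Young wall pattern consists of copies of the Young column pattern, all at the same height and orientation, placed in columns $k=0,1,2,\dots$ from right to left. Fix a Young column $g\in y_\emptyset$ (the ground-state column); the ground-state wall $Y_\lambda$ has $g$ in every column. A Young wall $Y=(\dots,y_2,y_1,y_0)$ is a set of blocks in the Young wall pattern differing from $Y_\lambda$ in finitely many blocks and such that each column $y_k$ is a Young column. $|y_k|_0$ is the number of $0$-blocks in $y_k\setminus g$ minus that in $g\setminus y_k$. A Young wall is proper if $H(y_{k+1}\otimes y_k)+|y_{k+1}|_0-|y_k|_0\le0$ for all $k\ge0$ (with $H'$ in type $F_4^{(1)}$). $\mathcal Z(\lambda)$ is the set of proper Young walls. **Affine crystal structure on $\mathcal Z(\lambda)$.**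 The $i$-signature of a Young column $y$ is $\varepsilon_i(y)$ copies of $-$ followed by $\varphi_i(y)$ copies of $+$. For a Young wall $Y$, concatenate $\cdots\mathrm{sign}_i(y_2)\,\mathrm{sign}_i(y_1)\,\mathrm{sign}_i(y_0)$ and cancel successively every $+-$ pair; the result (finitely many $-$'s followed by finitely many $+$'s) is $\mathrm{sign}_i(Y)$. $\tilde E_iY$ applies $\tilde e_i$ to the column containing the rightmost $-$ of $\mathrm{sign}_i(Y)$ ($0$ if there is none); $\tilde F_iY$ applies $\tilde f_i$ to the column containing the leftmost $+$ ($0$ if there is none). $\varepsilon_i(Y)$, $\varphi_i(Y)$ are the numbers of $-$'s and $+$'s in $\mathrm{sign}_i(Y)$. $\mathrm{wt}(Y)=\lambda-\sum_ik_i\alpha_i$, where $k_i$ is the (signed) difference in the number of $i$-blocks between $Y$ and the ground-state wall. *)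

theory Defs
  imports Main "HOL-Library.FuncSet" "HOL-Library.Function_Algebras" "HOL-Library.Product_Plus"
begin

section \<open>Cartan data and weights\<close>

datatype ind = I0 | I1 | I2 | I3 | I4

lemma UNIV_ind: "UNIV = {I0, I1, I2, I3, I4}"
  using ind.exhaust by auto

instance ind :: finite
  by standard (simp add: UNIV_ind)

text \<open>An element \<open>(\<mu>, n)\<close> of the affine weight lattice \<open>P\<close> stands for
  \<open>(\<Sum>j. \<mu> j * \<Lambda>\<^sub>j) + n * \<delta>\<close>. The classical weights are the elements with \<open>n = 0\<close>.\<close>

type_synonym weight = "(ind \<Rightarrow> int) \<times> int"

definition smul :: "int \<Rightarrow> weight \<Rightarrow> weight" where
  "smul c \<mu> = (\<lambda>j. c * fst \<mu> j, c * snd \<mu>)"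

definition pairing :: "ind \<Rightarrow> weight \<Rightarrow> int" where
  "pairing i \<mu> = fst \<mu> i"

definition Lam :: "ind \<Rightarrow> weight" where
  "Lam i = (\<lambda>j. if j = i then 1 else 0, 0)"

definition delta :: weight where
  "delta = (0, 1)"

definition classical_weights :: "weight set" where
  "classical_weights = {\<mu>. snd \<mu> = 0}"

text \<open>\<open>cl_root A i\<close> is \<open>\<Sum>j. A j i * \<Lambda>\<^sub>j\<close>. The classical simple roots are not linearly
  independent; in \<open>P\<close> the root \<open>\<alpha>\<^sub>0\<close> carries an additional \<open>\<delta>\<close> (in both types
  \<open>\<delta> = \<alpha>\<^sub>0 + \<theta>\<close>).\<close>

definition cl_root :: "(ind \<Rightarrow> ind \<Rightarrow> int) \<Rightarrow> ind \<Rightarrow> weight" where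
  "cl_root A i = (\<lambda>j. A j i, 0)"

definition simple_root :: "(ind \<Rightarrow> ind \<Rightarrow> int) \<Rightarrow> ind \<Rightarrow> weight" where
  "simple_root A i = cl_root A i + (if i = I0 then delta else 0)"


section \<open>Crystals\<close>

text \<open>The element \<open>0\<close> of a crystal is rendered as \<open>None\<close>. The functions \<open>\<epsilon>\<^sub>i\<close> and \<open>\<phi>\<^sub>i\<close> are
  integer valued; the value \<open>-\<infinity>\<close> allowed for general Kashiwara crystals does not occur for
  the crystals considered here.\<close>

record 'b crystal =
  carr :: "'b set"
  wt :: "'b \<Rightarrow> weight"
  eps :: "ind \<Rightarrow> 'b \<Rightarrow> int"
  phi :: "ind \<Rightarrow> 'b \<Rightarrow> int"
  et :: "ind \<Rightarrow> 'b \<Rightarrow> 'b option"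
  ft :: "ind \<Rightarrow> 'b \<Rightarrow> 'b option"

definition kashiwara_crystal :: "weight set \<Rightarrow> (ind \<Rightarrow> weight) \<Rightarrow> 'b crystal \<Rightarrow> bool" where
  "kashiwara_crystal P \<alpha> X \<longleftrightarrow>
     (\<forall>b\<in>carr X. wt X b \<in> P) \<and>
     (\<forall>i. \<forall>b\<in>carr X. phi X i b = eps X i b + pairing i (wt X b)) \<and>
     (\<forall>i. \<forall>b\<in>carr X. \<forall>b'. et X i b = Some b' \<longrightarrow>
        b' \<in> carr X \<and> wt X b' = wt X b + \<alpha> i \<and>
        eps X i b' = eps X i b - 1 \<and> phi X i b' = phi X i b + 1) \<and>
     (\<forall>i. \<forall>b\<in>carr X. \<forall>b'. ft X i b = Some b' \<longrightarrow>
        b' \<in> carr X \<and> wt X b' = wt X b - \<alpha> i \<and>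
        eps X i b' = eps X i b + 1 \<and> phi X i b' = phi X i b - 1) \<and>
     (\<forall>i. \<forall>b\<in>carr X. \<forall>b'\<in>carr X. ft X i b = Some b' \<longleftrightarrow> et X i b' = Some b)"

definition crystal_iso ::
    "weight set \<Rightarrow> (ind \<Rightarrow> weight) \<Rightarrow> 'b crystal \<Rightarrow> 'c crystal \<Rightarrow> ('b \<Rightarrow> 'c) \<Rightarrow> bool" where
  "crystal_iso P \<alpha> X Y \<psi> \<longleftrightarrow>
     kashiwara_crystal P \<alpha> X \<and> kashiwara_crystal P \<alpha> Y \<and>
     bij_betw \<psi> (carr X) (carr Y) \<and>
     (\<forall>b\<in>carr X. wt Y (\<psi> b) = wt X b) \<and>
     (\<forall>i. \<forall>b\<in>carr X. eps Y i (\<psi> b) = eps X i b \<and> phi Y i (\<psi> b) = phi X i b) \<and>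
     (\<forall>i. \<forall>b\<in>carr X. et Y i (\<psi> b) = map_option \<psi> (et X i b)) \<and>
     (\<forall>i. \<forall>b\<in>carr X. ft Y i (\<psi> b) = map_option \<psi> (ft X i b))"

definition string_length :: "('b \<Rightarrow> 'b option) \<Rightarrow> 'b \<Rightarrow> int" where
  "string_length h b = int (Max {n. ((\<lambda>x. Option.bind x h) ^^ n) (Some b) \<noteq> None})"

definition tensor :: "'b crystal \<Rightarrow> 'c crystal \<Rightarrow> ('b \<times> 'c) crystal" where
  "tensor X Y = \<lparr>
     carr = carr X \<times> carr Y,
     wt = (\<lambda>(a, b). wt X a + wt Y b),
     eps = (\<lambda>i (a, b). max (eps X i a) (eps Y i b - pairing i (wt X a))),
     phi = (\<lambda>i (a, b). max (phi Y i b) (phi X i a + pairing i (wt Y b))),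
     et = (\<lambda>i (a, b). if phi X i a \<ge> eps Y i b
                      then map_option (\<lambda>a'. (a', b)) (et X i a)
                      else map_option (\<lambda>b'. (a, b')) (et Y i b)),
     ft = (\<lambda>i (a, b). if phi X i a > eps Y i b
                      then map_option (\<lambda>a'. (a', b)) (ft X i a)
                      else map_option (\<lambda>b'. (a, b')) (ft Y i b)) \<rparr>"

text \<open>\<open>tensor_power X n\<close> is the \<open>n\<close>-fold tensor power; the list \<open>[b\<^sub>1, \<dots>, b\<^sub>n]\<close> stands for
  \<open>b\<^sub>1 \<otimes> (b\<^sub>2 \<otimes> (\<dots> \<otimes> b\<^sub>n))\<close>.\<close>

primrec tensor_power :: "'b crystal \<Rightarrow> nat \<Rightarrow> 'b list crystal" where
  "tensor_power X 0 = \<lparr>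
     carr = {[]}, wt = (\<lambda>_. 0), eps = (\<lambda>_ _. 0), phi = (\<lambda>_ _. 0),
     et = (\<lambda>_ _. None), ft = (\<lambda>_ _. None) \<rparr>"
| "tensor_power X (Suc n) =
     (let T = tensor X (tensor_power X n);
          split = (\<lambda>l. (hd l, tl l));
          join = (\<lambda>(a, l). a # l)
      in \<lparr> carr = join ` carr T,
           wt = (\<lambda>l. wt T (split l)),
           eps = (\<lambda>i l. eps T i (split l)),
           phi = (\<lambda>i l. phi T i (split l)),
           et = (\<lambda>i l. map_option join (et T i (split l))),
           ft = (\<lambda>i l. map_option join (ft T i (split l))) \<rparr>)"

text \<open>The pair \<open>(b, n)\<close> stands for \<open>b(n)\<close>.\<close>

definition affinization :: "'b crystal \<Rightarrow> ('b \<times> int) crystal" where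
  "affinization X = \<lparr>
     carr = carr X \<times> UNIV,
     wt = (\<lambda>(b, n). wt X b - smul n delta),
     eps = (\<lambda>i (b, n). eps X i b),
     phi = (\<lambda>i (b, n). phi X i b),
     et = (\<lambda>i (b, n). map_option (\<lambda>b'. (b', n - (if i = I0 then 1 else 0))) (et X i b)),
     ft = (\<lambda>i (b, n). map_option (\<lambda>b'. (b', n + (if i = I0 then 1 else 0))) (ft X i b)) \<rparr>"


section \<open>The data depending on the type\<close>

text \<open>\<open>(a\<^sub>1, a\<^sub>2, a\<^sub>3, a\<^sub>4)\<close> stands for \<open>\<Sum>i. a\<^sub>i * \<alpha>\<^sub>i\<close>.\<close>

type_synonym root = "int \<times> int \<times> int \<times> int"

text \<open>The pair \<open>(l, m)\<close> is the block with letter \<open>l\<close> and index \<open>m\<close>.\<close>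

type_synonym 'l block = "'l \<times> int"

text \<open>In \<open>type_data\<close>, block \<open>(l, m)\<close> has colour \<open>colour l\<close>, lies in row \<open>4 * m + row l\<close>,
  and rests on the blocks \<open>(l', m + d)\<close> with \<open>(l', d) \<in> support l\<close>.
  \<open>col_empty\<close> and \<open>col_r j\<close> are columns representing the classes
  \<open>y\<^sub>\<emptyset>\<close> and \<open>y\<close> with subscript \<open>r\<^sub>j\<close>.\<close>

record 'l type_data =
  cartan :: "ind \<Rightarrow> ind \<Rightarrow> int"
  pos_roots :: "root set"
  theta :: root
  colour :: "'l \<Rightarrow> ind"
  row :: "'l \<Rightarrow> int"
  support :: "'l \<Rightarrow> ('l \<times> int) set"
  col_empty :: "'l block set"
  col_r :: "ind \<Rightarrow> 'l block set option"

subsection \<open>Type \<open>E\<close>: twisted affine \<open>E\<^sub>6\<close>\<close>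

fun cartan_E :: "ind \<Rightarrow> ind \<Rightarrow> int" where
  "cartan_E i j =
     (if i = j then 2
      else if (i, j) = (I2, I3) then -2
      else if (i, j) \<in> {(I0, I1), (I1, I0), (I1, I2), (I2, I1), (I3, I2), (I3, I4), (I4, I3)}
      then -1 else 0)"

datatype letter_E = Ea | Ea' | Eb | Eb' | Eb'' | Ec | Ec' | Ed | Ez

fun colour_E :: "letter_E \<Rightarrow> ind" where
  "colour_E Ec = I3" | "colour_E Ea = I1"
| "colour_E Eb = I2" | "colour_E Eb' = I2"
| "colour_E Ea' = I1" | "colour_E Ec' = I3"
| "colour_E Ez = I0" | "colour_E Eb'' = I2" | "colour_E Ed = I4"

fun row_E :: "letter_E \<Rightarrow> int" where
  "row_E Ec = 0" | "row_E Ea = 0"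
| "row_E Eb = 1" | "row_E Eb' = 1"
| "row_E Ea' = 2" | "row_E Ec' = 2"
| "row_E Ez = 3" | "row_E Eb'' = 3" | "row_E Ed = 3"

fun support_E :: "letter_E \<Rightarrow> (letter_E \<times> int) set" where
  "support_E Eb = {(Ec, 0)}"
| "support_E Eb' = {(Ec, 0), (Ea, 0)}"
| "support_E Ea' = {(Eb, 0)}"
| "support_E Ec' = {(Eb, 0), (Eb', 0)}"
| "support_E Ez = {(Ea', 0)}"
| "support_E Eb'' = {(Ea', 0), (Ec', 0)}"
| "support_E Ed = {(Ec', 0)}"
| "support_E Ea = {(Ez, -1), (Eb'', -1)}"
| "support_E Ec = {(Eb'', -1), (Ed, -1)}"

definition base_E :: "letter_E block set" where
  "base_E = {(l, m). m \<le> -1} \<union>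
     {(Ec, 0), (Ea, 0), (Eb, 0), (Eb', 0), (Ea', 0), (Ec', 0), (Eb'', 0)}"

definition type_E :: "letter_E type_data" where
  "type_E = \<lparr>
     cartan = cartan_E,
     pos_roots = {(1,0,0,0), (0,1,0,0), (1,1,0,0), (0,1,1,0), (1,1,1,0), (0,1,1,1),
      (1,1,1,1), (1,2,1,0), (1,2,1,1), (1,2,2,1), (1,3,2,1), (2,3,2,1)},
     theta = (2,3,2,1),
     colour = colour_E, row = row_E, support = support_E,
     col_empty = base_E \<union> {(Ed, 0), (Ec, 1), (Eb, 1), (Ea', 1), (Ez, 1)},
     col_r = [I1 \<mapsto> base_E \<union> {(Ez, 0), (Ed, 0), (Ec, 1), (Eb, 1), (Ea', 1)},
              I2 \<mapsto> base_E \<union> {(Ez, 0), (Ea, 1), (Eb', 1), (Ed, 0), (Ec, 1)}] \<rparr>"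

subsection \<open>Type \<open>F\<close>: untwisted affine \<open>F\<^sub>4\<close>\<close>

fun cartan_F :: "ind \<Rightarrow> ind \<Rightarrow> int" where
  "cartan_F i j =
     (if i = j then 2
      else if (i, j) = (I3, I2) then -2
      else if (i, j) \<in> {(I0, I1), (I1, I0), (I1, I2), (I2, I1), (I2, I3), (I3, I4), (I4, I3)}
      then -1 else 0)"

datatype letter_F = Fa1 | Fa2 | Fb1 | Fb2 | Fb3 | Fc1 | Fc2 | Fc3 | Fc4 | Fd1 | Fd2 | Fz

fun colour_F :: "letter_F \<Rightarrow> ind" where
  "colour_F Fc1 = I3" | "colour_F Fd1 = I4" | "colour_F Fa1 = I1"
| "colour_F Fc2 = I3" | "colour_F Fb1 = I2"
| "colour_F Fb2 = I2" | "colour_F Fc3 = I3"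
| "colour_F Fa2 = I1" | "colour_F Fc4 = I3" | "colour_F Fd2 = I4"
| "colour_F Fz = I0" | "colour_F Fb3 = I2"

fun row_F :: "letter_F \<Rightarrow> int" where
  "row_F Fc1 = 0" | "row_F Fd1 = 0" | "row_F Fa1 = 0"
| "row_F Fc2 = 1" | "row_F Fb1 = 1"
| "row_F Fb2 = 2" | "row_F Fc3 = 2"
| "row_F Fa2 = 3" | "row_F Fc4 = 3" | "row_F Fd2 = 3"
| "row_F Fz = 3" | "row_F Fb3 = 3"

fun support_F :: "letter_F \<Rightarrow> (letter_F \<times> int) set" where
  "support_F Fc2 = {(Fc1, 0), (Fd1, 0)}"
| "support_F Fb1 = {(Fc1, 0), (Fa1, 0)}"
| "support_F Fb2 = {(Fc2, 0)}"
| "support_F Fc3 = {(Fb1, 0)}"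
| "support_F Fa2 = {(Fb2, 0)}"
| "support_F Fc4 = {(Fb2, 0), (Fc3, 0)}"
| "support_F Fd2 = {(Fc3, 0)}"
| "support_F Fz = {(Fa2, 0)}"
| "support_F Fb3 = {(Fa2, 0), (Fc4, 0)}"
| "support_F Fc1 = {(Fb3, -1), (Fc4, -1), (Fd2, -1)}"
| "support_F Fd1 = {(Fc4, -1), (Fd2, -1)}"
| "support_F Fa1 = {(Fz, -1), (Fb3, -1)}"

definition base_F :: "letter_F block set" where
  "base_F = {(l, m). m \<le> -1} \<union> {(l, 0) | l. l \<notin> {Fz, Fd2}}"

definition type_F :: "letter_F type_data" where
  "type_F = \<lparr>
     cartan = cartan_F,
     pos_roots = {(1,0,0,0), (0,1,0,0), (0,0,1,0), (0,0,0,1), (1,1,0,0), (0,1,1,0),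
      (0,0,1,1), (1,1,1,0), (0,1,2,0), (0,1,1,1), (1,1,2,0), (1,1,1,1),
      (0,1,2,1), (1,2,2,0), (1,1,2,1), (0,1,2,2), (1,2,2,1), (1,1,2,2),
      (1,2,3,1), (1,2,2,2), (1,2,3,2), (1,2,4,2), (1,3,4,2), (2,3,4,2)},
     theta = (2,3,4,2),
     colour = colour_F, row = row_F, support = support_F,
     col_empty = base_F \<union> {(Fd2, 0), (Fc1, 1), (Fd1, 1), (Fc2, 1), (Fb2, 1), (Fa2, 1), (Fz, 1)},
     col_r = [I1 \<mapsto> base_F \<union> {(Fz, 0), (Fd2, 0), (Fc1, 1), (Fd1, 1), (Fc2, 1), (Fb2, 1), (Fa2, 1)},
              I2 \<mapsto> base_F \<union> {(Fz, 0), (Fa1, 1), (Fb1, 1), (Fd2, 0), (Fc1, 1), (Fd1, 1), (Fc2, 1)},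
              I3 \<mapsto> base_F \<union> {(Fz, 0), (Fa1, 1), (Fb1, 1), (Fc3, 1), (Fd2, 0), (Fc1, 1), (Fd1, 1)},
              I4 \<mapsto> base_F \<union> {(Fz, 0), (Fa1, 1), (Fb1, 1), (Fc3, 1), (Fd2, 1), (Fd2, 0), (Fc1, 1)}] \<rparr>"


section \<open>Perfect crystals and energy functions\<close>

datatype pelem = X root | R ind | Emp

fun alpha_root :: "ind \<Rightarrow> root" where
  "alpha_root I0 = (0, 0, 0, 0)" \<comment> \<open>not used\<close>
| "alpha_root I1 = (1, 0, 0, 0)"
| "alpha_root I2 = (0, 1, 0, 0)"
| "alpha_root I3 = (0, 0, 1, 0)"
| "alpha_root I4 = (0, 0, 0, 1)"

definition roots :: "'l type_data \<Rightarrow> root set" where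
  "roots D = pos_roots D \<union> uminus ` pos_roots D"

fun root_wt :: "(ind \<Rightarrow> ind \<Rightarrow> int) \<Rightarrow> root \<Rightarrow> weight" where
  "root_wt A (a1, a2, a3, a4) =
     smul a1 (cl_root A I1) + smul a2 (cl_root A I2) + smul a3 (cl_root A I3) + smul a4 (cl_root A I4)"

inductive arrow :: "'l type_data \<Rightarrow> ind \<Rightarrow> pelem \<Rightarrow> pelem \<Rightarrow> bool" for D where
  "i \<noteq> I0 \<Longrightarrow> \<alpha> \<in> roots D \<Longrightarrow> \<beta> \<in> roots D \<Longrightarrow> \<alpha> - alpha_root i = \<beta> \<Longrightarrow> arrow D i (X \<alpha>) (X \<beta>)"
| "i \<noteq> I0 \<Longrightarrow> alpha_root i \<in> pos_roots D \<Longrightarrow> arrow D i (X (alpha_root i)) (R i)"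
| "i \<noteq> I0 \<Longrightarrow> alpha_root i \<in> pos_roots D \<Longrightarrow> arrow D i (R i) (X (- alpha_root i))"
| "\<alpha> \<in> roots D \<Longrightarrow> \<beta> \<in> roots D \<Longrightarrow> \<alpha> \<notin> {theta D, - theta D} \<Longrightarrow> \<beta> \<notin> {theta D, - theta D} \<Longrightarrow>
     \<alpha> + theta D = \<beta> \<Longrightarrow> arrow D I0 (X \<alpha>) (X \<beta>)"
| "arrow D I0 (X (- theta D)) Emp"
| "arrow D I0 Emp (X (theta D))"

definition choose_opt :: "('b \<Rightarrow> bool) \<Rightarrow> 'b option" where
  "choose_opt Q = (if \<exists>x. Q x then Some (SOME x. Q x) else None)"

definition perfect_crystal :: "'l type_data \<Rightarrow> pelem crystal" where
  "perfect_crystal D =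
     (let e = (\<lambda>i b. choose_opt (\<lambda>b'. arrow D i b' b));
          f = (\<lambda>i b. choose_opt (\<lambda>b'. arrow D i b b'))
      in \<lparr> carr = X ` roots D \<union> {R i | i. i \<noteq> I0 \<and> alpha_root i \<in> pos_roots D} \<union> {Emp},
           wt = (\<lambda>b. case b of X \<alpha> \<Rightarrow> root_wt (cartan D) \<alpha> | _ \<Rightarrow> 0),
           eps = (\<lambda>i. string_length (e i)),
           phi = (\<lambda>i. string_length (f i)),
           et = e, ft = f \<rparr>)"

text \<open>Extensionality makes the energy function unique as a function on the whole type.\<close>

definition is_energy :: "'l type_data \<Rightarrow> (pelem \<times> pelem \<Rightarrow> int) \<Rightarrow> bool" where
  "is_energy D H \<longleftrightarrow>
     (let B = perfect_crystal D in
      H \<in> extensional (carr B \<times> carr B) \<and>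
      H (Emp, Emp) = 0 \<and>
      (\<forall>i. \<forall>a\<in>carr B. \<forall>b\<in>carr B. \<forall>c. ft (tensor B B) i (a, b) = Some c \<longrightarrow>
         H c - H (a, b) =
           (if i \<noteq> I0 then 0 else if phi B I0 a > eps B I0 b then -1 else 1)))"

definition energy :: "'l type_data \<Rightarrow> pelem \<times> pelem \<Rightarrow> int" where
  "energy D = (THE H. is_energy D H)"

definition energy_aff :: "'l type_data \<Rightarrow> pelem \<times> int \<Rightarrow> pelem \<times> int \<Rightarrow> int" where
  "energy_aff D a b = energy D (fst a, fst b) + snd a - snd b"


section \<open>The Fock space crystal\<close>

definition ground_sequence :: "nat \<Rightarrow> pelem \<times> int" where
  "ground_sequence k = (Emp, int k)"

definition fock_carrier :: "'l type_data \<Rightarrow> (nat \<Rightarrow> pelem \<times> int) set" where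
  "fock_carrier D = {p.
     (\<forall>k. p k \<in> carr (affinization (perfect_crystal D))) \<and>
     (\<exists>r. \<forall>k\<ge>r. p k = ground_sequence k) \<and>
     (\<forall>k. energy_aff D (p (Suc k)) (p k) < 2)}"

text \<open>Any \<open>r\<close> beyond which \<open>p\<close> agrees with the ground-state sequence gives the same
  crystal structure; the least one is used.\<close>

definition stable_from :: "(nat \<Rightarrow> pelem \<times> int) \<Rightarrow> nat" where
  "stable_from p = (LEAST r. \<forall>k\<ge>r. p k = ground_sequence k)"

text \<open>\<open>segment p n\<close> is \<open>[p (n - 1), \<dots>, p 0]\<close>.\<close>

definition segment :: "(nat \<Rightarrow> 'b) \<Rightarrow> nat \<Rightarrow> 'b list" where
  "segment p n = rev (map p [0..<n])"

definition put_segment :: "(nat \<Rightarrow> 'b) \<Rightarrow> 'b list \<Rightarrow> (nat \<Rightarrow> 'b)" where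
  "put_segment p l = (\<lambda>k. if k < length l then rev l ! k else p k)"

text \<open>If the tensor product rule lets \<open>e\<^sub>i\<close> act on the factor \<open>\<emptyset>(r)\<close>, that is if
  \<open>\<phi>\<^sub>i(\<emptyset>) \<ge> \<epsilon>\<^sub>i(p')\<close>, then \<open>e\<^sub>i p = 0\<close>; this is the case \<open>\<epsilon>\<^sub>i(p) = 0\<close>.
  (The sequence that the rule would produce there violates the energy
  condition at the factors \<open>r + 1\<close> and \<open>r\<close>.)\<close>

definition fock_crystal :: "'l type_data \<Rightarrow> weight \<Rightarrow> (nat \<Rightarrow> pelem \<times> int) crystal" where
  "fock_crystal D lam =
     (let B = perfect_crystal D;
          T = tensor_power (affinization B);
          eps' = (\<lambda>i p. eps (T (stable_from p)) i (segment p (stable_from p)));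
          phi' = (\<lambda>i p. phi (T (stable_from p)) i (segment p (stable_from p)))
      in \<lparr> carr = fock_carrier D,
           wt = (\<lambda>p. lam + (\<Sum>k<stable_from p.
                      wt B (fst (p k)) - smul (snd (p k) - int k) delta)),
           eps = (\<lambda>i p. max (eps' i p - phi B i Emp) 0),
           phi = (\<lambda>i p. phi' i p + max (phi B i Emp - eps' i p) 0),
           et = (\<lambda>i p. let n = Suc (stable_from p) in
                  if phi B i Emp \<ge> eps' i p then None
                  else map_option (put_segment p) (et (T n) i (segment p n))),
           ft = (\<lambda>i p. let n = Suc (stable_from p) in
                  map_option (put_segment p) (ft (T n) i (segment p n))) \<rparr>)"


section \<open>Young columns\<close>

definition block_colour :: "'l type_data \<Rightarrow> 'l block \<Rightarrow> ind" where
  "block_colour D x = colour D (fst x)"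

definition block_row :: "'l type_data \<Rightarrow> 'l block \<Rightarrow> int" where
  "block_row D x = 4 * snd x + row D (fst x)"

definition rests_on :: "'l type_data \<Rightarrow> 'l block \<Rightarrow> 'l block set" where
  "rests_on D x = {(l, snd x + d) | l d. (l, d) \<in> support D (fst x)}"

definition pre_young :: "'l type_data \<Rightarrow> 'l block set \<Rightarrow> bool" where
  "pre_young D y \<longleftrightarrow>
     y \<noteq> {} \<and> (\<exists>h. \<forall>x\<in>y. block_row D x \<le> h) \<and> (\<forall>x\<in>y. rests_on D x \<subseteq> y)"

definition free_block :: "'l type_data \<Rightarrow> 'l block set \<Rightarrow> 'l block \<Rightarrow> bool" where
  "free_block D y x \<longleftrightarrow> x \<in> y \<and> pre_young D (y - {x})"

definition top_blocks :: "'l type_data \<Rightarrow> 'l block set \<Rightarrow> 'l block set" where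
  "top_blocks D y = {x \<in> y. \<forall>w\<in>y. block_row D w \<le> block_row D x}"

definition exceptional :: "'l type_data \<Rightarrow> 'l block set \<Rightarrow> bool" where
  "exceptional D y \<longleftrightarrow>
     (\<exists>!x. x \<in> top_blocks D y \<and> free_block D y x \<and> block_colour D x = I2) \<and>
     (\<exists>x. free_block D y x \<and> block_colour D x = I1)"

definition young_column :: "'l type_data \<Rightarrow> 'l block set \<Rightarrow> bool" where
  "young_column D y \<longleftrightarrow> pre_young D y \<and> \<not> exceptional D y"

text \<open>\<open>shift n\<close> is the action of the \<open>n\<close>-th power of the symmetry \<open>\<sigma>\<close>; \<open>shift_class y\<close> is
  the equivalence class of \<open>y\<close>.\<close>

definition shift :: "int \<Rightarrow> 'l block set \<Rightarrow> 'l block set" where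
  "shift n y = {(l, m + n) | l m. (l, m) \<in> y}"

definition shift_class :: "'l block set \<Rightarrow> 'l block set set" where
  "shift_class y = range (\<lambda>n. shift n y)"

definition removable :: "'l type_data \<Rightarrow> ind \<Rightarrow> 'l block set \<Rightarrow> 'l block \<Rightarrow> bool" where
  "removable D i y x \<longleftrightarrow> x \<in> y \<and> block_colour D x = i \<and> young_column D (y - {x})"

definition addable :: "'l type_data \<Rightarrow> ind \<Rightarrow> 'l block set \<Rightarrow> 'l block \<Rightarrow> bool" where
  "addable D i y x \<longleftrightarrow> x \<notin> y \<and> block_colour D x = i \<and> young_column D (insert x y)"

definition blocked :: "'l type_data \<Rightarrow> ind \<Rightarrow> 'l block set \<Rightarrow> bool" where
  "blocked D i y \<longleftrightarrow> (\<exists>j y'. j \<noteq> i \<and> col_r D j = Some y' \<and> y \<in> shift_class y')"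

definition col_f :: "'l type_data \<Rightarrow> ind \<Rightarrow> 'l block set \<Rightarrow> 'l block set option" where
  "col_f D i y =
     (if blocked D i y \<or> (\<nexists>x. addable D i y x) then None
      else Some (insert (arg_max (block_row D) (addable D i y)) y))"

definition col_e :: "'l type_data \<Rightarrow> ind \<Rightarrow> 'l block set \<Rightarrow> 'l block set option" where
  "col_e D i y =
     (if blocked D i y \<or> (\<nexists>x. removable D i y x) then None
      else Some (y - {arg_min (block_row D) (removable D i y)}))"

definition col_phi :: "'l type_data \<Rightarrow> ind \<Rightarrow> 'l block set \<Rightarrow> int" where
  "col_phi D i = string_length (col_f D i)"

definition col_eps :: "'l type_data \<Rightarrow> ind \<Rightarrow> 'l block set \<Rightarrow> int" where
  "col_eps D i = string_length (col_e D i)"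

text \<open>The classical crystal of equivalence classes. Its weight function is forced by
  \<open>\<phi>\<^sub>i - \<epsilon>\<^sub>i = \<langle>h\<^sub>i, wt\<rangle>\<close>.\<close>

definition column_crystal :: "'l type_data \<Rightarrow> 'l block set set crystal" where
  "column_crystal D =
     (let rep = (\<lambda>c. SOME y. y \<in> c) in
      \<lparr> carr = shift_class ` {y. young_column D y},
        wt = (\<lambda>c. (\<lambda>i. col_phi D i (rep c) - col_eps D i (rep c), 0)),
        eps = (\<lambda>i c. col_eps D i (rep c)),
        phi = (\<lambda>i c. col_phi D i (rep c)),
        et = (\<lambda>i c. map_option shift_class (col_e D i (rep c))),
        ft = (\<lambda>i c. map_option shift_class (col_f D i (rep c))) \<rparr>)"

definition column_iso :: "'l type_data \<Rightarrow> 'l block set set \<Rightarrow> pelem" where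
  "column_iso D = (SOME \<psi>.
     crystal_iso classical_weights (cl_root (cartan D)) (column_crystal D) (perfect_crystal D) \<psi> \<and>
     \<psi> (shift_class (col_empty D)) = Emp)"

definition col_energy :: "'l type_data \<Rightarrow> 'l block set \<Rightarrow> 'l block set \<Rightarrow> int" where
  "col_energy D y y' = energy D (column_iso D (shift_class y), column_iso D (shift_class y'))"


section \<open>Young walls\<close>

text \<open>A wall is given by its columns: \<open>Y k\<close> is the column \<open>y\<^sub>k\<close>, with \<open>k\<close> counted from right
  to left. The parameter \<open>g\<close> is the ground-state column.\<close>

type_synonym 'l wall = "nat \<Rightarrow> 'l block set"

definition ground_wall :: "'l block set \<Rightarrow> 'l wall" where
  "ground_wall g = (\<lambda>k. g)"

definition young_wall :: "'l type_data \<Rightarrow> 'l block set \<Rightarrow> 'l wall \<Rightarrow> bool" where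
  "young_wall D g Y \<longleftrightarrow>
     finite {(k, x). x \<in> Y k \<and> x \<notin> ground_wall g k} \<and>
     finite {(k, x). x \<notin> Y k \<and> x \<in> ground_wall g k} \<and>
     (\<forall>k. young_column D (Y k))"

definition zero_count :: "'l type_data \<Rightarrow> 'l block set \<Rightarrow> 'l block set \<Rightarrow> int" where
  "zero_count D g y =
     int (card {x \<in> y - g. block_colour D x = I0}) - int (card {x \<in> g - y. block_colour D x = I0})"

definition proper :: "'l type_data \<Rightarrow> 'l block set \<Rightarrow> 'l wall \<Rightarrow> bool" where
  "proper D g Y \<longleftrightarrow>
     (\<forall>k. col_energy D (Y (Suc k)) (Y k) + zero_count D g (Y (Suc k)) - zero_count D g (Y k) \<le> 0)"

definition wall_count :: "'l type_data \<Rightarrow> 'l block set \<Rightarrow> ind \<Rightarrow> 'l wall \<Rightarrow> int" where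
  "wall_count D g i Y =
     int (card {(k, x). x \<in> Y k \<and> x \<notin> ground_wall g k \<and> block_colour D x = i}) -
     int (card {(k, x). x \<notin> Y k \<and> x \<in> ground_wall g k \<and> block_colour D x = i})"

subsection \<open>Signatures\<close>

text \<open>The concatenated signature of a wall is infinite to the left. Its signs are the
  positions \<open>(k, j)\<close>, the \<open>j\<close>-th sign (from the left, starting with \<open>0\<close>) of column \<open>k\<close>.
  Two signs cancel if they form a \<open>+-\<close> pair and all signs strictly between
  them cancel among themselves.\<close>

definition minus_pos :: "'l type_data \<Rightarrow> ind \<Rightarrow> 'l wall \<Rightarrow> (nat \<times> nat) set" where
  "minus_pos D i Y = {(k, j). int j < col_eps D i (Y k)}"

definition plus_pos :: "'l type_data \<Rightarrow> ind \<Rightarrow> 'l wall \<Rightarrow> (nat \<times> nat) set" where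
  "plus_pos D i Y =
     {(k, j). col_eps D i (Y k) \<le> int j \<and> int j < col_eps D i (Y k) + col_phi D i (Y k)}"

definition left_of :: "nat \<times> nat \<Rightarrow> nat \<times> nat \<Rightarrow> bool" where
  "left_of p q \<longleftrightarrow> fst p > fst q \<or> fst p = fst q \<and> snd p < snd q"

inductive cancels :: "'l type_data \<Rightarrow> ind \<Rightarrow> 'l wall \<Rightarrow> nat \<times> nat \<Rightarrow> nat \<times> nat \<Rightarrow> bool"
  for D i Y where
  "p \<in> plus_pos D i Y \<Longrightarrow> q \<in> minus_pos D i Y \<Longrightarrow> left_of p q \<Longrightarrow>
   (\<And>r. r \<in> plus_pos D i Y \<union> minus_pos D i Y \<Longrightarrow> left_of p r \<Longrightarrow> left_of r q \<Longrightarrow>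
      \<exists>p' q'. left_of p p' \<and> left_of q' q \<and> cancels D i Y p' q' \<and> (r = p' \<or> r = q')) \<Longrightarrow>
   cancels D i Y p q"

definition minus_left :: "'l type_data \<Rightarrow> ind \<Rightarrow> 'l wall \<Rightarrow> (nat \<times> nat) set" where
  "minus_left D i Y = {q \<in> minus_pos D i Y. \<nexists>p. cancels D i Y p q}"

definition plus_left :: "'l type_data \<Rightarrow> ind \<Rightarrow> 'l wall \<Rightarrow> (nat \<times> nat) set" where
  "plus_left D i Y = {p \<in> plus_pos D i Y. \<nexists>q. cancels D i Y p q}"

subsection \<open>The crystal of proper Young walls\<close>

text \<open>Columns are numbered from right to left, so the column of the rightmost \<open>-\<close> is the
  minimum and that of the leftmost \<open>+\<close> the maximum.\<close>

definition wall_crystal :: "'l type_data \<Rightarrow> 'l block set \<Rightarrow> weight \<Rightarrow> 'l wall crystal" where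
  "wall_crystal D g lam = \<lparr>
     carr = {Y. young_wall D g Y \<and> proper D g Y},
     wt = (\<lambda>Y. lam - (\<Sum>i\<in>UNIV. smul (wall_count D g i Y) (simple_root (cartan D) i))),
     eps = (\<lambda>i Y. int (card (minus_left D i Y))),
     phi = (\<lambda>i Y. int (card (plus_left D i Y))),
     et = (\<lambda>i Y. if minus_left D i Y = {} then None
                 else let k = Min (fst ` minus_left D i Y)
                      in map_option (\<lambda>y. Y(k := y)) (col_e D i (Y k))),
     ft = (\<lambda>i Y. if plus_left D i Y = {} then None
                 else let k = Max (fst ` plus_left D i Y)
                      in map_option (\<lambda>y. Y(k := y)) (col_f D i (Y k))) \<rparr>"

definition affine_crystal_iso :: "'l type_data \<Rightarrow> 'b crystal \<Rightarrow> 'c crystal \<Rightarrow> ('b \<Rightarrow> 'c) \<Rightarrow> bool" where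
  "affine_crystal_iso D = crystal_iso UNIV (simple_root (cartan D))"

end

theory Submission
  imports Defs
begin

text \<open>A column is determined by its class and its number of \<open>0\<close>-blocks, so sending the column \<open>y\<^sub>k\<close> to
  \<open>\<phi>(y\<^sub>k)(n + k)\<close>, where \<open>n\<close> counts the \<open>0\<close>-blocks of \<open>y\<^sub>k\<close> relative to the ground-state column,
  turns walls into paths, and properness into the condition that the affine energy of adjacent
  factors is less than \<open>2\<close>.

  To compare the operators, read the signature of a wall from right to left as a mountain range.
  A \<open>+\<close> and a \<open>-\<close> cancel iff they lie at the same level with only lower signs between them. Hence
  \<open>\<epsilon>\<^sub>i\<close>, \<open>\<phi>\<^sub>i\<close> and the column on which an operator acts can be read off from the height of the
  mountain range and from its first and last highest peak, and the tensor product rule leads to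
  the same description.

  The classes of Young columns, the isomorphism with the perfect crystal and the energy function
  are finite tables that are checked by rewriting. The tables list all classes since every
  pre-Young column arises from a set of all blocks of low index by adding blocks one at a time.\<close>

text \<open>The signature of a wall never ends on the left: for i = 0 every ground-state column
  contributes a - and a +, so there is no finite word to set against a finite tensor product. The
  height of the mountain range repairs this. In the tail its peaks stay at one constant level, so
  maxima exist, and a tensor product that reaches one factor into the tail already decides
  everything.

  The same picture shows why an operator preserves properness. It acts at an extremal peak, and
  comparing this peak with its two neighbours gives exactly the inequalities under which the tensor
  product rule acts on that factor in both adjacent pairs. There the affine energy is constant,
  since the change of the exponent under f_0 balances that of H.

  The energy function is given by a description, so a table of values says something about it only
  after uniqueness is known; this is where connectedness of the tensor square enters. The crystal
  axioms are proved for paths and for the perfect crystal only, and are pulled back from there to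
  walls and to classes of columns.\<close>

lemma crystal_iso_transfer:
  assumes Y: "kashiwara_crystal P \<alpha> Y"
    and bij: "bij_betw \<psi> (carr U) (carr Y)"
    and wt: "\<And>b. b \<in> carr U \<Longrightarrow> wt Y (\<psi> b) = wt U b"
    and eps: "\<And>i b. b \<in> carr U \<Longrightarrow> eps Y i (\<psi> b) = eps U i b"
    and phi: "\<And>i b. b \<in> carr U \<Longrightarrow> phi Y i (\<psi> b) = phi U i b"
    and et: "\<And>i b. b \<in> carr U \<Longrightarrow> et Y i (\<psi> b) = map_option \<psi> (et U i b)"
    and ft: "\<And>i b. b \<in> carr U \<Longrightarrow> ft Y i (\<psi> b) = map_option \<psi> (ft U i b)"
    and et_in: "\<And>i b b'. b \<in> carr U \<Longrightarrow> et U i b = Some b' \<Longrightarrow> b' \<in> carr U"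
    and ft_in: "\<And>i b b'. b \<in> carr U \<Longrightarrow> ft U i b = Some b' \<Longrightarrow> b' \<in> carr U"
  shows "crystal_iso P \<alpha> U Y \<psi>"
proof -
  have in_Y: "\<psi> b \<in> carr Y" if "b \<in> carr U" for b
    using bij that by (auto simp: bij_betw_def)
  have inj: "\<psi> a = \<psi> b \<longleftrightarrow> a = b" if "a \<in> carr U" "b \<in> carr U" for a b
    using bij that by (auto simp: bij_betw_def inj_on_def)
  have Yet: "\<psi> b' \<in> carr Y \<and> wt Y (\<psi> b') = wt Y (\<psi> b) + \<alpha> i \<and>
      eps Y i (\<psi> b') = eps Y i (\<psi> b) - 1 \<and> phi Y i (\<psi> b') = phi Y i (\<psi> b) + 1"
    if "b \<in> carr U" "et U i b = Some b'" for i b b'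
  proof -
    have "et Y i (\<psi> b) = Some (\<psi> b')" using et[OF that(1), of i] that(2) by simp
    then show ?thesis using Y in_Y[OF that(1)] unfolding kashiwara_crystal_def by blast
  qed
  have Yft: "\<psi> b' \<in> carr Y \<and> wt Y (\<psi> b') = wt Y (\<psi> b) - \<alpha> i \<and>
      eps Y i (\<psi> b') = eps Y i (\<psi> b) + 1 \<and> phi Y i (\<psi> b') = phi Y i (\<psi> b) - 1"
    if "b \<in> carr U" "ft U i b = Some b'" for i b b'
  proof -
    have "ft Y i (\<psi> b) = Some (\<psi> b')" using ft[OF that(1), of i] that(2) by simp
    then show ?thesis using Y in_Y[OF that(1)] unfolding kashiwara_crystal_def by blast
  qed
  \<comment> \<open>The axioms of \<open>U\<close> are those of \<open>Y\<close> read through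
    \<open>\<psi>\<close>. Injectivity on the carrier turns the equivalence between
    \<open>ft\<close> and \<open>et\<close> back into one about \<open>U\<close>, provided that the
    operators of \<open>U\<close> stay in the carrier.\<close>
  have U: "kashiwara_crystal P \<alpha> U"
    unfolding kashiwara_crystal_def
  proof (intro conjI allI ballI impI)
    fix b assume "b \<in> carr U"
    then show "wt U b \<in> P" using Y in_Y wt unfolding kashiwara_crystal_def by metis
  next
    fix i b assume b: "b \<in> carr U"
    have "phi Y i (\<psi> b) = eps Y i (\<psi> b) + pairing i (wt Y (\<psi> b))"
      using Y in_Y[OF b] unfolding kashiwara_crystal_def by blast
    then show "phi U i b = eps U i b + pairing i (wt U b)" using wt eps phi b by simp
  next
    fix i b b' assume b: "b \<in> carr U" and b': "b' \<in> carr U"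
    have "ft Y i (\<psi> b) = Some (\<psi> b') \<longleftrightarrow> et Y i (\<psi> b') = Some (\<psi> b)"
      using Y in_Y b b' unfolding kashiwara_crystal_def by blast
    moreover have "ft Y i (\<psi> b) = Some (\<psi> b') \<longleftrightarrow> ft U i b = Some b'"
      using ft[OF b, of i] ft_in[OF b, of i] inj b' by (cases "ft U i b") auto
    moreover have "et Y i (\<psi> b') = Some (\<psi> b) \<longleftrightarrow> et U i b' = Some b"
      using et[OF b', of i] et_in[OF b', of i] inj b by (cases "et U i b'") auto
    ultimately show "ft U i b = Some b' \<longleftrightarrow> et U i b' = Some b" by simp
  qed (use Yet Yft et_in ft_in wt eps phi in \<open>metis\<close>)+
  show ?thesis unfolding crystal_iso_def
    using U Y bij wt eps phi et ft by simp
qed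



section \<open>String lengths\<close>

text \<open>\<open>string_length\<close> takes the \<open>Max\<close> of a set of exponents that
  could be infinite. The recursion makes \<open>r\<close> drop by one along every arrow, so inside
  \<open>S\<close> every string ends and the set is \<open>{..r x}\<close>.\<close>

lemma string_length_eqI:
  assumes closed: "\<And>x y. x \<in> S \<Longrightarrow> h x = Some y \<Longrightarrow> y \<in> S"
    and rec: "\<And>x. x \<in> S \<Longrightarrow> r x = (case h x of None \<Rightarrow> 0 | Some y \<Rightarrow> Suc (r y))"
    and "x \<in> S"
  shows "string_length h x = int (r x)"
proof -
  define it where "it n y = ((\<lambda>x. Option.bind x h) ^^ n) y" for n y
  have Suc: "it (Suc n) (Some y) = it n (h y)" for n y
    by (simp add: it_def funpow_Suc_right del: funpow.simps)
  have None: "it n None = None" for n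
    by (induction n) (auto simp: it_def)
  have "it n (Some y) \<noteq> None \<longleftrightarrow> n \<le> r y" if "y \<in> S" for n y
    using that
  proof (induction n arbitrary: y)
    case 0
    then show ?case by (simp add: it_def)
  next
    case (Suc n)
    then show ?case
      using closed[OF Suc.prems] rec[OF Suc.prems] by (cases "h y") (auto simp: \<open>\<And>n y. it (Suc n) (Some y) = it n (h y)\<close> None)
  qed
  then have "{n. it n (Some x) \<noteq> None} = {..r x}" using \<open>x \<in> S\<close> by auto
  moreover have "Max {..r x} = r x" by (rule Max_eqI) auto
  ultimately show ?thesis by (simp add: string_length_def it_def[symmetric])
qed

text \<open>The iterates of \<open>h'\<close> are the \<open>j\<close>-images of those of
  \<open>h\<close> and vanish at the same time, so the two sets of exponents are equal, finite or
  not.\<close>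

lemma string_length_map:
  assumes closed: "\<And>x y. x \<in> S \<Longrightarrow> h x = Some y \<Longrightarrow> y \<in> S"
    and map: "\<And>x. x \<in> S \<Longrightarrow> h' (j x) = map_option j (h x)"
    and "x \<in> S"
  shows "string_length h' (j x) = string_length h x"
proof -
  define it where "it n = ((\<lambda>x. Option.bind x h) ^^ n) (Some x)" for n
  define it' where "it' n = ((\<lambda>x. Option.bind x h') ^^ n) (Some (j x))" for n
  have "it' n = map_option j (it n) \<and> (\<forall>y. it n = Some y \<longrightarrow> y \<in> S)" for n
  proof (induction n)
    case 0
    then show ?case using \<open>x \<in> S\<close> by (simp add: it_def it'_def)
  next
    case (Suc n)
    have "it (Suc n) = Option.bind (it n) h" "it' (Suc n) = Option.bind (it' n) h'"
      by (simp_all add: it_def it'_def)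
    then show ?case using Suc closed map by (cases "it n") auto
  qed
  then have "it' n \<noteq> None \<longleftrightarrow> it n \<noteq> None" for n by simp
  then show ?thesis by (simp add: string_length_def it_def[symmetric] it'_def[symmetric])
qed

section \<open>Signatures as mountain ranges\<close>

text \<open>Reading a signature from right to left, go up at every \<open>+\<close> and down at every \<open>-\<close>.
  If column \<open>k\<close> contributes \<open>e k\<close> signs \<open>-\<close> followed by \<open>f k\<close> signs \<open>+\<close>, then \<open>peak e f k\<close> is the
  height of the peak in that column, and \<open>valley e f k\<close> that of the valley to its right.\<close>

definition valley :: "(nat \<Rightarrow> int) \<Rightarrow> (nat \<Rightarrow> int) \<Rightarrow> nat \<Rightarrow> int" where
  "valley e f k = (\<Sum>m<k. f m - e m)"

definition peak :: "(nat \<Rightarrow> int) \<Rightarrow> (nat \<Rightarrow> int) \<Rightarrow> nat \<Rightarrow> int" where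
  "peak e f k = valley e f k + f k"

lemma valley_0 [simp]: "valley e f 0 = 0"
  by (simp add: valley_def)

lemma valley_Suc: "valley e f (Suc k) = peak e f k - e k"
  by (simp add: valley_def peak_def)

section \<open>Highest peaks of eventually constant sequences\<close>

definition max_val :: "(nat \<Rightarrow> int) \<Rightarrow> int \<Rightarrow> bool" where
  "max_val T M \<longleftrightarrow> (\<exists>k. T k = M) \<and> (\<forall>k. T k \<le> M)"

text \<open>The two notions are not mirror images. On the right the range starts at level 0, so an
  uncancelled + needs a peak above 0. On the left the strict inequality of \<open>last_max\<close>
  against a constant tail plays the corresponding role for an uncancelled -.\<close>

definition first_max :: "(nat \<Rightarrow> int) \<Rightarrow> nat \<Rightarrow> bool" where
  "first_max T k \<longleftrightarrow> 0 < T k \<and> (\<forall>j<k. T j < T k) \<and> (\<forall>j>k. T j \<le> T k)"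

definition last_max :: "(nat \<Rightarrow> int) \<Rightarrow> nat \<Rightarrow> bool" where
  "last_max T k \<longleftrightarrow> (\<forall>j<k. T j \<le> T k) \<and> (\<forall>j>k. T j < T k)"

lemma max_valD: "max_val h M \<Longrightarrow> h k \<le> M"
  by (simp add: max_val_def)

lemma max_val_unique: "max_val T M \<Longrightarrow> max_val T M' \<Longrightarrow> M = M'"
  unfolding max_val_def by (metis order_antisym)

lemma first_max_max_val: "first_max T k \<Longrightarrow> max_val T (T k)"
  unfolding max_val_def first_max_def by (metis less_imp_le linorder_neqE_nat order_refl)

lemma last_max_max_val: "last_max T k \<Longrightarrow> max_val T (T k)"
  unfolding max_val_def last_max_def by (metis less_imp_le linorder_neqE_nat order_refl)

lemma first_max_unique: "first_max T k \<Longrightarrow> first_max T k' \<Longrightarrow> k = k'"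
  unfolding first_max_def by (metis linorder_neqE_nat not_less)

lemma last_max_unique: "last_max T k \<Longrightarrow> last_max T k' \<Longrightarrow> k = k'"
  unfolding last_max_def by (metis linorder_neqE_nat not_less)

lemma max_val_exists:
  assumes "\<And>k. r \<le> k \<Longrightarrow> T k = T r"
  obtains M where "max_val T M"
proof -
  have "range T = T ` {..r}"
  proof (intro equalityI subsetI)
    fix x assume "x \<in> range T"
    then obtain k where k: "x = T k" by blast
    show "x \<in> T ` {..r}"
    proof (cases "k \<le> r")
      case True then show ?thesis using k by auto
    next
      case False then show ?thesis using k assms[of k] by auto
    qed
  qed auto
  then have fin: "finite (range T)" by simp
  have "max_val T (Max (range T))"
    unfolding max_val_def using Max_in[OF fin] Max_ge[OF fin] by fastforce
  then show thesis by (rule that)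
qed

lemma first_max_exists:
  assumes M: "max_val T M" and "0 < M"
  obtains k where "first_max T k"
proof -
  let ?k = "LEAST k. T k = M"
  have k: "T ?k = M" using M unfolding max_val_def by (metis (mono_tags, lifting) LeastI_ex)
  have "T j < M" if "j < ?k" for j
    using not_less_Least[OF that] M unfolding max_val_def by (simp add: order.not_eq_order_implies_strict)
  then have "first_max T ?k" unfolding first_max_def using k M \<open>0 < M\<close> unfolding max_val_def by auto
  then show thesis by (rule that)
qed

lemma last_max_exists:
  assumes r: "\<And>k. r \<le> k \<Longrightarrow> T k = T r" and M: "max_val T M" and "T r < M"
  obtains k where "last_max T k"
proof -
  let ?P = "\<lambda>k. T k = M"
  have bound: "k \<le> r" if "?P k" for k using r \<open>T r < M\<close> that by (metis less_irrefl nat_le_linear)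
  let ?k = "GREATEST k. ?P k"
  have ex: "\<exists>k. ?P k" using M unfolding max_val_def by blast
  have k: "T ?k = M" using GreatestI_ex_nat[OF ex bound] by blast
  have "T j < M" if "?k < j" for j
  proof -
    have "T j \<noteq> M" using Greatest_le_nat[of ?P j r] bound that by (meson leD)
    then show ?thesis using M unfolding max_val_def by (simp add: order.not_eq_order_implies_strict)
  qed
  then have "last_max T ?k" unfolding last_max_def using k M unfolding max_val_def by auto
  then show thesis by (rule that)
qed

section \<open>Cancellation in a signature with a periodic tail\<close>

locale signature =
  fixes e f :: "nat \<Rightarrow> int" and r :: nat
  assumes e_nonneg: "0 \<le> e k" and f_nonneg: "0 \<le> f k"
    and tail: "r \<le> k \<Longrightarrow> e k = f k \<and> f k = f r"
begin

abbreviation "V \<equiv> valley e f"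
abbreviation "T \<equiv> peak e f"

lemma V_le_T: "V k \<le> T k" and V_Suc_le_T: "V (Suc k) \<le> T k"
  using e_nonneg[of k] f_nonneg[of k] by (simp_all add: peak_def valley_Suc)

lemma T0: "0 \<le> T 0" using V_le_T[of 0] by simp

text \<open>A column of the tail climbs and descends by the same amount, as a copy of the
  ground-state column does; its signs never stop, but its peaks keep the height of the one at
  \<open>r\<close>.\<close>

lemma T_tail: "r \<le> k \<Longrightarrow> T k = T r"
proof (induction k rule: dec_induct)
  case (step n)
  have "T (Suc n) = T n - e n + f (Suc n)" by (simp add: peak_def[of _ _ "Suc n"] valley_Suc)
  then show ?case using step tail[of n] tail[of "Suc n"] by simp
qed simp

text \<open>The height of the lower end of the unit step that the sign contributes. Positions count
  from the left, the range is walked from the right: on the descending side the level grows with the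
  position, on the ascending side it falls.\<close>

definition sign_level :: "nat \<times> nat \<Rightarrow> int" where
  "sign_level p = (if int (snd p) < e (fst p) then V (Suc (fst p)) + int (snd p)
     else V (fst p) + e (fst p) + f (fst p) - 1 - int (snd p))"

definition is_minus where "is_minus p \<longleftrightarrow> int (snd p) < e (fst p)"
definition is_plus where
  "is_plus p \<longleftrightarrow> e (fst p) \<le> int (snd p) \<and> int (snd p) < e (fst p) + f (fst p)"

lemma minus_level: "is_minus p \<Longrightarrow> V (Suc (fst p)) \<le> sign_level p \<and> sign_level p < T (fst p)"
  and plus_level: "is_plus p \<Longrightarrow> V (fst p) \<le> sign_level p \<and> sign_level p < T (fst p)"
  by (auto simp: is_minus_def is_plus_def sign_level_def valley_Suc peak_def)

lemma minus_at:
  assumes "V (Suc k) \<le> l" "l < T k"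
  obtains j where "is_minus (k, j)" "sign_level (k, j) = l"
proof -
  have "int (nat (l - V (Suc k))) = l - V (Suc k)" using assms by simp
  moreover have "l - V (Suc k) < e k" using assms by (simp add: valley_Suc)
  ultimately show thesis using that[of "nat (l - V (Suc k))"] by (simp add: is_minus_def sign_level_def)
qed

lemma plus_at:
  assumes "V k \<le> l" "l < T k"
  obtains j where "is_plus (k, j)" "sign_level (k, j) = l"
proof -
  have "int (nat (e k + f k - 1 - (l - V k))) = e k + f k - 1 - (l - V k)"
    using assms e_nonneg[of k] by (simp add: peak_def)
  moreover have "l - V k < f k" using assms by (simp add: peak_def)
  ultimately show thesis using that[of "nat (e k + f k - 1 - (l - V k))"] assms
    by (simp add: is_plus_def sign_level_def)
qed

text \<open>Two signs cancel iff they face each other across a valley of the mountain range.\<close>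

definition pairs :: "nat \<times> nat \<Rightarrow> nat \<times> nat \<Rightarrow> bool" where
  "pairs p q \<longleftrightarrow> is_plus p \<and> is_minus q \<and> left_of p q \<and> sign_level p = sign_level q \<and>
     (\<forall>s. (is_plus s \<or> is_minus s) \<and> left_of p s \<and> left_of s q \<longrightarrow> sign_level s < sign_level p)"

lemma plus_level_less:
  assumes "is_plus p" "is_plus p'" "left_of p' p" "fst p = fst p'"
  shows "sign_level p < sign_level p'"
proof -
  obtain k j j' where "p = (k, j)" "p' = (k, j')" using assms(4) by (metis prod.collapse)
  then show ?thesis using assms by (simp add: left_of_def is_plus_def sign_level_def)
qed

lemma pairsD:
  assumes "pairs p q"
  shows "is_plus p" "is_minus q" "left_of p q" "sign_level p = sign_level q"
  using assms unfolding pairs_def by blast+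

lemma not_plus_minus: "is_plus p \<Longrightarrow> \<not> is_minus p"
  by (simp add: is_plus_def is_minus_def)

lemma pairs_fst: "pairs p q \<Longrightarrow> fst q < fst p"
  unfolding pairs_def left_of_def is_plus_def is_minus_def by auto

text \<open>A discrete intermediate value argument. To the right of \<open>p\<close> take the
  nearest column whose peak exceeds the level of \<open>p\<close>; the valley on its left is no
  higher than this level, so its slope carries a - at exactly the level of \<open>p\<close>.\<close>

lemma pairs_from_plus:
  assumes p: "is_plus p" and ex: "\<exists>k<fst p. sign_level p < T k"
  obtains q where "pairs p q" "\<And>k. fst q < k \<Longrightarrow> k < fst p \<Longrightarrow> T k \<le> sign_level p"
proof -
  let ?l = "sign_level p"
  let ?P = "\<lambda>k. k < fst p \<and> ?l < T k"
  let ?k = "GREATEST k. ?P k"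
  have bound: "k \<le> fst p" if "?P k" for k using that by auto
  have ex': "\<exists>k. ?P k" using ex by blast
  have k: "?P ?k" by (rule GreatestI_ex_nat[OF ex' bound])
  have gr: "T k \<le> ?l" if "?k < k" "k < fst p" for k
    using Greatest_le_nat[of ?P k "fst p"] bound that by (meson leD not_less)
  have "V (Suc ?k) \<le> ?l"
  proof (cases "Suc ?k = fst p")
    case True then show ?thesis using plus_level[OF p] by simp
  next
    case False
    then show ?thesis using k gr[of "Suc ?k"] V_le_T[of "Suc ?k"] by simp
  qed
  then obtain j where j: "is_minus (?k, j)" "sign_level (?k, j) = ?l" using k minus_at by blast
  have "pairs p (?k, j)"
    unfolding pairs_def
  proof (intro conjI allI impI)
    fix s assume s: "(is_plus s \<or> is_minus s) \<and> left_of p s \<and> left_of s (?k, j)"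
    consider "fst s = fst p" | "fst s = ?k" | "?k < fst s" "fst s < fst p"
      using s by (auto simp: left_of_def)
    then show "sign_level s < ?l"
    proof cases
      case 1
      then have "snd p < snd s" using s k by (auto simp: left_of_def)
      then show ?thesis using 1 p by (auto simp: is_plus_def sign_level_def)
    next
      case 2
      then have "snd s < j" using s k by (auto simp: left_of_def)
      then show ?thesis using 2 j by (auto simp: is_minus_def sign_level_def)
    next
      case 3
      have "sign_level s < T (fst s)" using s plus_level[of s] minus_level[of s] by blast
      then show ?thesis using gr[OF 3] by simp
    qed
  qed (use p j k in \<open>auto simp: left_of_def\<close>)
  then show thesis by (rule that) (simp add: gr)
qed

text \<open>The mirror image: the first column to the left of \<open>q\<close> with a peak above the
  level of \<open>q\<close> must climb through that level.\<close>

lemma pairs_from_minus: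
  assumes q: "is_minus q" and ex: "\<exists>k>fst q. sign_level q < T k"
  obtains p where "pairs p q" "\<And>k. fst q < k \<Longrightarrow> k < fst p \<Longrightarrow> T k \<le> sign_level q"
proof -
  let ?l = "sign_level q"
  let ?P = "\<lambda>k. fst q < k \<and> ?l < T k"
  obtain k where k: "?P k" and least: "\<forall>j<k. \<not> ?P j" using ex exists_least_iff[of ?P] by blast
  have le: "T j \<le> ?l" if "fst q < j" "j < k" for j
    using least that by (meson not_less)
  have "V k \<le> ?l"
  proof (cases "k = Suc (fst q)")
    case True then show ?thesis using minus_level[OF q] by simp
  next
    case False
    obtain k' where k': "k = Suc k'" using k by (cases k) auto
    then have "fst q < k'" using False k by simp
    then show ?thesis using le[of k'] V_Suc_le_T[of k'] k' by simp
  qed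
  then obtain j where j: "is_plus (k, j)" "sign_level (k, j) = ?l" using k plus_at by blast
  have "pairs (k, j) q"
    unfolding pairs_def
  proof (intro conjI allI impI)
    fix s assume s: "(is_plus s \<or> is_minus s) \<and> left_of (k, j) s \<and> left_of s q"
    consider "fst s = fst q" | "fst s = k" | "fst q < fst s" "fst s < k"
      using s by (auto simp: left_of_def)
    then have "sign_level s < ?l"
    proof cases
      case 1
      then have "snd s < snd q" using s k by (auto simp: left_of_def)
      then show ?thesis using 1 q by (auto simp: is_minus_def sign_level_def)
    next
      case 2
      then have "j < snd s" using s k by (auto simp: left_of_def)
      then show ?thesis using 2 j by (auto simp: is_plus_def sign_level_def)
    next
      case 3
      have "sign_level s < T (fst s)" using s plus_level[of s] minus_level[of s] by blast
      then show ?thesis using le[OF 3] by simp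
    qed
    then show "sign_level s < sign_level (k, j)" using j by simp
  qed (use q j k in \<open>auto simp: left_of_def\<close>)
  then show thesis by (rule that) (simp add: le)
qed

lemma left_of_linear: "p = q \<or> left_of p q \<or> left_of q p"
  by (cases p; cases q) (auto simp: left_of_def)

lemma left_of_irrefl: "\<not> left_of p p"
  by (auto simp: left_of_def)

text \<open>Of two partners of \<open>q\<close> the nearer one would lie between \<open>q\<close>
  and the farther one, hence strictly lower, although both have the level of
  \<open>q\<close>.\<close>

lemma pairs_unique_left:
  assumes "pairs p q" "pairs p' q"
  shows "p = p'"
proof -
  have False if "pairs a q" "pairs b q" "left_of a b" for a b
  proof -
    have "sign_level a = sign_level b" "is_plus b" "left_of b q" using that unfolding pairs_def by auto
    moreover have "sign_level b < sign_level a" using that calculation unfolding pairs_def by blast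
    ultimately show False by simp
  qed
  then show ?thesis using assms left_of_linear[of p p'] by blast
qed

lemma pairs_unique_right:
  assumes "pairs p q" "pairs p q'"
  shows "q = q'"
proof -
  have False if "pairs p a" "pairs p b" "left_of a b" for a b
  proof -
    have "sign_level a = sign_level p" "is_minus a" "left_of p a" using that unfolding pairs_def by auto
    moreover have "sign_level a < sign_level p" using that calculation unfolding pairs_def by blast
    ultimately show False by simp
  qed
  then show ?thesis using assms left_of_linear[of q q'] by blast
qed

text \<open>Every sign \<open>s\<close> between \<open>p\<close> and \<open>q\<close> is lower than
  both, and the peaks above \<open>p\<close> and \<open>q\<close> rise higher than \<open>s\<close>.
  So the search for the partner of \<open>s\<close> stops before it leaves the valley between
  \<open>p\<close> and \<open>q\<close>.\<close>

lemma pairs_nested: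
  assumes pq: "pairs p q" and s: "is_plus s \<or> is_minus s" "left_of p s" "left_of s q"
  obtains p' q' where "pairs p' q'" "left_of p p'" "left_of q' q" "s = p' \<or> s = q'"
proof -
  have lev: "sign_level s < sign_level p" using assms unfolding pairs_def by blast
  have Tp: "sign_level p < T (fst p)" "sign_level p < T (fst q)"
    using pq plus_level[of p] minus_level[of q] unfolding pairs_def by auto
  from s(1) show thesis
  proof
    assume plus: "is_plus s"
    have "fst q < fst s"
      using s(3) pq plus unfolding pairs_def left_of_def is_plus_def is_minus_def by auto
    then have ex: "\<exists>k<fst s. sign_level s < T k" using Tp lev by (intro exI[of _ "fst q"]) simp
    obtain q' where q': "pairs s q'" "\<And>k. fst q' < k \<Longrightarrow> k < fst s \<Longrightarrow> T k \<le> sign_level s"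
      by (rule pairs_from_plus[OF plus ex]) (rule that)
    have "fst q \<le> fst q'"
      using q'(2)[of "fst q"] Tp lev \<open>fst q < fst s\<close> by (cases "fst q' < fst q") simp_all
    moreover have "snd q' < snd q" if "fst q = fst q'"
    proof -
      have "is_minus q'" "is_minus q" "sign_level q' < sign_level q"
        using q'(1) pq lev unfolding pairs_def by auto
      then show ?thesis using that by (auto simp: is_minus_def sign_level_def)
    qed
    ultimately have "left_of q' q" by (auto simp: left_of_def)
    then show thesis by (rule that[OF q'(1) s(2)]) simp
  next
    assume minus: "is_minus s"
    have "fst s < fst p"
      using s(2) pq minus unfolding pairs_def left_of_def is_plus_def is_minus_def by auto
    then have ex: "\<exists>k>fst s. sign_level s < T k" using Tp lev by (intro exI[of _ "fst p"]) simp
    obtain p' where p': "pairs p' s" "\<And>k. fst s < k \<Longrightarrow> k < fst p' \<Longrightarrow> T k \<le> sign_level s"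
      by (rule pairs_from_minus[OF minus ex]) (rule that)
    have "fst p' \<le> fst p"
      using p'(2)[of "fst p"] Tp lev \<open>fst s < fst p\<close> by (cases "fst p < fst p'") simp_all
    moreover have "snd p < snd p'" if "fst p = fst p'"
    proof -
      have "is_plus p'" "is_plus p" "sign_level p' < sign_level p"
        using p'(1) pq lev unfolding pairs_def by auto
      then show ?thesis using that by (auto simp: is_plus_def sign_level_def)
    qed
    ultimately have "left_of p p'" by (auto simp: left_of_def)
    then show thesis using that[OF p'(1) _ s(3)] by simp
  qed
qed

text \<open>No sign strictly inside can be the partner of \<open>p\<close> or of \<open>q\<close>,
  because there it already cancels with an inner sign and partners are unique. The partner found
  across the valley thus lies in the column of the other sign, and the order of levels on one slope
  leaves only that sign itself.\<close>

lemma pairs_of_nested: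
  assumes p: "is_plus p" and q: "is_minus q" and pq: "left_of p q"
    and inner: "\<And>s. is_plus s \<or> is_minus s \<Longrightarrow> left_of p s \<Longrightarrow> left_of s q \<Longrightarrow>
      \<exists>p' q'. left_of p p' \<and> left_of q' q \<and> pairs p' q' \<and> (s = p' \<or> s = q')"
  shows "pairs p q"
proof -
  have right: "\<not> left_of q' q" if "pairs p q'" for q'
  proof
    assume l: "left_of q' q"
    have "left_of p q'" "is_minus q'" using pairsD[OF that] by blast+
    then obtain p1 q1 where "left_of p p1" "pairs p1 q1" "q' = p1 \<or> q' = q1"
      using inner[of q'] l by blast
    moreover have "q' \<noteq> p1" using pairsD(1)[OF \<open>pairs p1 q1\<close>] \<open>is_minus q'\<close> not_plus_minus by blast
    ultimately show False using pairs_unique_left[of p1 q1 p] that left_of_irrefl[of p] by blast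
  qed
  have left: "\<not> left_of p p'" if "pairs p' q" for p'
  proof
    assume l: "left_of p p'"
    have "left_of p' q" "is_plus p'" using pairsD[OF that] by blast+
    then obtain p1 q1 where "left_of q1 q" "pairs p1 q1" "p' = p1 \<or> p' = q1"
      using inner[of p'] l by blast
    moreover have "p' \<noteq> q1" using pairsD(2)[OF \<open>pairs p1 q1\<close>] \<open>is_plus p'\<close> not_plus_minus by blast
    ultimately show False using pairs_unique_right[of p1 q1 q] that left_of_irrefl[of q] by blast
  qed
  have fst: "fst q < fst p" using p q pq unfolding left_of_def is_plus_def is_minus_def by auto
  have Tp: "sign_level p < T (fst p)" and Tq: "sign_level q < T (fst q)"
    using plus_level[OF p] minus_level[OF q] by auto
  \<comment> \<open>If the peak in the column of \<open>q\<close> rises above \<open>p\<close>, then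
    \<open>p\<close> has a partner in that column, at \<open>q\<close> or to its right. Otherwise
    \<open>q\<close> is the lower of the two and its partner is followed instead.\<close>
  show ?thesis
  proof (cases "sign_level p < T (fst q)")
    case True
    then have ex: "\<exists>k<fst p. sign_level p < T k" using fst by blast
    obtain q' where q': "pairs p q'" "\<And>k. fst q' < k \<Longrightarrow> k < fst p \<Longrightarrow> T k \<le> sign_level p"
      by (rule pairs_from_plus[OF p ex]) (rule that)
    have "fst q \<le> fst q'" using q'(2)[of "fst q"] True fst by (cases "fst q' < fst q") simp_all
    then have "q' = q \<or> left_of q q' \<and> fst q = fst q'"
      using right[OF q'(1)] left_of_linear[of q q'] by (auto simp: left_of_def)
    then show ?thesis
    proof
      assume *: "left_of q q' \<and> fst q = fst q'"
      have "is_minus q'" "sign_level q' = sign_level p" using pairsD[OF q'(1)] by simp_all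
      then have less: "sign_level q < sign_level p" using * q by (auto simp: left_of_def is_minus_def sign_level_def)
      then have ex: "\<exists>k>fst q. sign_level q < T k" using fst Tp by (intro exI[of _ "fst p"]) simp
      obtain p' where p': "pairs p' q" "\<And>k. fst q < k \<Longrightarrow> k < fst p' \<Longrightarrow> T k \<le> sign_level q"
        by (rule pairs_from_minus[OF q ex]) (rule that)
      have "fst p' \<le> fst p" using p'(2)[of "fst p"] less Tp fst by (cases "fst p < fst p'") simp_all
      then have "p = p' \<or> left_of p' p \<and> fst p = fst p'"
        using left[OF p'(1)] left_of_linear[of p p'] by (auto simp: left_of_def)
      moreover have "\<not> (left_of p' p \<and> fst p = fst p')"
        using plus_level_less[OF p pairsD(1)[OF p'(1)]] pairsD(4)[OF p'(1)] less by auto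
      ultimately show ?thesis using p'(1) by blast
    qed (use q'(1) in simp)
  next
    case False
    then have less: "sign_level q < sign_level p" using Tq by simp
    then have ex: "\<exists>k>fst q. sign_level q < T k" using fst Tp by (intro exI[of _ "fst p"]) simp
    obtain p' where p': "pairs p' q" "\<And>k. fst q < k \<Longrightarrow> k < fst p' \<Longrightarrow> T k \<le> sign_level q"
      by (rule pairs_from_minus[OF q ex]) (rule that)
    have "fst p' \<le> fst p" using p'(2)[of "fst p"] less Tp fst by (cases "fst p < fst p'") simp_all
    then have "p = p' \<or> left_of p' p \<and> fst p = fst p'"
      using left[OF p'(1)] left_of_linear[of p p'] by (auto simp: left_of_def)
    moreover have "\<not> (left_of p' p \<and> fst p = fst p')"
      using plus_level_less[OF p pairsD(1)[OF p'(1)]] pairsD(4)[OF p'(1)] less by auto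
    ultimately show ?thesis using p'(1) by blast
  qed
qed

section \<open>Surviving signs: their number and their extreme columns\<close>

definition unpaired_plus :: "(nat \<times> nat) set" where
  "unpaired_plus = {p. is_plus p \<and> (\<forall>k<fst p. T k \<le> sign_level p)}"

definition unpaired_minus :: "(nat \<times> nat) set" where
  "unpaired_minus = {q. is_minus q \<and> (\<forall>k>fst q. T k \<le> sign_level q)}"

lemma unpaired_plusD: "p \<in> unpaired_plus \<Longrightarrow> is_plus p"
  and unpaired_minusD: "p \<in> unpaired_minus \<Longrightarrow> is_minus p"
  by (simp_all add: unpaired_plus_def unpaired_minus_def)

lemma no_pair_plus: "is_plus p \<Longrightarrow> (\<nexists>q. pairs p q) \<longleftrightarrow> p \<in> unpaired_plus"
proof -
  assume p: "is_plus p"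
  have "\<exists>k<fst p. sign_level p < T k" if "pairs p q" for q
    using pairs_fst[OF that] minus_level[of q] that unfolding pairs_def by auto
  moreover have "\<exists>q. pairs p q" if "\<exists>k<fst p. sign_level p < T k"
    using pairs_from_plus[OF p that] by blast
  ultimately show ?thesis using p unfolding unpaired_plus_def by (auto simp: not_less[symmetric])
qed

lemma no_pair_minus: "is_minus q \<Longrightarrow> (\<nexists>p. pairs p q) \<longleftrightarrow> q \<in> unpaired_minus"
proof -
  assume q: "is_minus q"
  have "\<exists>k>fst q. sign_level q < T k" if "pairs p q" for p
    using pairs_fst[OF that] plus_level[of p] that unfolding pairs_def by auto
  moreover have "\<exists>p. pairs p q" if "\<exists>k>fst q. sign_level q < T k"
    using pairs_from_minus[OF q that] by blast
  ultimately show ?thesis using q unfolding unpaired_minus_def by (auto simp: not_less[symmetric])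
qed

lemma sign_eqI:
  assumes "sign_level p = sign_level p'" "fst p = fst p'"
    and "is_plus p \<and> is_plus p' \<or> is_minus p \<and> is_minus p'"
  shows "p = p'"
proof -
  have "snd p = snd p'" using assms by (auto simp: is_plus_def is_minus_def sign_level_def)
  then show ?thesis using assms(2) by (simp add: prod_eq_iff)
qed

text \<open>Each level from 0 up to the maximum is crossed upwards for the first time by exactly one
  step, and these first crossings are the surviving +. Hence phi is the height of the highest
  peak.\<close>

lemma level_unpaired_plus:
  assumes M: "max_val T M"
  shows "bij_betw sign_level unpaired_plus {0..<M}"
proof (rule bij_betwI')
  fix p p' assume pp: "p \<in> unpaired_plus" "p' \<in> unpaired_plus"
  have "sign_level p \<noteq> sign_level p'" if "fst p < fst p'" "p \<in> unpaired_plus" "p' \<in> unpaired_plus" for p p'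
    using that plus_level[of p] unfolding unpaired_plus_def by auto
  then show "sign_level p = sign_level p' \<longleftrightarrow> p = p'"
    using pp sign_eqI[of p p'] unpaired_plusD[of p] unpaired_plusD[of p'] by (metis linorder_neqE_nat)
next
  fix p assume p: "p \<in> unpaired_plus"
  have "0 \<le> sign_level p"
  proof (cases "fst p = 0")
    case True
    then show ?thesis using p plus_level[of p] unfolding unpaired_plus_def by simp
  next
    case False
    then show ?thesis using p T0 unfolding unpaired_plus_def by force
  qed
  moreover have "sign_level p < M"
    using plus_level[OF unpaired_plusD[OF p]] max_valD[OF M, of "fst p"] by simp
  ultimately show "sign_level p \<in> {0..<M}" by simp
next
  fix l assume l: "l \<in> {0..<M}"
  then have "\<exists>k. l < T k" using M unfolding max_val_def by auto
  then obtain k where k: "l < T k" and least: "\<forall>j<k. \<not> l < T j"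
    using exists_least_iff[of "\<lambda>k. l < T k"] by blast
  have "V k \<le> l"
  proof (cases k)
    case 0
    then show ?thesis using l by simp
  next
    case (Suc k')
    then show ?thesis using least V_Suc_le_T[of k'] by force
  qed
  then obtain j where "is_plus (k, j)" "sign_level (k, j) = l" using plus_at k by blast
  then show "\<exists>p\<in>unpaired_plus. l = sign_level p"
    using least unfolding unpaired_plus_def by (intro bexI[of _ "(k, j)"]) auto
qed

text \<open>Here the last downward crossings count. A - at a level below \<open>T r\<close> has a
  higher peak of the tail to its left and therefore a partner, so eps is the height of the maximum
  over the peaks of the tail.\<close>

lemma level_unpaired_minus:
  assumes M: "max_val T M"
  shows "bij_betw sign_level unpaired_minus {T r..<M}"
proof (rule bij_betwI')
  fix p p' assume pp: "p \<in> unpaired_minus" "p' \<in> unpaired_minus"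
  have "sign_level p \<noteq> sign_level p'" if "fst p' < fst p" "p \<in> unpaired_minus" "p' \<in> unpaired_minus" for p p'
    using that minus_level[of p] unfolding unpaired_minus_def by auto
  then show "sign_level p = sign_level p' \<longleftrightarrow> p = p'"
    using pp sign_eqI[of p p'] unpaired_minusD[of p] unpaired_minusD[of p'] by (metis linorder_neqE_nat)
next
  fix p assume p: "p \<in> unpaired_minus"
  \<comment> \<open>The index \<open>max r (Suc (fst p))\<close> is a column that is strictly left
    of \<open>p\<close> and lies in the tail.\<close>
  have "T (max r (Suc (fst p))) \<le> sign_level p"
    using p unfolding unpaired_minus_def by (auto simp: less_max_iff_disj)
  then have "T r \<le> sign_level p" using T_tail[of "max r (Suc (fst p))"] by simp
  moreover have "sign_level p < M"
    using minus_level[OF unpaired_minusD[OF p]] max_valD[OF M, of "fst p"] by simp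
  ultimately show "sign_level p \<in> {T r..<M}" by simp
next
  fix l assume l: "l \<in> {T r..<M}"
  let ?P = "\<lambda>k. l < T k"
  have ex: "\<exists>k. ?P k" using M l unfolding max_val_def by auto
  have bound: "k \<le> r" if "?P k" for k
    using T_tail[of k] that l by (cases "k \<le> r") auto
  define k where "k = (GREATEST k. ?P k)"
  have k: "?P k" unfolding k_def using GreatestI_ex_nat[OF ex bound] by blast
  have gr: "T j \<le> l" if "k < j" for j
    using Greatest_le_nat[of ?P j r] bound that unfolding k_def by (meson leD not_less)
  have "V (Suc k) \<le> l" using gr[of "Suc k"] V_le_T[of "Suc k"] by simp
  then obtain j where "is_minus (k, j)" "sign_level (k, j) = l" using minus_at k by blast
  then show "\<exists>p\<in>unpaired_minus. l = sign_level p"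
    using gr unfolding unpaired_minus_def by (intro bexI[of _ "(k, j)"]) auto
qed

lemma card_unpaired_plus: "max_val T M \<Longrightarrow> int (card unpaired_plus) = M"
  using bij_betw_same_card[OF level_unpaired_plus, of M] T0
  unfolding max_val_def by (metis atLeastLessThan_iff card_atLeastLessThan_int diff_zero dual_order.trans nat_0_le)

lemma card_unpaired_minus: "max_val T M \<Longrightarrow> int (card unpaired_minus) = M - T r"
  using bij_betw_same_card[OF level_unpaired_minus, of M]
  unfolding max_val_def by (metis card_atLeastLessThan_int diff_ge_0_iff_ge nat_0_le)

text \<open>The leftmost surviving + is the one just below the maximum, at level
  \<open>T k - 1\<close>: a + beyond column \<open>k\<close> that survives would have to lie at or
  above the maximum.\<close>

lemma unpaired_plus_column:
  assumes k: "first_max T k"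
  shows "unpaired_plus \<noteq> {}" and "Max (fst ` unpaired_plus) = k"
proof -
  note M = first_max_max_val[OF k]
  have fin: "finite (fst ` unpaired_plus)"
    using bij_betw_finite[OF level_unpaired_plus[OF M]] by simp
  have "T k - 1 \<in> {0..<T k}" using k unfolding first_max_def by simp
  then obtain p where p: "p \<in> unpaired_plus" "sign_level p = T k - 1"
    using level_unpaired_plus[OF M] unfolding bij_betw_def by (metis imageE)
  have le: "fst p' \<le> k" if "p' \<in> unpaired_plus" for p'
  proof (rule ccontr)
    assume "\<not> fst p' \<le> k"
    then have "T k \<le> sign_level p'" using that unfolding unpaired_plus_def by simp
    then show False using bij_betwE[OF level_unpaired_plus[OF M]] that by auto
  qed
  have "T k \<le> T (fst p)" using p plus_level[of p] unfolding unpaired_plus_def by auto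
  then have "fst p = k" using le[OF p(1)] k unfolding first_max_def by (metis leD le_neq_implies_less)
  then show "Max (fst ` unpaired_plus) = k" using le p fin by (intro Max_eqI) auto
  show "unpaired_plus \<noteq> {}" using p by auto
qed

lemma unpaired_minus_column:
  assumes k: "last_max T k" and less: "T r < T k"
  shows "unpaired_minus \<noteq> {}" and "Min (fst ` unpaired_minus) = k"
proof -
  note M = last_max_max_val[OF k]
  have fin: "finite (fst ` unpaired_minus)"
    using bij_betw_finite[OF level_unpaired_minus[OF M]] by simp
  have "T k - 1 \<in> {T r..<T k}" using less by simp
  then obtain p where p: "p \<in> unpaired_minus" "sign_level p = T k - 1"
    using level_unpaired_minus[OF M] unfolding bij_betw_def by (metis imageE)
  have le: "k \<le> fst p'" if "p' \<in> unpaired_minus" for p'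
  proof (rule ccontr)
    assume "\<not> k \<le> fst p'"
    then have "T k \<le> sign_level p'" using that unfolding unpaired_minus_def by simp
    then show False using bij_betwE[OF level_unpaired_minus[OF M]] that by auto
  qed
  have "T k \<le> T (fst p)" using p minus_level[of p] unfolding unpaired_minus_def by auto
  then have "fst p = k" using le[OF p(1)] k unfolding last_max_def by (metis leD le_neq_implies_less)
  then show "Min (fst ` unpaired_minus) = k" using le p fin by (intro Min_eqI) auto
  show "unpaired_minus \<noteq> {}" using p by auto
qed

lemma cancels_iff_pairs:
  assumes plus: "plus_pos D i Y = {p. is_plus p}" and minus: "minus_pos D i Y = {q. is_minus q}"
  shows "cancels D i Y p q \<longleftrightarrow> pairs p q"
proof
  assume "cancels D i Y p q"
  then show "pairs p q"
  proof induction
    case (1 p q)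
    show ?case
    proof (rule pairs_of_nested)
      show "is_plus p" "is_minus q" "left_of p q" using 1(1-3) plus minus by simp_all
      fix s assume "is_plus s \<or> is_minus s" "left_of p s" "left_of s q"
      then show "\<exists>p' q'. left_of p p' \<and> left_of q' q \<and> pairs p' q' \<and> (s = p' \<or> s = q')"
        using 1(4)[of s] plus minus by blast
    qed
  qed
next
  assume "pairs p q"
  then show "cancels D i Y p q"
  \<comment> \<open>An inner pair spans fewer columns, or the same two columns with the - moved to
    the left, which lowers its position.\<close>
  proof (induction "(p, q)" arbitrary: p q rule: wf_induct_rule[OF wf_measures[of "[\<lambda>(p, q). fst p - fst q, \<lambda>(p, q). snd q]"]])
    case (1 p q)
    show ?case
    proof (rule cancels.intros)
      show "p \<in> plus_pos D i Y" "q \<in> minus_pos D i Y" "left_of p q"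
        using 1(2) plus minus unfolding pairs_def by auto
      fix s assume s: "s \<in> plus_pos D i Y \<union> minus_pos D i Y" "left_of p s" "left_of s q"
      have "is_plus s \<or> is_minus s" using s(1) plus minus by auto
      then obtain p' q' where p'q': "pairs p' q'" "left_of p p'" "left_of q' q" "s = p' \<or> s = q'"
        by (rule pairs_nested[OF 1(2) _ s(2,3)]) (rule that)
      have "cancels D i Y p' q'"
        by (rule 1(1)) (use p'q' pairs_fst[OF p'q'(1)] pairs_fst[OF 1(2)] in \<open>auto simp: left_of_def\<close>)
      then show "\<exists>p' q'. left_of p p' \<and> left_of q' q \<and> cancels D i Y p' q' \<and> (s = p' \<or> s = q')"
        using p'q' by blast
    qed
  qed
qed

lemma
  assumes plus: "plus_pos D i Y = {p. is_plus p}" and minus: "minus_pos D i Y = {q. is_minus q}"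
  shows plus_left_eq: "plus_left D i Y = unpaired_plus"
    and minus_left_eq: "minus_left D i Y = unpaired_minus"
proof -
  have "{p \<in> Collect is_plus. \<nexists>q. pairs p q} = unpaired_plus"
    using no_pair_plus unpaired_plusD by blast
  then show "plus_left D i Y = unpaired_plus"
    unfolding plus_left_def cancels_iff_pairs[OF assms] plus .
  have "{q \<in> Collect is_minus. \<nexists>p. pairs p q} = unpaired_minus"
    using no_pair_minus unpaired_minusD by blast
  then show "minus_left D i Y = unpaired_minus"
    unfolding minus_left_def cancels_iff_pairs[OF assms] minus .
qed

end

section \<open>Effect of an operator on the mountain range\<close>

lemma valley_upd:
  assumes "e' = e(k := e k + d)" "f' = f(k := f k - d)"
  shows "valley e' f' j = valley e f j - (if k < j then 2 * d else 0)"
proof -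
  have "valley e' f' j = (\<Sum>m<j. (f m - e m) - (if m = k then 2 * d else 0))"
    unfolding valley_def assms by (rule sum.cong) auto
  then show ?thesis by (simp add: sum_subtractf valley_def)
qed

text \<open>\<open>d = 1\<close> is a lowering operator, which turns a + of column \<open>k\<close>
  into a -, and \<open>d = -1\<close> a raising one. That the peaks further left move twice as far
  is what turns a first maximum into a last one and back.\<close>

lemma peak_upd:
  assumes "e' = e(k := e k + d)" "f' = f(k := f k - d)"
  shows "peak e' f' j = peak e f j - (if k < j then 2 * d else if k = j then d else 0)"
  using valley_upd[OF assms, of j] by (auto simp: peak_def assms(2))

section \<open>Crystals of paths\<close>

text \<open>\<open>h_left\<close> and \<open>h_right\<close> say that \<open>h\<close> is constant on the connected components of the tensor
  square; since an operator acting on a path acts on each pair of adjacent factors by the tensor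
  product rule, this preserves the condition \<open>h (p (k + 1)) (p k) < 2\<close>.\<close>

locale path_data =
  fixes U :: "'b crystal" and \<alpha> :: "ind \<Rightarrow> weight" and gs :: "nat \<Rightarrow> 'b"
    and h :: "'b \<Rightarrow> 'b \<Rightarrow> int" and lam :: weight
  assumes U: "kashiwara_crystal UNIV \<alpha> U"
    and eps_nonneg: "b \<in> carr U \<Longrightarrow> 0 \<le> eps U i b"
    and phi_nonneg: "b \<in> carr U \<Longrightarrow> 0 \<le> phi U i b"
    and gs: "gs k \<in> carr U"
    and gs_eps: "eps U i (gs k) = pairing i lam"
    and gs_phi: "phi U i (gs k) = pairing i lam"
    and h_left: "a \<in> carr U \<Longrightarrow> b \<in> carr U \<Longrightarrow> eps U i b < phi U i a \<Longrightarrow>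
      ft U i a = Some a' \<Longrightarrow> h a' b = h a b"
    and h_right: "a \<in> carr U \<Longrightarrow> b \<in> carr U \<Longrightarrow> phi U i a \<le> eps U i b \<Longrightarrow>
      ft U i b = Some b' \<Longrightarrow> h a b' = h a b"
begin

lemma U_ft:
  assumes b: "b \<in> carr U" "ft U i b = Some b'"
  shows "b' \<in> carr U \<and> et U i b' = Some b \<and>
    wt U b' = wt U b - \<alpha> i \<and> eps U i b' = eps U i b + 1 \<and> phi U i b' = phi U i b - 1"
proof -
  have *: "b' \<in> carr U \<and> wt U b' = wt U b - \<alpha> i \<and> eps U i b' = eps U i b + 1 \<and> phi U i b' = phi U i b - 1"
    using U b unfolding kashiwara_crystal_def by blast
  moreover have "et U i b' = Some b" using U b * unfolding kashiwara_crystal_def by blast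
  ultimately show ?thesis by blast
qed

lemma U_et:
  assumes b: "b \<in> carr U" "et U i b = Some b'"
  shows "b' \<in> carr U \<and> ft U i b' = Some b \<and>
    wt U b' = wt U b + \<alpha> i \<and> eps U i b' = eps U i b - 1 \<and> phi U i b' = phi U i b + 1"
proof -
  have *: "b' \<in> carr U \<and> wt U b' = wt U b + \<alpha> i \<and> eps U i b' = eps U i b - 1 \<and> phi U i b' = phi U i b + 1"
    using U b unfolding kashiwara_crystal_def by blast
  moreover have "ft U i b' = Some b" using U b * unfolding kashiwara_crystal_def by blast
  ultimately show ?thesis by blast
qed

lemma U_wt:
  assumes "b \<in> carr U"
  shows "pairing i (wt U b) = phi U i b - eps U i b"
proof -
  have "phi U i b = eps U i b + pairing i (wt U b)"
    using U assms unfolding kashiwara_crystal_def by blast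
  then show ?thesis by simp
qed

text \<open>Raising \<open>a\<close> to \<open>a'\<close> is lowering \<open>a'\<close> to
  \<open>a\<close>. As phi of \<open>a'\<close> is larger by one, the weak inequality of the raising
  rule becomes the strict one of the lowering rule.\<close>

lemma h_et_left:
  assumes "a \<in> carr U" "b \<in> carr U" "eps U i b \<le> phi U i a" "et U i a = Some a'"
  shows "h a' b = h a b"
  using h_left[of a' b i a] U_et[OF assms(1,4)] assms by simp

lemma h_et_right:
  assumes "a \<in> carr U" "b \<in> carr U" "phi U i a < eps U i b" "et U i b = Some b'"
  shows "h a b' = h a b"
  using h_right[of a b' i b] U_et[OF assms(2,4)] assms by simp

definition stable :: "(nat \<Rightarrow> 'b) \<Rightarrow> nat \<Rightarrow> bool" where
  "stable p r \<longleftrightarrow> (\<forall>k\<ge>r. p k = gs k)"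

definition paths :: "(nat \<Rightarrow> 'b) set" where
  "paths = {p. (\<forall>k. p k \<in> carr U) \<and> (\<exists>r. stable p r) \<and> (\<forall>k. h (p (Suc k)) (p k) < 2)}"

definition peaks :: "(nat \<Rightarrow> 'b) \<Rightarrow> ind \<Rightarrow> nat \<Rightarrow> int" where
  "peaks p i = peak (\<lambda>k. eps U i (p k)) (\<lambda>k. phi U i (p k))"

lemma pathsD: "p \<in> paths \<Longrightarrow> p k \<in> carr U"
  by (simp add: paths_def)

lemma stable_mono: "stable p r \<Longrightarrow> r \<le> s \<Longrightarrow> stable p s"
  by (simp add: stable_def)

lemma signature:
  assumes "\<And>k. p k \<in> carr U" "stable p r"
  shows "signature (\<lambda>k. eps U i (p k)) (\<lambda>k. phi U i (p k)) r"
  using assms eps_nonneg phi_nonneg gs_eps gs_phi by unfold_locales (auto simp: stable_def)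

lemma peaks_Suc: "peaks p i (Suc k) = peaks p i k - eps U i (p k) + phi U i (p (Suc k))"
  by (simp add: peaks_def peak_def[of _ _ "Suc k"] valley_Suc)

lemma peaks_upd:
  assumes "eps U i b = eps U i (p k) + d" "phi U i b = phi U i (p k) - d"
  shows "peaks (p(k := b)) i j = peaks p i j - (if k < j then 2 * d else if k = j then d else 0)"
  unfolding peaks_def by (rule peak_upd) (use assms in auto)

text \<open>Comparing adjacent peaks is comparing phi of the left factor with eps of the right one.
  So the first maximum is the place where the tensor product rule acts on factor \<open>k\<close>
  both in the pair with its left and in the pair with its right neighbour.\<close>

lemma path_ft:
  assumes p: "p \<in> paths" and k: "first_max (peaks p i) k" and b: "ft U i (p k) = Some b"
  shows "p(k := b) \<in> paths" "last_max (peaks (p(k := b)) i) k"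
proof -
  note b' = U_ft[OF pathsD[OF p] b]
  obtain r where "stable p r" using p unfolding paths_def by blast
  then have "stable (p(k := b)) (max r (Suc k))" by (simp add: stable_def)
  moreover have "h ((p(k := b)) (Suc j)) ((p(k := b)) j) < 2" for j
  proof -
    have j: "h (p (Suc j)) (p j) < 2" using p unfolding paths_def by blast
    consider "j = k" | "Suc j = k" | "j \<noteq> k" "Suc j \<noteq> k" by blast
    then show ?thesis
    proof cases
      case 1
      have "peaks p i (Suc k) \<le> peaks p i k" using k unfolding first_max_def by simp
      then have "phi U i (p (Suc k)) \<le> eps U i (p k)" by (simp add: peaks_Suc)
      then show ?thesis using h_right[OF pathsD[OF p] pathsD[OF p] _ b, of "Suc k"] 1 j by simp
    next
      case 2
      have "peaks p i j < peaks p i (Suc j)" using k 2 unfolding first_max_def by auto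
      then have "eps U i (p j) < phi U i (p k)" using 2 peaks_Suc[of p i j] by auto
      then show ?thesis using h_left[OF pathsD[OF p] pathsD[OF p] _ b, of j] 2 j by auto
    qed (use j in auto)
  qed
  ultimately show "p(k := b) \<in> paths" using p b' unfolding paths_def by auto
  \<comment> \<open>Earlier peaks were lower by at least 1 and are unchanged, peak \<open>k\<close>
    drops by 1, later peaks drop by 2.\<close>
  show "last_max (peaks (p(k := b)) i) k"
    using k peaks_upd[of i b p k 1] b' unfolding first_max_def last_max_def by force
qed

lemma path_et:
  assumes p: "p \<in> paths" and k: "last_max (peaks p i) k" and b: "et U i (p k) = Some b"
  shows "p(k := b) \<in> paths" "first_max (peaks (p(k := b)) i) k"
proof -
  note b' = U_et[OF pathsD[OF p] b]
  obtain r where r: "stable p r" using p unfolding paths_def by blast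
  then have "stable (p(k := b)) (max r (Suc k))" by (simp add: stable_def)
  moreover have "h ((p(k := b)) (Suc j)) ((p(k := b)) j) < 2" for j
  proof -
    have j: "h (p (Suc j)) (p j) < 2" using p unfolding paths_def by blast
    consider "j = k" | "Suc j = k" | "j \<noteq> k" "Suc j \<noteq> k" by blast
    then show ?thesis
    proof cases
      case 1
      have "peaks p i (Suc k) < peaks p i k" using k unfolding last_max_def by simp
      then have "phi U i (p (Suc k)) < eps U i (p k)" by (simp add: peaks_Suc)
      then show ?thesis using h_et_right[OF pathsD[OF p] pathsD[OF p] _ b, of "Suc k"] 1 j by simp
    next
      case 2
      have "peaks p i j \<le> peaks p i (Suc j)" using k 2 unfolding last_max_def by auto
      then have "eps U i (p j) \<le> phi U i (p k)" using 2 peaks_Suc[of p i j] by auto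
      then show ?thesis using h_et_left[OF pathsD[OF p] pathsD[OF p] _ b, of j] 2 j by auto
    qed (use j in auto)
  qed
  ultimately show "p(k := b) \<in> paths" using p b' unfolding paths_def by auto
  \<comment> \<open>\<open>first_max\<close> demands positive height. The old maximum is at least
    the first peak, hence nonnegative, and raising adds 1.\<close>
  have "0 \<le> peaks p i 0" using signature.T0[OF signature[OF pathsD[OF p] r]] unfolding peaks_def .
  then have "0 \<le> peaks p i k" using max_valD[OF last_max_max_val[OF k]] by (meson order_trans)
  then show "first_max (peaks (p(k := b)) i) k"
    using k peaks_upd[of i b p k "-1"] b' unfolding first_max_def last_max_def by force
qed

end

section \<open>Crystals whose structure is read off from the mountain range\<close>

locale path_crystal = path_data U \<alpha> gs h lam
  for U :: "'b crystal" and \<alpha> gs h lam +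
  fixes Z :: "(nat \<Rightarrow> 'b) crystal"
  assumes carr: "carr Z = paths"
    and wt: "p \<in> paths \<Longrightarrow> stable p r \<Longrightarrow> wt Z p = lam + (\<Sum>k<r. wt U (p k) - wt U (gs k))"
    and phi: "p \<in> paths \<Longrightarrow> max_val (peaks p i) (phi Z i p)"
    and eps: "p \<in> paths \<Longrightarrow> stable p r \<Longrightarrow> eps Z i p = phi Z i p - peaks p i r"
    and ft: "p \<in> paths \<Longrightarrow> ft Z i p = Some q \<longleftrightarrow>
      (\<exists>k b. first_max (peaks p i) k \<and> ft U i (p k) = Some b \<and> q = p(k := b))"
    and et: "p \<in> paths \<Longrightarrow> et Z i p = Some q \<longleftrightarrow>
      (\<exists>k b. last_max (peaks p i) k \<and> et U i (p k) = Some b \<and> q = p(k := b))"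
begin

lemma wt_upd:
  assumes p: "p \<in> paths" and q: "p(k := b) \<in> paths" and b: "wt U b = wt U (p k) + d"
  shows "wt Z (p(k := b)) = wt Z p + d"
proof -
  obtain r where r: "stable p r" using p unfolding paths_def by blast
  define s where "s = max r (Suc k)"
  then have "k < s" by simp
  have "(\<Sum>j<s. wt U ((p(k := b)) j) - wt U (gs j)) =
      (\<Sum>j<s. (wt U (p j) - wt U (gs j)) + (if j = k then d else 0))"
    by (rule sum.cong) (auto simp: b)
  also have "\<dots> = (\<Sum>j<s. wt U (p j) - wt U (gs j)) + d"
    using \<open>k < s\<close> by (simp add: sum.distrib)
  finally show ?thesis
    using wt[OF p stable_mono[OF r, of s]] wt[OF q, of s] r by (simp add: s_def stable_def)
qed

lemma eps_phi_upd:
  assumes p: "p \<in> paths" and q: "p(k := b) \<in> paths"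
    and b: "eps U i b = eps U i (p k) + d" "phi U i b = phi U i (p k) - d"
    and k: "peaks p i k = phi Z i p" "max_val (peaks (p(k := b)) i) (peaks (p(k := b)) i k)"
  shows "phi Z i (p(k := b)) = phi Z i p - d" "eps Z i (p(k := b)) = eps Z i p + d"
proof -
  obtain r where r: "stable p r" using p unfolding paths_def by blast
  \<comment> \<open>Both paths are stable from \<open>s\<close> on and \<open>s\<close> lies beyond
    \<open>k\<close>. The peak at \<open>s\<close> therefore changes by \<open>- 2 * d\<close> and
    phi by \<open>- d\<close>, which leaves \<open>+ d\<close> for eps.\<close>
  define s where "s = max r (Suc k)"
  have s: "stable p s" "stable (p(k := b)) s" using r unfolding stable_def s_def by auto
  show *: "phi Z i (p(k := b)) = phi Z i p - d"
    using max_val_unique[OF phi[OF q, of i] k(2)] peaks_upd[of i b p k d k] b k(1) by simp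
  show "eps Z i (p(k := b)) = eps Z i p + d"
    using * eps[OF p s(1), of i] eps[OF q s(2), of i] peaks_upd[of i b p k d s] b
    by (simp add: s_def less_max_iff_disj)
qed

lemma ft_props:
  assumes p: "p \<in> paths" and q: "ft Z i p = Some q"
  shows "q \<in> paths" "wt Z q = wt Z p - \<alpha> i" "eps Z i q = eps Z i p + 1" "phi Z i q = phi Z i p - 1"
    "et Z i q = Some p"
proof -
  obtain k b where k: "first_max (peaks p i) k" and b: "ft U i (p k) = Some b" and q_eq: "q = p(k := b)"
    using q ft[OF p] by blast
  note b' = U_ft[OF pathsD[OF p] b]
  note pf = path_ft[OF p k b]
  show "q \<in> paths" using pf q_eq by simp
  show "wt Z q = wt Z p - \<alpha> i" using wt_upd[OF p pf(1), of "- \<alpha> i"] b' q_eq by simp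
  have "peaks p i k = phi Z i p" using max_val_unique[OF phi[OF p] first_max_max_val[OF k]] by simp
  then show "eps Z i q = eps Z i p + 1" "phi Z i q = phi Z i p - 1"
    using eps_phi_upd[OF p pf(1), of i 1] last_max_max_val[OF pf(2)] b' q_eq by simp_all
  show "et Z i q = Some p"
    unfolding et[OF \<open>q \<in> paths\<close>] using pf(2) b' q_eq by (intro exI[of _ k] exI[of _ "p k"]) simp
qed

lemma et_props:
  assumes p: "p \<in> paths" and q: "et Z i p = Some q"
  shows "q \<in> paths" "wt Z q = wt Z p + \<alpha> i" "eps Z i q = eps Z i p - 1" "phi Z i q = phi Z i p + 1"
    "ft Z i q = Some p"
proof -
  obtain k b where k: "last_max (peaks p i) k" and b: "et U i (p k) = Some b" and q_eq: "q = p(k := b)"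
    using q et[OF p] by blast
  note b' = U_et[OF pathsD[OF p] b]
  note pf = path_et[OF p k b]
  show "q \<in> paths" using pf q_eq by simp
  show "wt Z q = wt Z p + \<alpha> i" using wt_upd[OF p pf(1), of "\<alpha> i"] b' q_eq by simp
  have "peaks p i k = phi Z i p" using max_val_unique[OF phi[OF p] last_max_max_val[OF k]] by simp
  then show "eps Z i q = eps Z i p - 1" "phi Z i q = phi Z i p + 1"
    using eps_phi_upd[OF p pf(1), of i "-1"] first_max_max_val[OF pf(2)] b' q_eq by simp_all
  show "ft Z i q = Some p"
    unfolding ft[OF \<open>q \<in> paths\<close>] using pf(2) b' q_eq by (intro exI[of _ k] exI[of _ "p k"]) simp
qed

text \<open>Phi minus eps is the height of the tail. The valley at \<open>r\<close> telescopes to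
  the pairing with the weight gained by the first \<open>r\<close> factors, and the ground-state
  factor at \<open>r\<close> adds the pairing with \<open>lam\<close>.\<close>

lemma phi_eps_wt:
  assumes p: "p \<in> paths"
  shows "phi Z i p = eps Z i p + pairing i (wt Z p)"
proof -
  obtain r where r: "stable p r" using p unfolding paths_def by blast
  have add: "pairing i (a + b) = pairing i a + pairing i b" for a b by (simp add: pairing_def)
  have "pairing i (\<Sum>k<n. wt U (p k) - wt U (gs k)) = valley (\<lambda>k. eps U i (p k)) (\<lambda>k. phi U i (p k)) n" for n
  proof (induction n)
    case (Suc n)
    have "pairing i (wt U (p n) - wt U (gs n)) = phi U i (p n) - eps U i (p n)"
      using add[of "wt U (p n) - wt U (gs n)" "wt U (gs n)"] U_wt[OF gs, of i n] U_wt[OF pathsD[OF p], of i n]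
        gs_eps gs_phi by simp
    then show ?case using Suc by (simp add: add valley_def)
  qed (simp add: pairing_def)
  then have "pairing i (wt Z p) = peaks p i r"
    using r wt[OF p r] gs_phi by (simp add: add peaks_def peak_def stable_def)
  then show ?thesis using eps[OF p r, of i] by simp
qed

lemma kashiwara: "kashiwara_crystal UNIV \<alpha> Z"
  unfolding kashiwara_crystal_def carr
proof (intro conjI allI ballI impI)
  fix i p q assume "p \<in> paths" "q \<in> paths"
  then show "ft Z i p = Some q \<longleftrightarrow> et Z i q = Some p"
    using ft_props(5) et_props(5) by blast
qed (auto intro: phi_eps_wt ft_props et_props)

end

section \<open>Tensor powers\<close>

text \<open>The initial value 0 is phi of the empty tensor power.\<close>

primrec running_max :: "(nat \<Rightarrow> int) \<Rightarrow> nat \<Rightarrow> int" where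
  "running_max T 0 = 0"
| "running_max T (Suc n) = max (running_max T n) (T n)"

text \<open>The factor with the largest index is the leftmost. Strict and weak inequality in
  \<open>f_position\<close> and \<open>e_position\<close> reproduce the ties of the tensor product
  rule, where lowering goes to the right factor and raising to the left one.\<close>

primrec f_position :: "(nat \<Rightarrow> int) \<Rightarrow> nat \<Rightarrow> nat option" where
  "f_position T 0 = None"
| "f_position T (Suc n) = (if running_max T n < T n then Some n else f_position T n)"

primrec e_position :: "(nat \<Rightarrow> int) \<Rightarrow> nat \<Rightarrow> nat option" where
  "e_position T 0 = None"
| "e_position T (Suc n) = (if running_max T n \<le> T n then Some n else e_position T n)"

lemma running_max_less: "running_max T n < x \<longleftrightarrow> 0 < x \<and> (\<forall>j<n. T j < x)"
  by (induction n) (auto simp: less_Suc_eq)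

lemma running_max_le: "running_max T n \<le> x \<longleftrightarrow> 0 \<le> x \<and> (\<forall>j<n. T j \<le> x)"
  by (induction n) (auto simp: less_Suc_eq)

lemma f_position_eq_Some:
  "f_position T n = Some k \<longleftrightarrow> k < n \<and> 0 < T k \<and> (\<forall>j<k. T j < T k) \<and> (\<forall>j. k < j \<and> j < n \<longrightarrow> T j \<le> T k)"
proof (induction n)
  case (Suc n)
  show ?case
  proof (cases "running_max T n < T n")
    case True
    then have *: "0 < T n" "\<forall>j<n. T j < T n" by (simp_all add: running_max_less)
    show ?thesis
    proof
      assume "f_position T (Suc n) = Some k"
      then have "k = n" using True by simp
      then show "k < Suc n \<and> 0 < T k \<and> (\<forall>j<k. T j < T k) \<and> (\<forall>j. k < j \<and> j < Suc n \<longrightarrow> T j \<le> T k)"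
        using * by auto
    next
      assume r: "k < Suc n \<and> 0 < T k \<and> (\<forall>j<k. T j < T k) \<and> (\<forall>j. k < j \<and> j < Suc n \<longrightarrow> T j \<le> T k)"
      have "k = n"
      proof (rule ccontr)
        assume "k \<noteq> n"
        then have "k < n" using r by simp
        then have "T n \<le> T k" "T k < T n" using r * by auto
        then show False by simp
      qed
      then show "f_position T (Suc n) = Some k" using True by simp
    qed
  next
    case False
    have "T n \<le> T k" if "k < n" "0 < T k" "\<forall>j<k. T j < T k" "\<forall>j. k < j \<and> j < n \<longrightarrow> T j \<le> T k"
    proof -
      have "running_max T n \<le> T k" unfolding running_max_le using that by (metis linorder_neqE_nat less_imp_le order_refl)
      then show ?thesis using False by simp
    qed
    moreover have "\<not> (k = n \<and> 0 < T k \<and> (\<forall>j<k. T j < T k))" using False running_max_less by blast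
    ultimately show ?thesis using Suc False by (auto simp: less_Suc_eq)
  qed
qed simp

lemma e_position_eq_Some:
  "e_position T n = Some k \<longleftrightarrow> k < n \<and> 0 \<le> T k \<and> (\<forall>j<k. T j \<le> T k) \<and> (\<forall>j. k < j \<and> j < n \<longrightarrow> T j < T k)"
proof (induction n)
  case (Suc n)
  show ?case
  proof (cases "running_max T n \<le> T n")
    case True
    then have *: "0 \<le> T n" "\<forall>j<n. T j \<le> T n" by (simp_all add: running_max_le)
    show ?thesis
    proof
      assume "e_position T (Suc n) = Some k"
      then have "k = n" using True by simp
      then show "k < Suc n \<and> 0 \<le> T k \<and> (\<forall>j<k. T j \<le> T k) \<and> (\<forall>j. k < j \<and> j < Suc n \<longrightarrow> T j < T k)"
        using * by auto
    next
      assume r: "k < Suc n \<and> 0 \<le> T k \<and> (\<forall>j<k. T j \<le> T k) \<and> (\<forall>j. k < j \<and> j < Suc n \<longrightarrow> T j < T k)"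
      have "k = n"
      proof (rule ccontr)
        assume "k \<noteq> n"
        then have "k < n" using r by simp
        then have "T n < T k" "T k \<le> T n" using r * by auto
        then show False by simp
      qed
      then show "e_position T (Suc n) = Some k" using True by simp
    qed
  next
    case False
    have "T n < T k" if "k < n" "0 \<le> T k" "\<forall>j<k. T j \<le> T k" "\<forall>j. k < j \<and> j < n \<longrightarrow> T j < T k"
    proof -
      have "running_max T n \<le> T k" unfolding running_max_le using that by (metis linorder_neqE_nat less_imp_le order_refl)
      then show ?thesis using False by simp
    qed
    moreover have "\<not> (k = n \<and> 0 \<le> T k \<and> (\<forall>j<k. T j \<le> T k))" using False running_max_le by blast
    ultimately show ?thesis using Suc False by (auto simp: less_Suc_eq)
  qed
qed simp

lemma segment_Suc: "segment p (Suc n) = p n # segment p n"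
  by (simp add: segment_def)

lemma segment_upd: "n \<le> k \<Longrightarrow> segment (p(k := b)) n = segment p n"
  by (auto simp: segment_def)

lemma put_segment: "(\<And>k. n \<le> k \<Longrightarrow> q k = p k) \<Longrightarrow> put_segment p (segment q n) = q"
  by (rule ext) (auto simp: put_segment_def segment_def)

section \<open>Tensor powers along a path\<close>

context path_data
begin

lemma pairing_add: "pairing i (a + b) = pairing i a + pairing i b"
  by (simp add: pairing_def)

text \<open>The maxima in the tensor product formulas for eps and phi are the recursion of
  \<open>running_max\<close>: phi is the highest level reached, counting the starting level 0, and
  eps the descent from there to the end of the range.\<close>

lemma tensor_power_segment:
  assumes p: "\<And>k. p k \<in> carr U"
  shows "pairing i (wt (tensor_power U n) (segment p n)) =
      valley (\<lambda>k. eps U i (p k)) (\<lambda>k. phi U i (p k)) n"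
    and "eps (tensor_power U n) i (segment p n) = running_max (peaks p i) n -
      valley (\<lambda>k. eps U i (p k)) (\<lambda>k. phi U i (p k)) n"
    and "phi (tensor_power U n) i (segment p n) = running_max (peaks p i) n"
proof (induction n)
  case 0
  show "pairing i (wt (tensor_power U 0) (segment p 0)) = valley (\<lambda>k. eps U i (p k)) (\<lambda>k. phi U i (p k)) 0"
    "eps (tensor_power U 0) i (segment p 0) = running_max (peaks p i) 0 -
      valley (\<lambda>k. eps U i (p k)) (\<lambda>k. phi U i (p k)) 0"
    "phi (tensor_power U 0) i (segment p 0) = running_max (peaks p i) 0"
    by (simp_all add: pairing_def)
next
  case (Suc n)
  note wt = U_wt[OF p, of i n]
  let ?V = "valley (\<lambda>k. eps U i (p k)) (\<lambda>k. phi U i (p k))"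
  have V: "?V (Suc n) = ?V n + phi U i (p n) - eps U i (p n)" by (simp add: valley_def)
  have T: "peaks p i n = ?V n + phi U i (p n)" by (simp add: peaks_def peak_def)
  show "pairing i (wt (tensor_power U (Suc n)) (segment p (Suc n))) = ?V (Suc n)"
    using Suc by (simp add: segment_Suc tensor_def Let_def pairing_add wt V)
  show "eps (tensor_power U (Suc n)) i (segment p (Suc n)) = running_max (peaks p i) (Suc n) - ?V (Suc n)"
    using Suc by (simp add: segment_Suc tensor_def Let_def wt V T)
  show "phi (tensor_power U (Suc n)) i (segment p (Suc n)) = running_max (peaks p i) (Suc n)"
    using Suc by (simp add: segment_Suc tensor_def Let_def wt V T max_def)
qed

lemma tensor_power_ft:
  assumes p: "\<And>k. p k \<in> carr U"
  shows "ft (tensor_power U n) i (segment p n) = (case f_position (peaks p i) n of None \<Rightarrow> None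
    | Some k \<Rightarrow> map_option (\<lambda>b. segment (p(k := b)) n) (ft U i (p k)))"
proof (induction n)
  case (Suc n)
  \<comment> \<open>Adding the valley at \<open>n\<close> turns phi of factor \<open>n\<close> into
    its peak and eps of the remaining factors into their highest level.\<close>
  have cond: "phi U i (p n) > eps (tensor_power U n) i (segment p n) \<longleftrightarrow> running_max (peaks p i) n < peaks p i n"
    using tensor_power_segment(2)[where n = n and i = i, OF p] by (auto simp: peaks_def peak_def)
  show ?case
  proof (cases "running_max (peaks p i) n < peaks p i n")
    case True
    then have "ft (tensor_power U (Suc n)) i (segment p (Suc n)) =
        map_option (\<lambda>b. b # segment p n) (ft U i (p n))"
      using cond by (simp add: segment_Suc tensor_def Let_def option.map_comp comp_def)
    then show ?thesis using True by (simp add: segment_Suc segment_upd)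
  next
    case False
    then have "ft (tensor_power U (Suc n)) i (segment p (Suc n)) =
        map_option ((#) (p n)) (ft (tensor_power U n) i (segment p n))"
      using cond by (simp add: segment_Suc tensor_def Let_def option.map_comp comp_def)
    also have "\<dots> = (case f_position (peaks p i) (Suc n) of None \<Rightarrow> None
        | Some k \<Rightarrow> map_option (\<lambda>b. segment (p(k := b)) (Suc n)) (ft U i (p k)))"
    proof (cases "f_position (peaks p i) n")
      case (Some k)
      then have "k < n" using f_position_eq_Some by blast
      then show ?thesis using Suc False Some by (simp add: segment_Suc option.map_comp comp_def)
    qed (use Suc False in simp)
    finally show ?thesis .
  qed
qed simp

lemma tensor_power_et:
  assumes p: "\<And>k. p k \<in> carr U"
  shows "et (tensor_power U n) i (segment p n) = (case e_position (peaks p i) n of None \<Rightarrow> None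
    | Some k \<Rightarrow> map_option (\<lambda>b. segment (p(k := b)) n) (et U i (p k)))"
proof (induction n)
  case (Suc n)
  have cond: "phi U i (p n) \<ge> eps (tensor_power U n) i (segment p n) \<longleftrightarrow> running_max (peaks p i) n \<le> peaks p i n"
    using tensor_power_segment(2)[where n = n and i = i, OF p] by (auto simp: peaks_def peak_def)
  show ?case
  proof (cases "running_max (peaks p i) n \<le> peaks p i n")
    case True
    then have "et (tensor_power U (Suc n)) i (segment p (Suc n)) =
        map_option (\<lambda>b. b # segment p n) (et U i (p n))"
      using cond by (simp add: segment_Suc tensor_def Let_def option.map_comp comp_def)
    then show ?thesis using True by (simp add: segment_Suc segment_upd)
  next
    case False
    then have "et (tensor_power U (Suc n)) i (segment p (Suc n)) =
        map_option ((#) (p n)) (et (tensor_power U n) i (segment p n))"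
      using cond by (simp add: segment_Suc tensor_def Let_def option.map_comp comp_def)
    also have "\<dots> = (case e_position (peaks p i) (Suc n) of None \<Rightarrow> None
        | Some k \<Rightarrow> map_option (\<lambda>b. segment (p(k := b)) (Suc n)) (et U i (p k)))"
    proof (cases "e_position (peaks p i) n")
      case (Some k)
      then have "k < n" using e_position_eq_Some by blast
      then show ?thesis using Suc False Some by (simp add: segment_Suc option.map_comp comp_def)
    qed (use Suc False in simp)
    finally show ?thesis .
  qed
qed simp

context
  fixes p r
  assumes p: "p \<in> paths" and r: "stable p r"
begin

lemma peaks_tail: "r \<le> k \<Longrightarrow> peaks p i k = peaks p i r"
  unfolding peaks_def by (rule signature.T_tail[OF signature[OF pathsD[OF p] r]])

lemma peaks_0: "0 \<le> peaks p i 0"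
  unfolding peaks_def by (rule signature.T0[OF signature[OF pathsD[OF p] r]])

text \<open>One factor of the tail suffices: a first maximum may lie at \<open>r\<close> but not
  beyond, since all peaks from \<open>r\<close> on are equal.\<close>

lemma f_position_stable: "f_position (peaks p i) (Suc r) = Some k \<longleftrightarrow> first_max (peaks p i) k"
proof
  assume *: "f_position (peaks p i) (Suc r) = Some k"
  have "peaks p i j \<le> peaks p i k" if "k < j" for j
  proof (cases "j \<le> r")
    case False
    then have "peaks p i j = peaks p i r" using peaks_tail[of j i] by simp
    moreover have "k \<le> r" using * f_position_eq_Some[of "peaks p i" "Suc r" k] by simp
    ultimately show ?thesis using * f_position_eq_Some[of "peaks p i" "Suc r" k]
      by (cases "k = r") auto
  qed (use * that f_position_eq_Some[of "peaks p i" "Suc r" k] in auto)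
  then show "first_max (peaks p i) k"
    using * f_position_eq_Some[of "peaks p i" "Suc r" k] unfolding first_max_def by blast
next
  assume *: "first_max (peaks p i) k"
  have "k < Suc r"
  proof (rule ccontr)
    assume "\<not> k < Suc r"
    then have "peaks p i k = peaks p i r" "r < k" using peaks_tail[of k i] by simp_all
    then show False using * unfolding first_max_def by fastforce
  qed
  then show "f_position (peaks p i) (Suc r) = Some k"
    using * unfolding f_position_eq_Some first_max_def by auto
qed

text \<open>If the maximum is attained at \<open>r\<close>, all later peaks attain it too and there
  is no last one. This is the case in which the rule would raise the added ground-state factor and
  in which the Fock space sets \<open>et\<close> to \<open>None\<close>.\<close>

lemma e_position_stable:
  "e_position (peaks p i) (Suc r) = Some k \<and> peaks p i r < running_max (peaks p i) r \<longleftrightarrow> last_max (peaks p i) k"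
proof
  assume *: "e_position (peaks p i) (Suc r) = Some k \<and> peaks p i r < running_max (peaks p i) r"
  then have k: "k < Suc r" "\<forall>j<k. peaks p i j \<le> peaks p i k"
      "\<forall>j. k < j \<and> j < Suc r \<longrightarrow> peaks p i j < peaks p i k"
    using e_position_eq_Some[of "peaks p i" "Suc r" k] by blast+
  have "0 \<le> peaks p i k" using * e_position_eq_Some by blast
  then have "k \<noteq> r" using * k running_max_le[of "peaks p i" r "peaks p i k"] by auto
  then have "peaks p i r < peaks p i k" using k by simp
  have "peaks p i j < peaks p i k" if "k < j" for j
    using peaks_tail[of j i] k that \<open>peaks p i r < peaks p i k\<close> by (cases "j \<le> r") auto
  then show "last_max (peaks p i) k" using k unfolding last_max_def by blast
next
  assume *: "last_max (peaks p i) k"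
  have "k < r"
  proof (rule ccontr)
    assume "\<not> k < r"
    then have "peaks p i k = peaks p i r" "peaks p i (Suc k) = peaks p i r"
      using peaks_tail[of k i] peaks_tail[of "Suc k" i] by simp_all
    then show False using * unfolding last_max_def by force
  qed
  have "0 \<le> peaks p i k"
    using max_valD[OF last_max_max_val[OF *], of 0] peaks_0[of i] by simp
  moreover have "peaks p i r < peaks p i k" using * \<open>k < r\<close> unfolding last_max_def by simp
  moreover have "peaks p i k \<le> running_max (peaks p i) r"
    using running_max_le[of "peaks p i" r "running_max (peaks p i) r"] \<open>k < r\<close> by auto
  ultimately show "e_position (peaks p i) (Suc r) = Some k \<and> peaks p i r < running_max (peaks p i) r"
    using * \<open>k < r\<close> unfolding e_position_eq_Some last_max_def by auto
qed

lemma max_val_running_max: "max_val (peaks p i) (running_max (peaks p i) (Suc r))"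
proof -
  let ?M = "running_max (peaks p i) (Suc r)"
  have le: "peaks p i k \<le> ?M" for k
  proof (cases "k < Suc r")
    case True
    then show ?thesis using running_max_le[of "peaks p i" "Suc r" ?M] by blast
  next
    case False
    then show ?thesis using peaks_tail[of k i] by simp
  qed
  \<comment> \<open>The value could be the initial 0 of \<open>running_max\<close>, attained by no
    peak; the first peak, being nonnegative, excludes this.\<close>
  moreover have "\<exists>k. peaks p i k = ?M"
  proof (rule ccontr)
    assume "\<nexists>k. peaks p i k = ?M"
    then have less: "peaks p i k < ?M" for k using le[of k] by (metis order.not_eq_order_implies_strict)
    then have "0 < ?M" using peaks_0[of i] by (meson le_less_trans)
    then show False using running_max_less[of "peaks p i" "Suc r" ?M] less by blast
  qed
  ultimately show ?thesis unfolding max_val_def by blast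
qed

end

end

section \<open>The Fock space crystal as a crystal of paths\<close>

lemma string_length_nonneg: "0 \<le> string_length h b"
  by (simp add: string_length_def)

lemma perfect_crystal_eps: "eps (perfect_crystal D) i = string_length (et (perfect_crystal D) i)"
  and perfect_crystal_phi: "phi (perfect_crystal D) i = string_length (ft (perfect_crystal D) i)"
  and perfect_crystal_wt_Emp: "wt (perfect_crystal D) Emp = 0"
  and Emp_perfect_crystal: "Emp \<in> carr (perfect_crystal D)"
  by (simp_all add: perfect_crystal_def Let_def)

lemma smul_delta_add: "smul (m + n) delta = smul m delta + smul n delta"
  by (simp add: smul_def delta_def fun_eq_iff)

lemma smul_delta_diff: "smul (m - n) delta = smul m delta - smul n delta"
  by (simp add: smul_def delta_def fun_eq_iff)

text \<open>The weight of b(n) contains -n times delta, so the shift of the exponent under the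
  0-operators supplies the delta by which \<alpha>_0 differs from its classical image.\<close>

lemma kashiwara_affinization:
  assumes B: "kashiwara_crystal P (cl_root A) B"
  shows "kashiwara_crystal UNIV (simple_root A) (affinization B)"
proof -
  let ?d = "\<lambda>i::ind. if i = I0 then 1 else 0 :: int"
  have d: "smul (?d i) delta = (if i = I0 then delta else 0)" for i
    by (simp add: smul_def zero_prod_def zero_fun_def)
  have wt: "pairing i (a - smul n delta) = pairing i a" for i a n
    by (simp add: pairing_def smul_def delta_def)
  have et: "b' \<in> carr B \<and> wt B b' = wt B b + cl_root A i \<and> eps B i b' = eps B i b - 1 \<and> phi B i b' = phi B i b + 1"
    if "b \<in> carr B" "et B i b = Some b'" for b b' i
    using B that unfolding kashiwara_crystal_def by blast
  have ft: "b' \<in> carr B \<and> wt B b' = wt B b - cl_root A i \<and> eps B i b' = eps B i b + 1 \<and> phi B i b' = phi B i b - 1"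
    if "b \<in> carr B" "ft B i b = Some b'" for b b' i
    using B that unfolding kashiwara_crystal_def by blast
  show ?thesis
    unfolding kashiwara_crystal_def
  proof (intro conjI allI ballI impI)
    fix i x assume "x \<in> carr (affinization B)"
    then obtain b n where x: "x = (b, n)" "b \<in> carr B" by (auto simp: affinization_def)
    have "phi B i b = eps B i b + pairing i (wt B b)" using B x(2) unfolding kashiwara_crystal_def by blast
    then show "phi (affinization B) i x = eps (affinization B) i x + pairing i (wt (affinization B) x)"
      using x by (simp add: affinization_def wt)
  next
    fix i x y assume "x \<in> carr (affinization B)" "y \<in> carr (affinization B)"
    then obtain b n b' n' where x: "x = (b, n)" "b \<in> carr B" and y: "y = (b', n')" "b' \<in> carr B"
      by (auto simp: affinization_def)
    have "ft B i b = Some b' \<longleftrightarrow> et B i b' = Some b" using B x(2) y(2) unfolding kashiwara_crystal_def by blast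
    then show "ft (affinization B) i x = Some y \<longleftrightarrow> et (affinization B) i y = Some x"
      using x y by (auto simp: affinization_def)
  next
    fix i x y assume xy: "x \<in> carr (affinization B)" "et (affinization B) i x = Some y"
    then obtain b n b' where x: "x = (b, n)" "b \<in> carr B" "et B i b = Some b'" "y = (b', n - ?d i)"
      by (auto simp: affinization_def)
    note * = et[OF x(2,3)]
    show "y \<in> carr (affinization B)" "eps (affinization B) i y = eps (affinization B) i x - 1"
      "phi (affinization B) i y = phi (affinization B) i x + 1"
      using x * by (simp_all add: affinization_def)
    show "wt (affinization B) y = wt (affinization B) x + simple_root A i"
      using x(1,4) * by (simp add: affinization_def simple_root_def smul_delta_diff d)
  next
    fix i x y assume xy: "x \<in> carr (affinization B)" "ft (affinization B) i x = Some y"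
    then obtain b n b' where x: "x = (b, n)" "b \<in> carr B" "ft B i b = Some b'" "y = (b', n + ?d i)"
      by (auto simp: affinization_def)
    note * = ft[OF x(2,3)]
    show "y \<in> carr (affinization B)" "eps (affinization B) i y = eps (affinization B) i x + 1"
      "phi (affinization B) i y = phi (affinization B) i x - 1"
      using x * by (simp_all add: affinization_def)
    show "wt (affinization B) y = wt (affinization B) x - simple_root A i"
      using x(1,4) * by (simp add: affinization_def simple_root_def smul_delta_add d)
  qed simp
qed

text \<open>That eps and phi of \<emptyset> both equal the pairing with \<open>lam\<close> is what
  makes the mountain range constant in the tail.\<close>

locale fock_model =
  fixes D :: "'l type_data" and lam :: weight
  assumes B: "kashiwara_crystal classical_weights (cl_root (cartan D)) (perfect_crystal D)"
    and Emp_eps: "eps (perfect_crystal D) i Emp = pairing i lam"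
    and Emp_phi: "phi (perfect_crystal D) i Emp = pairing i lam"
    and energy: "is_energy D (energy D)"
begin

lemma B_eps_nonneg: "0 \<le> eps (perfect_crystal D) i b" and B_phi_nonneg: "0 \<le> phi (perfect_crystal D) i b"
  by (simp_all add: perfect_crystal_eps perfect_crystal_phi string_length_nonneg)

lemma energy_ft:
  assumes "a \<in> carr (perfect_crystal D)" "b \<in> carr (perfect_crystal D)"
    and "ft (tensor (perfect_crystal D) (perfect_crystal D)) i (a, b) = Some c"
  shows "energy D c = energy D (a, b) +
    (if i \<noteq> I0 then 0 else if phi (perfect_crystal D) I0 a > eps (perfect_crystal D) I0 b then -1 else 1)"
proof -
  have "energy D c - energy D (a, b) =
    (if i \<noteq> I0 then 0 else if phi (perfect_crystal D) I0 a > eps (perfect_crystal D) I0 b then -1 else 1)"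
    using energy assms unfolding is_energy_def Let_def by blast
  then show ?thesis by simp
qed

sublocale path_data "affinization (perfect_crystal D)" "simple_root (cartan D)" ground_sequence "energy_aff D" lam
proof
  show "kashiwara_crystal UNIV (simple_root (cartan D)) (affinization (perfect_crystal D))"
    by (rule kashiwara_affinization[OF B])
next
  fix x y x' i
  assume *: "x \<in> carr (affinization (perfect_crystal D))" "y \<in> carr (affinization (perfect_crystal D))"
    "eps (affinization (perfect_crystal D)) i y < phi (affinization (perfect_crystal D)) i x"
    "ft (affinization (perfect_crystal D)) i x = Some x'"
  obtain a m b n where xy: "x = (a, m)" "y = (b, n)" by (cases x; cases y)
  obtain a' where "ft (perfect_crystal D) i a = Some a'" "x' = (a', m + (if i = I0 then 1 else 0))"
    using * xy by (auto simp: affinization_def)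
  \<comment> \<open>For i = 0 the energy falls by 1 when the left factor is lowered and the exponent
    of that factor grows by 1. On the right factor the energy grows by 1 and so does the exponent,
    which enters with a minus sign.\<close>
  then show "energy_aff D x' y = energy_aff D x y"
    using * xy energy_ft[of a b i "(a', b)"] by (auto simp: affinization_def energy_aff_def tensor_def)
next
  fix x y y' i
  assume *: "x \<in> carr (affinization (perfect_crystal D))" "y \<in> carr (affinization (perfect_crystal D))"
    "phi (affinization (perfect_crystal D)) i x \<le> eps (affinization (perfect_crystal D)) i y"
    "ft (affinization (perfect_crystal D)) i y = Some y'"
  obtain a m b n where xy: "x = (a, m)" "y = (b, n)" by (cases x; cases y)
  obtain b' where "ft (perfect_crystal D) i b = Some b'" "y' = (b', n + (if i = I0 then 1 else 0))"
    using * xy by (auto simp: affinization_def)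
  then show "energy_aff D x y' = energy_aff D x y"
    using * xy energy_ft[of a b i "(a, b')"] by (auto simp: affinization_def energy_aff_def tensor_def)
qed (auto simp: affinization_def ground_sequence_def Emp_eps Emp_phi
    Emp_perfect_crystal B_eps_nonneg B_phi_nonneg)

lemma paths_eq: "paths = fock_carrier D"
  by (simp add: paths_def fock_carrier_def stable_def)

lemma stable_from: "p \<in> paths \<Longrightarrow> stable p (stable_from p)"
  unfolding paths_def stable_def stable_from_def by (rule LeastI_ex) blast

sublocale path_crystal "affinization (perfect_crystal D)" "simple_root (cartan D)" ground_sequence
  "energy_aff D" lam "fock_crystal D lam"
proof
  let ?B = "perfect_crystal D"
  let ?U = "affinization ?B"
  show "carr (fock_crystal D lam) = paths"
    by (simp add: fock_crystal_def Let_def paths_eq)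
  fix p assume p: "p \<in> paths"
  let ?r = "stable_from p"
  have r: "stable p ?r" by (rule stable_from[OF p])
  \<comment> \<open>The terms with phi of \<open>Emp\<close> in the definition of the Fock space
    crystal become the peak of the factor at \<open>?r\<close>, so eps and phi are those of one more
    tensor factor.\<close>
  have peaks_r: "peaks p i ?r = valley (\<lambda>k. eps ?U i (p k)) (\<lambda>k. phi ?U i (p k)) ?r + pairing i lam" for i
    using r gs_phi[of i] by (simp add: peaks_def peak_def stable_def)
  note seg = tensor_power_segment[where n = ?r, OF pathsD[OF p]]
  have phi: "phi (fock_crystal D lam) i p = running_max (peaks p i) (Suc ?r)" for i
    using peaks_r[of i] by (simp add: fock_crystal_def Let_def seg Emp_phi)
  have eps: "eps (fock_crystal D lam) i p = running_max (peaks p i) (Suc ?r) - peaks p i ?r" for i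
    using peaks_r[of i] by (simp add: fock_crystal_def Let_def seg Emp_phi)
  show "max_val (peaks p i) (phi (fock_crystal D lam) i p)" for i
    unfolding phi by (rule max_val_running_max[OF p r])
  have put: "put_segment p (segment (p(k := b)) (Suc ?r)) = p(k := b)" if "k < Suc ?r" for k b
    by (rule put_segment) (use that in auto)
  fix q
  show "ft (fock_crystal D lam) i p = Some q \<longleftrightarrow>
      (\<exists>k b. first_max (peaks p i) k \<and> ft ?U i (p k) = Some b \<and> q = p(k := b))" for i
  proof -
    have "ft (fock_crystal D lam) i p = (case f_position (peaks p i) (Suc ?r) of None \<Rightarrow> None
        | Some k \<Rightarrow> map_option (\<lambda>b. p(k := b)) (ft ?U i (p k)))"
    proof -
      have "ft (fock_crystal D lam) i p =
          map_option (put_segment p) (ft (tensor_power ?U (Suc ?r)) i (segment p (Suc ?r)))"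
        by (simp add: fock_crystal_def Let_def del: tensor_power.simps)
      also have "\<dots> = (case f_position (peaks p i) (Suc ?r) of None \<Rightarrow> None
        | Some k \<Rightarrow> map_option (\<lambda>b. p(k := b)) (ft ?U i (p k)))"
      proof (cases "f_position (peaks p i) (Suc ?r)")
        case None
        then show ?thesis by (simp add: tensor_power_ft[OF pathsD[OF p]] del: f_position.simps tensor_power.simps)
      next
        case (Some k)
        then have "k < Suc ?r" using f_position_eq_Some by blast
        then show ?thesis using Some put
          by (simp add: tensor_power_ft[OF pathsD[OF p]] option.map_comp comp_def
              del: f_position.simps tensor_power.simps)
      qed
      finally show ?thesis .
    qed
    then show ?thesis unfolding f_position_stable[OF p r, symmetric]
      by (cases "f_position (peaks p i) (Suc ?r)") (auto simp del: f_position.simps)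
  qed
  show "et (fock_crystal D lam) i p = Some q \<longleftrightarrow>
      (\<exists>k b. last_max (peaks p i) k \<and> et ?U i (p k) = Some b \<and> q = p(k := b))" for i
  proof -
    \<comment> \<open>The guard of \<open>et\<close> compares phi of \<open>Emp\<close> with eps of
      the finite part; adding the valley at \<open>?r\<close> makes it a comparison of the peak at
      \<open>?r\<close> with all earlier ones.\<close>
    have "et (fock_crystal D lam) i p = (if running_max (peaks p i) ?r \<le> peaks p i ?r then None else
        case e_position (peaks p i) (Suc ?r) of None \<Rightarrow> None
        | Some k \<Rightarrow> map_option (\<lambda>b. p(k := b)) (et ?U i (p k)))"
    proof -
      have "et (fock_crystal D lam) i p = (if running_max (peaks p i) ?r \<le> peaks p i ?r then None else
          map_option (put_segment p) (et (tensor_power ?U (Suc ?r)) i (segment p (Suc ?r))))"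
        using peaks_r[of i] by (simp add: fock_crystal_def Let_def seg Emp_phi algebra_simps del: tensor_power.simps)
      also have "map_option (put_segment p) (et (tensor_power ?U (Suc ?r)) i (segment p (Suc ?r))) =
          (case e_position (peaks p i) (Suc ?r) of None \<Rightarrow> None
          | Some k \<Rightarrow> map_option (\<lambda>b. p(k := b)) (et ?U i (p k)))"
      proof (cases "e_position (peaks p i) (Suc ?r)")
        case None
        then show ?thesis by (simp add: tensor_power_et[OF pathsD[OF p]] del: e_position.simps tensor_power.simps)
      next
        case (Some k)
        then have "k < Suc ?r" using e_position_eq_Some by blast
        then show ?thesis using Some put
          by (simp add: tensor_power_et[OF pathsD[OF p]] option.map_comp comp_def
              del: e_position.simps tensor_power.simps)
      qed
      finally show ?thesis .
    qed
    then show ?thesis unfolding e_position_stable[OF p r, symmetric]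
      by (cases "e_position (peaks p i) (Suc ?r)") (auto simp del: e_position.simps)
  qed
  fix s assume s: "stable p s"
  show "eps (fock_crystal D lam) i p = phi (fock_crystal D lam) i p - peaks p i s" for i
  proof -
    have "peaks p i s = peaks p i ?r"
      using peaks_tail[OF p r, of "max s ?r" i] peaks_tail[OF p s, of "max s ?r" i] by simp
    then show ?thesis by (simp add: eps phi)
  qed
  show "wt (fock_crystal D lam) p = lam + (\<Sum>k<s. wt ?U (p k) - wt ?U (ground_sequence k))"
  proof -
    have "?r \<le> s" using s unfolding stable_def stable_from_def by (rule Least_le)
    have "(\<Sum>k<s. wt ?U (p k) - wt ?U (ground_sequence k)) =
        (\<Sum>k<?r. wt ?U (p k) - wt ?U (ground_sequence k))"
      by (rule sum.mono_neutral_right) (use \<open>?r \<le> s\<close> r in \<open>auto simp: stable_def\<close>)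
    also have "\<dots> = (\<Sum>k<?r. wt ?B (fst (p k)) - smul (snd (p k) - int k) delta)"
    proof (rule sum.cong)
      fix k
      have "smul (snd (p k)) delta = smul (snd (p k) - int k) delta + smul (int k) delta"
        by (simp flip: smul_delta_add)
      then show "wt ?U (p k) - wt ?U (ground_sequence k) = wt ?B (fst (p k)) - smul (snd (p k) - int k) delta"
        by (simp add: affinization_def ground_sequence_def perfect_crystal_wt_Emp case_prod_unfold)
    qed simp
    finally show ?thesis by (simp add: fock_crystal_def Let_def)
  qed
qed

end

section \<open>Young walls as paths\<close>

lemma shift_iff: "(l, m) \<in> shift n y \<longleftrightarrow> (l, m - n) \<in> y"
  by (auto simp: shift_def) (metis diff_add_cancel)

definition colour_count :: "'l type_data \<Rightarrow> 'l block set \<Rightarrow> ind \<Rightarrow> 'l block set \<Rightarrow> int" where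
  "colour_count D g i y =
     int (card {x \<in> y - g. block_colour D x = i}) - int (card {x \<in> g - y. block_colour D x = i})"

lemma smul_add: "smul (a + b) x = smul a x + smul b x"
  by (simp add: smul_def distrib_right fun_eq_iff)

lemma smul_sum: "smul (\<Sum>k\<in>K. a k) x = (\<Sum>k\<in>K. smul (a k) x)"
  by (induction K rule: infinite_finite_induct)
    (simp_all add: smul_add, simp_all add: smul_def zero_prod_def zero_fun_def)

lemma smul_right_add: "smul a (x + y) = smul a x + smul a y"
  by (simp add: smul_def distrib_left fun_eq_iff)

text \<open>Isolates what the passage from walls to paths uses about columns, so that it is carried
  out once for both types and away from the tables.\<close>

locale wall_model = fock_model D lam for D :: "'l type_data" and lam +
  fixes \<psi> :: "'l block set set \<Rightarrow> pelem" and g :: "'l block set"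
  assumes \<psi>: "crystal_iso classical_weights (cl_root (cartan D)) (column_crystal D) (perfect_crystal D) \<psi>"
    and \<psi>_empty: "\<psi> (shift_class g) = Emp"
    and \<psi>_energy: "col_energy D y y' = energy D (\<psi> (shift_class y), \<psi> (shift_class y'))"
    and g: "young_column D g"
    and et_class: "young_column D y \<Longrightarrow>
      et (column_crystal D) i (shift_class y) = map_option shift_class (col_e D i y)"
    and ft_class: "young_column D y \<Longrightarrow>
      ft (column_crystal D) i (shift_class y) = map_option shift_class (col_f D i y)"
    and eps_class: "young_column D y \<Longrightarrow> eps (column_crystal D) i (shift_class y) = col_eps D i y"
    and phi_class: "young_column D y \<Longrightarrow> phi (column_crystal D) i (shift_class y) = col_phi D i y"
    and col_e: "young_column D y \<Longrightarrow> col_e D i y = Some y' \<Longrightarrow>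
      young_column D y' \<and> zero_count D g y' = zero_count D g y - (if i = I0 then 1 else 0)"
    and col_f: "young_column D y \<Longrightarrow> col_f D i y = Some y' \<Longrightarrow>
      young_column D y' \<and> zero_count D g y' = zero_count D g y + (if i = I0 then 1 else 0)"
    and class_inj: "young_column D y \<Longrightarrow> young_column D y' \<Longrightarrow> shift_class y = shift_class y' \<Longrightarrow>
      zero_count D g y = zero_count D g y' \<Longrightarrow> y = y'"
    and class_surj: "young_column D y \<Longrightarrow> \<exists>y'. young_column D y' \<and> shift_class y' = shift_class y \<and>
      zero_count D g y' = n"
    and col_wt: "young_column D y \<Longrightarrow>
      (\<Sum>i\<in>UNIV. smul (colour_count D g i y) (cl_root (cartan D) i)) = - wt (perfect_crystal D) (\<psi> (shift_class y))"
    and finite_diff: "young_column D y \<Longrightarrow> finite (y - g) \<and> finite (g - y)"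
begin

definition col_elem :: "nat \<Rightarrow> 'l block set \<Rightarrow> pelem \<times> int" where
  "col_elem k y = (\<psi> (shift_class y), zero_count D g y + int k)"

definition wall_path :: "'l wall \<Rightarrow> nat \<Rightarrow> pelem \<times> int" where
  "wall_path Y = (\<lambda>k. col_elem k (Y k))"

abbreviation "U \<equiv> affinization (perfect_crystal D)"

lemma class_carr: "young_column D y \<Longrightarrow> shift_class y \<in> carr (column_crystal D)"
  by (auto simp: column_crystal_def Let_def)

lemma \<psi>_carr: "young_column D y \<Longrightarrow> \<psi> (shift_class y) \<in> carr (perfect_crystal D)"
  using \<psi> class_carr unfolding crystal_iso_def bij_betw_def by blast

lemma \<psi>_inj: "young_column D y \<Longrightarrow> young_column D y' \<Longrightarrow>
    \<psi> (shift_class y) = \<psi> (shift_class y') \<Longrightarrow> shift_class y = shift_class y'"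
  using \<psi> class_carr unfolding crystal_iso_def bij_betw_def inj_on_def by blast

lemma col_elem_carr: "young_column D y \<Longrightarrow> col_elem k y \<in> carr U"
  using \<psi>_carr by (simp add: col_elem_def affinization_def)

lemma col_elem_inj: "young_column D y \<Longrightarrow> young_column D y' \<Longrightarrow> col_elem k y = col_elem k y' \<Longrightarrow> y = y'"
  using \<psi>_inj class_inj unfolding col_elem_def by auto

lemma col_elem_surj:
  assumes "x \<in> carr U"
  obtains y where "young_column D y" "col_elem k y = x"
proof -
  obtain b n where x: "x = (b, n)" "b \<in> carr (perfect_crystal D)" using assms by (auto simp: affinization_def)
  then have "b \<in> \<psi> ` carr (column_crystal D)" using \<psi> unfolding crystal_iso_def bij_betw_def by blast
  then obtain y where y: "young_column D y" "b = \<psi> (shift_class y)"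
    by (auto simp: column_crystal_def Let_def)
  obtain y' where "young_column D y'" "shift_class y' = shift_class y" "zero_count D g y' = n - int k"
    using class_surj[OF y(1)] by blast
  then show thesis using that[of y'] x y by (simp add: col_elem_def)
qed

lemma col_elem_g: "col_elem k g = ground_sequence k"
  by (simp add: col_elem_def ground_sequence_def zero_count_def \<psi>_empty)

lemma \<psi>_ops:
  assumes y: "young_column D y"
  shows "eps (perfect_crystal D) i (\<psi> (shift_class y)) = col_eps D i y"
    and "phi (perfect_crystal D) i (\<psi> (shift_class y)) = col_phi D i y"
    and "et (perfect_crystal D) i (\<psi> (shift_class y)) = map_option (\<lambda>y. \<psi> (shift_class y)) (col_e D i y)"
    and "ft (perfect_crystal D) i (\<psi> (shift_class y)) = map_option (\<lambda>y. \<psi> (shift_class y)) (col_f D i y)"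
  using \<psi> class_carr[OF y] eps_class[OF y] phi_class[OF y] et_class[OF y] ft_class[OF y]
  unfolding crystal_iso_def by (auto simp: option.map_comp comp_def)

lemma eps_col_elem: "young_column D y \<Longrightarrow> eps U i (col_elem k y) = col_eps D i y"
  and phi_col_elem: "young_column D y \<Longrightarrow> phi U i (col_elem k y) = col_phi D i y"
  by (simp_all add: col_elem_def affinization_def \<psi>_ops)

lemma et_col_elem: "young_column D y \<Longrightarrow> et U i (col_elem k y) = map_option (col_elem k) (col_e D i y)"
  using col_e[of y i]
  by (cases "col_e D i y") (auto simp: col_elem_def affinization_def \<psi>_ops)

lemma ft_col_elem: "young_column D y \<Longrightarrow> ft U i (col_elem k y) = map_option (col_elem k) (col_f D i y)"
  using col_f[of y i]
  by (cases "col_f D i y") (auto simp: col_elem_def affinization_def \<psi>_ops)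

definition prewall :: "'l wall \<Rightarrow> bool" where
  "prewall Y \<longleftrightarrow> (\<forall>k. young_column D (Y k)) \<and> (\<exists>r. \<forall>k\<ge>r. Y k = g)"

text \<open>Two Young columns differ in finitely many blocks only, so a finite total difference just
  means that finitely many columns differ from \<open>g\<close>.\<close>

lemma young_wall_iff: "young_wall D g Y \<longleftrightarrow> prewall Y"
proof
  let ?P = "{(k, x). x \<in> Y k \<and> x \<notin> ground_wall g k}" and ?Q = "{(k, x). x \<notin> Y k \<and> x \<in> ground_wall g k}"
  assume Y: "young_wall D g Y"
  then have "finite (fst ` (?P \<union> ?Q))" unfolding young_wall_def by simp
  then obtain r where r: "\<forall>k\<in>fst ` (?P \<union> ?Q). k < r"
    using finite_nat_set_iff_bounded by blast
  have "Y k = g" if "r \<le> k" for k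
  proof (rule ccontr)
    assume "Y k \<noteq> g"
    then obtain x where "(k, x) \<in> ?P \<union> ?Q" unfolding ground_wall_def by auto
    then have "k \<in> fst ` (?P \<union> ?Q)" by (rule image_eqI[rotated]) simp
    then have "k < r" using r by blast
    then show False using that by simp
  qed
  then show "prewall Y" using Y unfolding young_wall_def prewall_def by blast
next
  assume "prewall Y"
  then obtain r where Y: "\<And>k. young_column D (Y k)" and r: "\<And>k. r \<le> k \<Longrightarrow> Y k = g"
    unfolding prewall_def by blast
  have "{(k, x). x \<in> Y k \<and> x \<notin> ground_wall g k} \<subseteq> (SIGMA k:{..<r}. Y k - g)"
    "{(k, x). x \<notin> Y k \<and> x \<in> ground_wall g k} \<subseteq> (SIGMA k:{..<r}. g - Y k)"
    using r by (auto simp: ground_wall_def not_less[symmetric])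
  moreover have "finite (SIGMA k:{..<r}. Y k - g)" "finite (SIGMA k:{..<r}. g - Y k)"
    using finite_diff[OF Y] by auto
  ultimately show "young_wall D g Y"
    unfolding young_wall_def using Y finite_subset by blast
qed

text \<open>The exponent in column \<open>k\<close> contains the offset \<open>k\<close>. In
  adjacent columns the offsets differ by 1, which turns the bound 0 into 1, that is, into "less than
  2".\<close>

lemma proper_iff: "proper D g Y \<longleftrightarrow> (\<forall>k. energy_aff D (wall_path Y (Suc k)) (wall_path Y k) < 2)"
  unfolding proper_def
  by (rule iff_allI) (auto simp: energy_aff_def wall_path_def col_elem_def \<psi>_energy)

lemma wall_carr: "carr (wall_crystal D g lam) = {Y. prewall Y \<and> wall_path Y \<in> paths}"
proof -
  have "wall_path Y \<in> paths \<longleftrightarrow> proper D g Y" if Y: "prewall Y" for Y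
  proof -
    obtain r where Y: "\<And>k. young_column D (Y k)" and r: "\<And>k. r \<le> k \<Longrightarrow> Y k = g"
      using Y unfolding prewall_def by blast
    have "stable (wall_path Y) r" using r by (simp add: stable_def wall_path_def col_elem_g)
    then show ?thesis using col_elem_carr[OF Y] unfolding paths_def proper_iff wall_path_def by auto
  qed
  then show ?thesis unfolding wall_crystal_def by (auto simp: young_wall_iff)
qed

lemma prewall_upd: "prewall Y \<Longrightarrow> young_column D y \<Longrightarrow> prewall (Y(k := y))"
proof -
  assume Y: "prewall Y" and y: "young_column D y"
  then obtain r where r: "\<forall>k\<ge>r. Y k = g" unfolding prewall_def by blast
  have "\<forall>j\<ge>max r (Suc k). (Y(k := y)) j = g" using r by simp
  moreover have "young_column D ((Y(k := y)) j)" for j using Y y unfolding prewall_def by simp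
  ultimately show ?thesis unfolding prewall_def by blast
qed

lemma wall_path_upd: "wall_path (Y(k := y)) = (wall_path Y)(k := col_elem k y)"
  by (auto simp: wall_path_def)

lemma wall_path_inj:
  assumes "prewall Y" "prewall Y'" "wall_path Y = wall_path Y'"
  shows "Y = Y'"
proof
  fix k
  have "col_elem k (Y k) = col_elem k (Y' k)" using fun_cong[OF assms(3), of k] by (simp add: wall_path_def)
  then show "Y k = Y' k" using col_elem_inj assms(1,2) unfolding prewall_def by blast
qed

lemma wall_path_surj:
  assumes p: "p \<in> paths"
  obtains Y where "prewall Y" "wall_path Y = p"
proof -
  obtain r where r: "stable p r" using p unfolding paths_def by blast
  have "\<forall>k. \<exists>y. young_column D y \<and> col_elem k y = p k" using col_elem_surj pathsD[OF p] by metis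
  then obtain Y where Y: "\<And>k. young_column D (Y k)" "\<And>k. col_elem k (Y k) = p k" by metis
  have "Y k = g" if "r \<le> k" for k
    using col_elem_inj[OF Y(1) g, of k k] Y(2)[of k] r that by (simp add: stable_def col_elem_g)
  then have "prewall Y" using Y unfolding prewall_def by blast
  moreover have "wall_path Y = p" using Y by (auto simp: wall_path_def)
  ultimately show thesis by (rule that)
qed

lemma wall_path_bij: "bij_betw wall_path (carr (wall_crystal D g lam)) (carr (fock_crystal D lam))"
  unfolding bij_betw_def inj_on_def wall_carr carr
  using wall_path_inj wall_path_surj by blast

section \<open>The signature of a fixed proper wall\<close>

context
  fixes Y :: "'l wall" and i :: ind
  assumes Y: "Y \<in> carr (wall_crystal D g lam)"
begin

lemma Y_prewall: "prewall Y" and Y_path: "wall_path Y \<in> paths"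
  using Y unfolding wall_carr by auto

lemma Y_col: "young_column D (Y k)"
  using Y_prewall unfolding prewall_def by blast

abbreviation (input) "e \<equiv> \<lambda>k. eps U i (wall_path Y k)"
abbreviation (input) "f \<equiv> \<lambda>k. phi U i (wall_path Y k)"

lemma ef: "e k = col_eps D i (Y k)" "f k = col_phi D i (Y k)"
  using eps_col_elem[OF Y_col] phi_col_elem[OF Y_col] by (simp_all add: wall_path_def)

lemma signs: "plus_pos D i Y = {p. signature.is_plus e f p}" "minus_pos D i Y = {p. signature.is_minus e p}"
proof -
  obtain r where "stable (wall_path Y) r" using Y_path unfolding paths_def by blast
  then interpret signature e f r by (rule signature[OF pathsD[OF Y_path]])
  show "plus_pos D i Y = {p. is_plus p}" "minus_pos D i Y = {p. is_minus p}"
    unfolding plus_pos_def minus_pos_def is_plus_def is_minus_def ef[symmetric] by auto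
qed

lemma wall_eps_phi:
  assumes M: "max_val (peaks (wall_path Y) i) M" and r: "stable (wall_path Y) r"
  shows "phi (wall_crystal D g lam) i Y = M" "eps (wall_crystal D g lam) i Y = M - peaks (wall_path Y) i r"
    and "plus_left D i Y = {} \<longleftrightarrow> M \<le> 0" "minus_left D i Y = {} \<longleftrightarrow> M \<le> peaks (wall_path Y) i r"
    and "first_max (peaks (wall_path Y) i) k \<Longrightarrow> Max (fst ` plus_left D i Y) = k"
    and "last_max (peaks (wall_path Y) i) k \<Longrightarrow> Min (fst ` minus_left D i Y) = k"
proof -
  interpret signature e f r by (rule signature[OF pathsD[OF Y_path] r])
  note eqs = plus_left_eq[OF signs] minus_left_eq[OF signs]
  note M' = M[unfolded peaks_def]
  show "phi (wall_crystal D g lam) i Y = M" "eps (wall_crystal D g lam) i Y = M - peaks (wall_path Y) i r"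
    using card_unpaired_plus[OF M'] card_unpaired_minus[OF M'] by (simp_all add: wall_crystal_def eqs peaks_def)
  show "plus_left D i Y = {} \<longleftrightarrow> M \<le> 0"
    unfolding eqs using level_unpaired_plus[OF M'] by (auto simp: bij_betw_def)
  show "minus_left D i Y = {} \<longleftrightarrow> M \<le> peaks (wall_path Y) i r"
    unfolding eqs using level_unpaired_minus[OF M'] by (auto simp: bij_betw_def peaks_def)
  show "Max (fst ` plus_left D i Y) = k" if "first_max (peaks (wall_path Y) i) k"
    unfolding eqs using unpaired_plus_column(2) that by (simp add: peaks_def)
  show "Min (fst ` minus_left D i Y) = k" if k: "last_max (peaks (wall_path Y) i) k"
  proof -
    \<comment> \<open>A column beyond \<open>k\<close> that lies in the tail: its peak has the
      height of the one at \<open>r\<close>.\<close>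
    have "peaks (wall_path Y) i (max r (Suc k)) < peaks (wall_path Y) i k"
      using k unfolding last_max_def by (simp add: less_max_iff_disj)
    then have "peaks (wall_path Y) i r < peaks (wall_path Y) i k"
      using peaks_tail[OF Y_path r, of "max r (Suc k)" i] by simp
    then show ?thesis unfolding eqs using unpaired_minus_column(2) k by (simp add: peaks_def)
  qed
qed

lemma wall_ft: "ft (wall_crystal D g lam) i Y = Some Y' \<longleftrightarrow>
    (\<exists>k y. first_max (peaks (wall_path Y) i) k \<and> col_f D i (Y k) = Some y \<and> Y' = Y(k := y))"
proof -
  obtain r where r: "stable (wall_path Y) r" using Y_path unfolding paths_def by blast
  obtain M where M: "max_val (peaks (wall_path Y) i) M" using max_val_exists peaks_tail[OF Y_path r] by blast
  show ?thesis
  proof (cases "M \<le> 0")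
    case True
    have "\<not> first_max (peaks (wall_path Y) i) k" for k
      using True max_val_unique[OF M first_max_max_val] unfolding first_max_def by force
    then show ?thesis using True wall_eps_phi(3)[OF M r] by (simp add: wall_crystal_def)
  next
    case False
    then obtain k where k: "first_max (peaks (wall_path Y) i) k" using first_max_exists[OF M] by force
    have "ft (wall_crystal D g lam) i Y = map_option (\<lambda>y. Y(k := y)) (col_f D i (Y k))"
      using False wall_eps_phi(3,5)[OF M r] k by (simp add: wall_crystal_def Let_def)
    then show ?thesis using k by (simp add: map_option_eq_Some) (metis first_max_unique)
  qed
qed

lemma wall_et: "et (wall_crystal D g lam) i Y = Some Y' \<longleftrightarrow>
    (\<exists>k y. last_max (peaks (wall_path Y) i) k \<and> col_e D i (Y k) = Some y \<and> Y' = Y(k := y))"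
proof -
  obtain r where r: "stable (wall_path Y) r" using Y_path unfolding paths_def by blast
  obtain M where M: "max_val (peaks (wall_path Y) i) M" using max_val_exists peaks_tail[OF Y_path r] by blast
  show ?thesis
  proof (cases "M \<le> peaks (wall_path Y) i r")
    case True
    have "\<not> last_max (peaks (wall_path Y) i) k" for k
    proof
      assume k: "last_max (peaks (wall_path Y) i) k"
      have "peaks (wall_path Y) i (max r (Suc k)) < peaks (wall_path Y) i k"
        using k unfolding last_max_def by (simp add: less_max_iff_disj)
      then show False using peaks_tail[OF Y_path r, of "max r (Suc k)" i] True
          max_val_unique[OF M last_max_max_val[OF k]] by simp
    qed
    then show ?thesis using True wall_eps_phi(4)[OF M r] by (simp add: wall_crystal_def)
  next
    case False
    then obtain k where k: "last_max (peaks (wall_path Y) i) k"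
      using last_max_exists[OF peaks_tail[OF Y_path r] M] by force
    have "et (wall_crystal D g lam) i Y = map_option (\<lambda>y. Y(k := y)) (col_e D i (Y k))"
      using False wall_eps_phi(4,6)[OF M r] k by (simp add: wall_crystal_def Let_def)
    then show ?thesis using k by (simp add: map_option_eq_Some) (metis last_max_unique)
  qed
qed

lemma fock_ft: "ft (fock_crystal D lam) i (wall_path Y) = map_option wall_path (ft (wall_crystal D g lam) i Y)"
proof -
  have col: "ft U i (wall_path Y k) = map_option (col_elem k) (col_f D i (Y k))" for k
    using ft_col_elem[OF Y_col] by (simp add: wall_path_def)
  have "ft (fock_crystal D lam) i (wall_path Y) = Some q \<longleftrightarrow>
      map_option wall_path (ft (wall_crystal D g lam) i Y) = Some q" for q
    unfolding ft[OF Y_path] map_option_eq_Some wall_ft col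
    using wall_path_upd[of Y] by metis
  then show ?thesis by (metis not_None_eq)
qed

lemma fock_et: "et (fock_crystal D lam) i (wall_path Y) = map_option wall_path (et (wall_crystal D g lam) i Y)"
proof -
  have col: "et U i (wall_path Y k) = map_option (col_elem k) (col_e D i (Y k))" for k
    using et_col_elem[OF Y_col] by (simp add: wall_path_def)
  have "et (fock_crystal D lam) i (wall_path Y) = Some q \<longleftrightarrow>
      map_option wall_path (et (wall_crystal D g lam) i Y) = Some q" for q
    unfolding et[OF Y_path] map_option_eq_Some wall_et col
    using wall_path_upd[of Y] by metis
  then show ?thesis by (metis not_None_eq)
qed

text \<open>That the new wall is proper is not visible on the columns; it comes from the paths,
  where lowering and raising do not leave the set described by the energy condition.\<close>

lemma wall_closed:
  "ft (wall_crystal D g lam) i Y = Some Y' \<Longrightarrow> Y' \<in> carr (wall_crystal D g lam)"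
  "et (wall_crystal D g lam) i Y = Some Y' \<Longrightarrow> Y' \<in> carr (wall_crystal D g lam)"
proof -
  assume *: "ft (wall_crystal D g lam) i Y = Some Y'"
  then have "prewall Y'" unfolding wall_ft using prewall_upd[OF Y_prewall] col_f[OF Y_col] by blast
  moreover have "wall_path Y' \<in> paths" using ft_props(1)[OF Y_path] fock_ft * by simp
  ultimately show "Y' \<in> carr (wall_crystal D g lam)" unfolding wall_carr by simp
next
  assume *: "et (wall_crystal D g lam) i Y = Some Y'"
  then have "prewall Y'" unfolding wall_et using prewall_upd[OF Y_prewall] col_e[OF Y_col] by blast
  moreover have "wall_path Y' \<in> paths" using et_props(1)[OF Y_path] fock_et * by simp
  ultimately show "Y' \<in> carr (wall_crystal D g lam)" unfolding wall_carr by simp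
qed

end

section \<open>Weights of walls\<close>

lemma wall_count_sum:
  assumes Y: "\<And>k. young_column D (Y k)" and r: "\<And>k. r \<le> k \<Longrightarrow> Y k = g"
  shows "wall_count D g i Y = (\<Sum>k<r. colour_count D g i (Y k))"
proof -
  have eq: "{(k, x). x \<in> Y k \<and> x \<notin> ground_wall g k \<and> block_colour D x = i} =
      (SIGMA k:{..<r}. {x \<in> Y k - g. block_colour D x = i})"
    "{(k, x). x \<notin> Y k \<and> x \<in> ground_wall g k \<and> block_colour D x = i} =
      (SIGMA k:{..<r}. {x \<in> g - Y k. block_colour D x = i})"
    using r by (auto simp: ground_wall_def not_less[symmetric])
  have "finite {x \<in> Y k - g. block_colour D x = i}" for k
    by (rule finite_subset[of _ "Y k - g"]) (use finite_diff[OF Y, of k] in auto)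
  moreover have "finite {x \<in> g - Y k. block_colour D x = i}" for k
    by (rule finite_subset[of _ "g - Y k"]) (use finite_diff[OF Y, of k] in auto)
  ultimately show ?thesis
    unfolding wall_count_def eq colour_count_def by (simp add: sum_subtractf del: Diff_iff)
qed

text \<open>In each column the classical parts of the roots of the added blocks sum to minus the
  weight of its element of the perfect crystal, and the delta in \<alpha>_0 counts the 0-blocks,
  which is the exponent minus \<open>k\<close>.\<close>

lemma wall_wt:
  assumes Y: "Y \<in> carr (wall_crystal D g lam)"
  shows "wt (fock_crystal D lam) (wall_path Y) = wt (wall_crystal D g lam) Y"
proof -
  obtain r where r: "\<And>k. r \<le> k \<Longrightarrow> Y k = g" using Y_prewall[OF Y] unfolding prewall_def by blast
  note col = Y_col[OF Y]
  have stable: "stable (wall_path Y) r" using r by (simp add: stable_def wall_path_def col_elem_g)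
  have "wt U (wall_path Y k) - wt U (ground_sequence k) =
      - (\<Sum>i\<in>UNIV. smul (colour_count D g i (Y k)) (simple_root (cartan D) i))" for k
  proof -
    have "(\<Sum>i\<in>UNIV. smul (colour_count D g i (Y k)) (simple_root (cartan D) i)) =
        (\<Sum>i\<in>UNIV. smul (colour_count D g i (Y k)) (cl_root (cartan D) i)) +
        (\<Sum>i\<in>UNIV. smul (colour_count D g i (Y k)) (if i = I0 then delta else 0))"
      by (simp add: simple_root_def smul_right_add sum.distrib)
    also have "(\<Sum>i\<in>UNIV. smul (colour_count D g i (Y k)) (if i = I0 then delta else 0)) =
        (\<Sum>i\<in>UNIV. if i = I0 then smul (colour_count D g I0 (Y k)) delta else 0)"
      by (rule sum.cong) (auto simp: smul_def zero_prod_def zero_fun_def)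
    also have "\<dots> = smul (zero_count D g (Y k)) delta"
      by (simp add: colour_count_def zero_count_def)
    finally show ?thesis using col_wt[OF col, of k]
      by (simp add: wall_path_def col_elem_def affinization_def ground_sequence_def
          perfect_crystal_wt_Emp smul_delta_add)
  qed
  then have "wt (fock_crystal D lam) (wall_path Y) =
      lam - (\<Sum>k<r. \<Sum>i\<in>UNIV. smul (colour_count D g i (Y k)) (simple_root (cartan D) i))"
    using wt[OF Y_path[OF Y] stable] by (simp add: sum_negf)
  also have "\<dots> = wt (wall_crystal D g lam) Y"
    unfolding sum.swap[of _ UNIV] by (simp add: wall_crystal_def wall_count_sum[OF col r] smul_sum)
  finally show ?thesis .
qed

theorem wall_iso:
  "affine_crystal_iso D (wall_crystal D g lam) (fock_crystal D lam) wall_path \<and>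
   wall_path (ground_wall g) = ground_sequence"
proof
  show "wall_path (ground_wall g) = ground_sequence"
    by (auto simp: wall_path_def ground_wall_def col_elem_g)
  show "affine_crystal_iso D (wall_crystal D g lam) (fock_crystal D lam) wall_path"
    unfolding affine_crystal_iso_def
  proof (rule crystal_iso_transfer[OF kashiwara wall_path_bij])
    fix Y i assume Y: "Y \<in> carr (wall_crystal D g lam)"
    show "wt (fock_crystal D lam) (wall_path Y) = wt (wall_crystal D g lam) Y" by (rule wall_wt[OF Y])
    obtain r where r: "stable (wall_path Y) r" using Y_path[OF Y] unfolding paths_def by blast
    note phi' = phi[OF Y_path[OF Y], of i]
    show "phi (fock_crystal D lam) i (wall_path Y) = phi (wall_crystal D g lam) i Y"
      "eps (fock_crystal D lam) i (wall_path Y) = eps (wall_crystal D g lam) i Y"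
      using wall_eps_phi(1,2)[OF Y phi' r] eps[OF Y_path[OF Y] r, of i] by simp_all
  qed (use fock_ft fock_et wall_closed in blast)+
qed

end

section \<open>Tables of Young columns\<close>

text \<open>A vertex \<open>v\<close> names a class of pre-Young columns, represented by the symmetric difference of
  the list \<open>diff\<close> and the set of all blocks of negative index. \<open>covers\<close> lists the pairs \<open>(x, w)\<close>
  such that adding the block \<open>x\<close> to the representative of \<open>v\<close> gives that of \<open>w\<close>, shifted by \<open>1\<close> if
  \<open>x\<close> is a \<open>0\<close>-block; \<open>cocovers\<close> lists the same triples \<open>(v, x, w)\<close> by \<open>w\<close>. \<open>energies\<close> is the row of
  \<open>v\<close> in the table of the energy function. The exceptional class gets the otherwise unused
  name \<open>R I0\<close>.\<close>

type_synonym ('l, 'v) cover = "'l block \<times> 'v"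

datatype ('l, 'v) table_row =
  Row (name: pelem) (diff: "'l block list") (covers: "('l, 'v) cover list")
    (cocovers: "('l, 'v) cover list") (energies: "int list")

definition in_col :: "'l block list \<Rightarrow> 'l block \<Rightarrow> bool" where
  "in_col d x \<longleftrightarrow> (snd x < 0) \<noteq> (x \<in> set d)"

definition blocked_name :: "ind \<Rightarrow> pelem \<Rightarrow> bool" where
  "blocked_name i b = (case b of R j \<Rightarrow> j \<noteq> i | _ \<Rightarrow> False)"

definition moves :: "('l \<Rightarrow> ind) \<Rightarrow> ('v \<Rightarrow> ('l, 'v) table_row) \<Rightarrow> ind \<Rightarrow> ('l, 'v) cover list \<Rightarrow> ('l, 'v) cover list" where
  "moves c t i = filter (\<lambda>(x, w). c (fst x) = i \<and> name (t w) \<noteq> R I0)"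

text \<open>The lists are sorted by row, so the last cover is the highest addable block and, in
  \<open>vertex_e\<close>, the first cocover the lowest removable one.\<close>

definition vertex_f :: "('l \<Rightarrow> ind) \<Rightarrow> ('v \<Rightarrow> ('l, 'v) table_row) \<Rightarrow> ind \<Rightarrow> 'v \<Rightarrow> 'v option" where
  "vertex_f c t i v = (if name (t v) = R I0 \<or> blocked_name i (name (t v)) then None else
     case rev (moves c t i (covers (t v))) of [] \<Rightarrow> None | (x, w) # _ \<Rightarrow> Some w)"

definition vertex_e :: "('l \<Rightarrow> ind) \<Rightarrow> ('v \<Rightarrow> ('l, 'v) table_row) \<Rightarrow> ind \<Rightarrow> 'v \<Rightarrow> 'v option" where
  "vertex_e c t i v = (if name (t v) = R I0 \<or> blocked_name i (name (t v)) then None else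
     case moves c t i (cocovers (t v)) of [] \<Rightarrow> None | (x, w) # _ \<Rightarrow> Some w)"

text \<open>All strings have length at most \<open>2\<close>; this is part of \<open>strings_ok\<close>.\<close>

definition steps :: "('v \<Rightarrow> 'v option) \<Rightarrow> 'v \<Rightarrow> int" where
  "steps h v = (case h v of None \<Rightarrow> 0 | Some w \<Rightarrow> (case h w of None \<Rightarrow> 1 | Some _ \<Rightarrow> 2))"

definition weight_of :: "('l \<Rightarrow> ind) \<Rightarrow> ('v \<Rightarrow> ('l, 'v) table_row) \<Rightarrow> 'v \<Rightarrow> ind \<Rightarrow> int" where
  "weight_of c t v j = steps (vertex_f c t j) v - steps (vertex_e c t j) v"

definition inds :: "ind list" where "inds = [I0, I1, I2, I3, I4]"

text \<open>The representatives contain everything below index -1 and nothing above index 1, and a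
  new block can reach index 2 by resting on one of index 1. No other index can matter.\<close>

definition window :: "'l list \<Rightarrow> 'l block list" where
  "window ls = concat (map (\<lambda>m. map (\<lambda>l. (l, m)) ls) [-1, 0, 1, 2])"

definition rests_in :: "('l \<Rightarrow> ('l \<times> int) set) \<Rightarrow> 'l block list \<Rightarrow> 'l block \<Rightarrow> bool" where
  "rests_in s d x \<longleftrightarrow> (\<forall>(l, k) \<in> s (fst x). in_col d (l, snd x + k))"

definition row_of :: "('l \<Rightarrow> int) \<Rightarrow> 'l block \<Rightarrow> int" where
  "row_of rw x = 4 * snd x + rw (fst x)"

text \<open>The last conjunct fixes the order of the list, so that equal sets of blocks have equal
  lists.\<close>

definition is_down where
  "is_down s W d \<longleftrightarrow> list_all (\<lambda>(l, m). m = -1 \<or> m = 0 \<or> m = 1) d \<and>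
     list_all (\<lambda>x. in_col d x \<longrightarrow> rests_in s d x) W \<and> d = filter (\<lambda>x. x \<in> set d) W"

text \<open>A new block of negative index disappears from the symmetric difference, one of
  nonnegative index enters it. After a 0-block the representative of \<open>w\<close> is shifted, so
  there the two columns are compared block by block on the window.\<close>

definition covers_sound where
  "covers_sound c W t v \<longleftrightarrow> list_all (\<lambda>(x, w).
     x \<in> set W \<and> \<not> in_col (diff (t v)) x \<and>
     (if c (fst x) = I0
      then list_all (\<lambda>(l, m). ((l, m) = x \<or> in_col (diff (t v)) (l, m)) \<longleftrightarrow> in_col (diff (t w)) (l, m - 1)) W
      else if snd x < 0 then removeAll x (diff (t v)) = diff (t w)
      else removeAll x (diff (t w)) = diff (t v) \<and> x \<in> set (diff (t w)))) (covers (t v))"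

definition covers_complete where
  "covers_complete s W t v \<longleftrightarrow> list_all (\<lambda>x. in_col (diff (t v)) x \<or> \<not> rests_in s (diff (t v)) x \<or>
     x \<in> fst ` set (covers (t v))) W"

definition cocovers_ok where
  "cocovers_ok t v \<longleftrightarrow> list_all (\<lambda>(x, w). (x, v) \<in> set (cocovers (t w))) (covers (t v)) \<and>
     list_all (\<lambda>(x, w). (x, v) \<in> set (covers (t w))) (cocovers (t v))"

definition sorted_rows where
  "sorted_rows c rw t v \<longleftrightarrow> list_all (\<lambda>i.
     sorted_wrt (\<lambda>(x, _) (y, _). row_of rw x < row_of rw y) (moves c t i (covers (t v))) \<and>
     sorted_wrt (\<lambda>(x, _) (y, _). row_of rw x < row_of rw y) (moves c t i (cocovers (t v)))) inds"

definition exceptional_ok where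
  "exceptional_ok c rw W t v \<longleftrightarrow>
    (let top2 = filter (\<lambda>x. c (fst x) = I2 \<and> list_all (\<lambda>w. in_col (diff (t v)) w \<longrightarrow> row_of rw w \<le> row_of rw x) W)
           (map fst (cocovers (t v)));
         free1 = list_ex (\<lambda>(x, w). c (fst x) = I1) (cocovers (t v))
     in if name (t v) = R I0 then length top2 = 1 \<and> free1 else free1 \<longrightarrow> top2 = [])"

text \<open>As \<open>steps\<close> is capped at 2, the equation fails on any longer string, so it
  also certifies the cap.\<close>

definition strings_ok where
  "strings_ok c t v \<longleftrightarrow> list_all (\<lambda>i.
     (case vertex_f c t i v of None \<Rightarrow> True
      | Some w \<Rightarrow> vertex_e c t i w = Some v \<and> steps (vertex_f c t i) v = 1 + steps (vertex_f c t i) w) \<and>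
     (case vertex_e c t i v of None \<Rightarrow> True
      | Some w \<Rightarrow> vertex_f c t i w = Some v \<and> steps (vertex_e c t i) v = 1 + steps (vertex_e c t i) w)) inds"

text \<open>The second part includes the covers into and out of the exceptional class, so the weight
  can be followed along every way of building a column.\<close>

definition weights_ok where
  "weights_ok c A t v \<longleftrightarrow>
     list_all (\<lambda>j. (case name (t v) of X \<alpha> \<Rightarrow> fst (root_wt A \<alpha>) j | _ \<Rightarrow> 0) = weight_of c t v j) inds \<and>
     list_all (\<lambda>(x, w). list_all (\<lambda>j. weight_of c t w j = weight_of c t v j - A j (c (fst x))) inds) (covers (t v))"

text \<open>A list instead of an option: equality with an \<open>opt_list\<close> then also shows
  that there is at most one arrow, the one that \<open>choose_opt\<close> must pick.\<close>

definition arrows_from :: "root set \<Rightarrow> root \<Rightarrow> ind \<Rightarrow> pelem \<Rightarrow> pelem list" where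
  "arrows_from P th i b = (case b of
     X \<alpha> \<Rightarrow>
       (if i = I0 then
          (if \<alpha> = - th then [Emp]
           else if \<alpha> \<noteq> th \<and> (\<alpha> \<in> P \<or> - \<alpha> \<in> P) \<and> (\<alpha> + th \<in> P \<or> - (\<alpha> + th) \<in> P) \<and> \<alpha> + th \<noteq> th \<and> \<alpha> + th \<noteq> - th
           then [X (\<alpha> + th)] else [])
        else
          (if \<alpha> = alpha_root i \<and> alpha_root i \<in> P then [R i] else []) @
          (if (\<alpha> \<in> P \<or> - \<alpha> \<in> P) \<and> (\<alpha> - alpha_root i \<in> P \<or> - (\<alpha> - alpha_root i) \<in> P)
           then [X (\<alpha> - alpha_root i)] else []))
   | R j \<Rightarrow> if i = j \<and> i \<noteq> I0 \<and> alpha_root i \<in> P then [X (- alpha_root i)] else []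
   | Emp \<Rightarrow> if i = I0 then [X th] else [])"

definition arrows_to :: "root set \<Rightarrow> root \<Rightarrow> ind \<Rightarrow> pelem \<Rightarrow> pelem list" where
  "arrows_to P th i b = (case b of
     X \<alpha> \<Rightarrow>
       (if i = I0 then
          (if \<alpha> = th then [Emp]
           else if \<alpha> \<noteq> - th \<and> (\<alpha> \<in> P \<or> - \<alpha> \<in> P) \<and> (\<alpha> - th \<in> P \<or> - (\<alpha> - th) \<in> P) \<and> \<alpha> - th \<noteq> th \<and> \<alpha> - th \<noteq> - th
           then [X (\<alpha> - th)] else [])
        else
          (if \<alpha> = - alpha_root i \<and> alpha_root i \<in> P then [R i] else []) @
          (if (\<alpha> \<in> P \<or> - \<alpha> \<in> P) \<and> (\<alpha> + alpha_root i \<in> P \<or> - (\<alpha> + alpha_root i) \<in> P)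
           then [X (\<alpha> + alpha_root i)] else []))
   | R j \<Rightarrow> if i = j \<and> i \<noteq> I0 \<and> alpha_root i \<in> P then [X (alpha_root i)] else []
   | Emp \<Rightarrow> if i = I0 then [X (- th)] else [])"

definition opt_list :: "'a option \<Rightarrow> 'a list" where
  "opt_list x = (case x of None \<Rightarrow> [] | Some a \<Rightarrow> [a])"

definition arrows_ok where
  "arrows_ok c P th t v \<longleftrightarrow> name (t v) = R I0 \<or> list_all (\<lambda>i.
     arrows_from P th i (name (t v)) = opt_list (map_option (\<lambda>w. name (t w)) (vertex_f c t i v)) \<and>
     arrows_to P th i (name (t v)) = opt_list (map_option (\<lambda>w. name (t w)) (vertex_e c t i v))) inds"

definition energy_of :: "('v \<Rightarrow> ('l, 'v) table_row) \<Rightarrow> 'v list \<Rightarrow> 'v \<Rightarrow> 'v \<Rightarrow> int" where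
  "energy_of t vs v w = the (map_of (zip vs (energies (t v))) w)"

text \<open>Transposes the table of energies, so that a change of the second argument compares two
  lists entry by entry, just like a change of the first.\<close>

fun columns :: "'v list \<Rightarrow> int list list \<Rightarrow> int list list" where
  "columns [] rows = []"
| "columns (v # vs) rows = map hd rows # columns vs (map tl rows)"

definition energy_left where
  "energy_left c t i ns v \<longleftrightarrow> (case vertex_f c t i v of None \<Rightarrow> True | Some v' \<Rightarrow>
     list_all (\<lambda>(n, h, h'). n < steps (vertex_f c t i) v \<longrightarrow> h' = h - (if i = I0 then 1 else 0))
       (zip ns (zip (energies (t v)) (energies (t v')))))"

definition energy_right where
  "energy_right c t i ns cs w \<longleftrightarrow> (case vertex_f c t i w of None \<Rightarrow> True | Some w' \<Rightarrow>
     list_all (\<lambda>(n, h, h'). n \<le> steps (vertex_e c t i) w \<longrightarrow> h' = h + (if i = I0 then 1 else 0))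
       (zip ns (zip (the (map_of cs w)) (the (map_of cs w')))))"

definition energy_ok where
  "energy_ok c t vs \<longleftrightarrow> list_all (\<lambda>v. length (energies (t v)) = length vs) vs \<and>
     list_all (\<lambda>i. list_all (energy_left c t i (map (steps (vertex_e c t i)) vs)) vs) inds \<and>
     list_all (\<lambda>i. list_all (energy_right c t i (map (steps (vertex_f c t i)) vs)
       (zip vs (columns vs (map (\<lambda>v. energies (t v)) vs)))) vs) inds"

section \<open>Young columns from a table\<close>

text \<open>The vertices \<open>vx\<close>, \<open>v0\<close> and \<open>ve\<close> stand for the exceptional class, the class of the set of all
  blocks of negative index, and \<open>y\<^sub>\<emptyset>\<close>; \<open>lz\<close> is the letter of colour \<open>0\<close>. \<open>rank\<close> replaces \<open>row\<close>, which
  does not decrease strictly along supports inside the double-height rows of type \<open>F\<close>.\<close>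

locale column_model =
  fixes D :: "'l type_data" and ls :: "'l list" and vs :: "'v list"
    and t :: "'v \<Rightarrow> ('l, 'v) table_row" and rank :: "'l \<Rightarrow> int" and vx v0 ve :: 'v and lz :: 'l
  assumes ls: "set ls = UNIV" and vs: "set vs = UNIV"
    and row_range: "0 \<le> row D l" "row D l \<le> 3"
    and support_range: "(l', d) \<in> support D l \<Longrightarrow> (d = 0 \<or> d = -1) \<and> 5 * d + rank l' < rank l"
    and support_nonempty: "support D l \<noteq> {}"
    and below: "\<forall>x\<in>y. rests_on D x \<subseteq> y \<Longrightarrow> (l, m) \<in> y \<Longrightarrow> (l', m - 2) \<in> y \<and> (l', m - 3) \<in> y"
    and is_down: "list_all (\<lambda>v. is_down (support D) (window ls) (diff (t v))) vs"
    and covers_sound: "list_all (covers_sound (colour D) (window ls) t) vs"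
    and covers_complete: "list_all (covers_complete (support D) (window ls) t) vs"
    and cocovers_ok: "list_all (cocovers_ok t) vs"
    and sorted_rows: "list_all (sorted_rows (colour D) (row D) t) vs"
    and exceptional_ok: "list_all (exceptional_ok (colour D) (row D) (window ls) t) vs"
    and distinct_diff: "distinct (map (\<lambda>v. diff (t v)) vs)"
    and name_vx: "name (t v) = R I0 \<longleftrightarrow> v = vx"
    and v0: "diff (t v0) = []"
    and lz: "colour D l = I0 \<longleftrightarrow> l = lz"
    and col_empty: "col_empty D = {(l, m). in_col (diff (t ve)) (l, m - 1)}"
    and col_r: "col_r D j = Some y \<longleftrightarrow> j \<noteq> I0 \<and> (\<exists>v. name (t v) = R j \<and> y = {(l, m). in_col (diff (t v)) (l, m - 1)})"
    and ve: "name (t ve) = Emp"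
    and strings_ok: "list_all (strings_ok (colour D) t) vs"
    and weights_ok: "list_all (weights_ok (colour D) (cartan D) t) vs"
    and lz_diff: "(lz, m) \<in> set (diff (t v)) \<longleftrightarrow> v = ve \<and> (m = -1 \<or> m = 0)"
begin

section \<open>Columns named by a vertex and a shift; completeness of the table\<close>

abbreviation "df v \<equiv> diff (t v)"

definition col :: "'v \<Rightarrow> int \<Rightarrow> 'l block set" where
  "col v n = {(l, m). in_col (df v) (l, m - n)}"

lemma all_vs: "list_all Q vs \<Longrightarrow> Q v"
  using vs by (simp add: list_all_iff)

lemma window_iff: "(l, m) \<in> set (window ls) \<longleftrightarrow> -1 \<le> m \<and> m \<le> 2"
proof -
  have "-1 \<le> m \<and> m \<le> 2 \<longleftrightarrow> m = -1 \<or> m = 0 \<or> m = 1 \<or> m = 2" by auto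
  then show ?thesis using ls by (auto simp: window_def image_iff)
qed

lemma col_iff: "(l, m) \<in> col v n \<longleftrightarrow> in_col (df v) (l, m - n)"
  by (simp add: col_def)

lemma shift_col: "shift k (col v n) = col v (n + k)"
  by (auto simp: shift_iff col_iff algebra_simps)

lemma diff_range: "(l, m) \<in> set (df v) \<Longrightarrow> -1 \<le> m \<and> m \<le> 1"
  using all_vs[OF is_down, of v] by (force simp: is_down_def list_all_iff)

lemma in_col_low: "m < -1 \<Longrightarrow> in_col (df v) (l, m)"
  and in_col_high: "1 < m \<Longrightarrow> \<not> in_col (df v) (l, m)"
  using diff_range[of l m v] by (auto simp: in_col_def)

lemma rests_on_iff: "rests_on D (l, m) = {(l', m + d) | l' d. (l', d) \<in> support D l}"
  by (simp add: rests_on_def)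

lemma rests_on_col: "rests_on D (l, m) \<subseteq> col v n \<longleftrightarrow> rests_in (support D) (df v) (l, m - n)"
proof -
  have "rests_on D (l, m) \<subseteq> col v n \<longleftrightarrow> (\<forall>(l', d) \<in> support D l. (l', m + d) \<in> col v n)"
    by (auto simp: rests_on_iff)
  then show ?thesis by (simp add: rests_in_def col_iff diff_add_eq)
qed

lemma down: "x \<in> col v n \<Longrightarrow> rests_on D x \<subseteq> col v n"
proof -
  obtain l m where x: "x = (l, m)" by (cases x)
  assume "x \<in> col v n"
  then have m: "in_col (df v) (l, m - n)" by (simp add: x col_iff)
  have "m - n \<le> 1" using in_col_high[of "m - n" v l] m by linarith
  have "rests_in (support D) (df v) (l, m - n)"
  proof (cases "m - n < -1")
    case True
    then show ?thesis using support_range[of _ _ l] in_col_low[of _ v] by (fastforce simp: rests_in_def)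
  next
    case False
    then have "(l, m - n) \<in> set (window ls)" using \<open>m - n \<le> 1\<close> by (simp add: window_iff)
    then show ?thesis using all_vs[OF is_down, of v] m by (auto simp: is_down_def list_all_iff)
  qed
  then show ?thesis by (simp add: x rests_on_col)
qed

abbreviation zero_step :: "'l \<Rightarrow> int" where "zero_step l \<equiv> if colour D l = I0 then 1 else 0"

lemma cover:
  assumes "((l, m), w) \<in> set (covers (t v))"
  shows "(l, m + n) \<notin> col v n" and "insert (l, m + n) (col v n) = col w (n + zero_step l)"
proof -
  let ?x = "(l, m)"
  note S = all_vs[OF covers_sound, of v, unfolded covers_sound_def list_all_iff]
  have "?x \<in> set (window ls) \<and> \<not> in_col (df v) ?x \<and>
    (if colour D l = I0 then
      \<forall>(l', m')\<in>set (window ls). ((l', m') = ?x \<or> in_col (df v) (l', m')) = in_col (df w) (l', m' - 1)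
      else if m < 0 then removeAll ?x (df v) = df w
      else removeAll ?x (df w) = df v \<and> ?x \<in> set (df w))"
    using bspec[OF S assms] unfolding prod.case fst_conv snd_conv .
  then have *: "?x \<in> set (window ls)" "\<not> in_col (df v) ?x"
    "if colour D l = I0 then
      \<forall>(l', m')\<in>set (window ls). ((l', m') = ?x \<or> in_col (df v) (l', m')) = in_col (df w) (l', m' - 1)
      else if m < 0 then removeAll ?x (df v) = df w
      else removeAll ?x (df w) = df v \<and> ?x \<in> set (df w)"
    by blast+
  show "(l, m + n) \<notin> col v n" using * by (simp add: col_iff)
  have "((l', m') = ?x \<or> in_col (df v) (l', m')) \<longleftrightarrow> in_col (df w) (l', m' - zero_step l)" for l' m'
  proof (cases "colour D l = I0")
    case True
    \<comment> \<open>Below the window both sides hold, above it both fail, and inside it the table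
      has been checked.\<close>
    consider "m' < -1" | "2 < m'" | "(l', m') \<in> set (window ls)" unfolding window_iff by linarith
    then show ?thesis
    proof cases
      case 1
      then show ?thesis using True in_col_low by simp
    next
      case 2
      then show ?thesis using True in_col_high *(1) by (auto simp: window_iff)
    next
      case 3
      then show ?thesis using True *(3) by (auto simp: list_all_iff)
    qed
  next
    case False
    show ?thesis
    proof (cases "m < 0")
      case True
      then have "df w = removeAll ?x (df v)" using *(3) False by simp
      then show ?thesis using False True *(2) by (auto simp: in_col_def)
    next
      case m: False
      then have "df v = removeAll ?x (df w)" "?x \<in> set (df w)" using *(3) False by simp_all
      then show ?thesis using False m *(2) by (auto simp: in_col_def)
    qed
  qed
  note step = this
  show "insert (l, m + n) (col v n) = col w (n + zero_step l)"
  proof (rule set_eqI)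
    fix x :: "'l block"
    obtain l' m' where x: "x = (l', m')" by (cases x)
    have e: "m' = m + n \<longleftrightarrow> m' - n = m" "m' - (n + zero_step l) = m' - n - zero_step l" by auto
    show "x \<in> insert (l, m + n) (col v n) \<longleftrightarrow> x \<in> col w (n + zero_step l)"
      using step[of l' "m' - n"] unfolding x col_iff insert_iff prod.inject e .
  qed
qed

text \<open>All blocks below the window are present, and a block above it would have to rest on one
  of relative index at least 2, where the column is empty. So only blocks in the window can be
  added, and these are checked.\<close>

lemma complete:
  assumes "(l, m) \<notin> col v n" "rests_on D (l, m) \<subseteq> col v n"
  obtains w where "((l, m - n), w) \<in> set (covers (t v))"
proof -
  have n: "\<not> in_col (df v) (l, m - n)" "rests_in (support D) (df v) (l, m - n)"
    using assms by (simp_all add: col_iff rests_on_col)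
  have "-1 \<le> m - n" using in_col_low[of "m - n" v l] n(1) by linarith
  moreover have "m - n \<le> 2"
  proof (rule ccontr)
    assume m: "\<not> m - n \<le> 2"
    obtain l' d where d: "(l', d) \<in> support D l" using support_nonempty[of l] by auto
    then have "in_col (df v) (l', m - n + d)" using n(2) by (auto simp: rests_in_def)
    moreover have "1 < m - n + d" using support_range[OF d] m by auto
    ultimately show False using in_col_high by blast
  qed
  ultimately have "(l, m - n) \<in> set (window ls)" by (simp add: window_iff)
  then have "(l, m - n) \<in> fst ` set (covers (t v))"
    using all_vs[OF covers_complete, of v] n by (auto simp: covers_complete_def list_all_iff)
  then show thesis using that by auto
qed

lemma block_row_bound: "block_row D (l, m) \<le> 4 * m + 3" "4 * m \<le> block_row D (l, m)"
  using row_range[of l] by (simp_all add: block_row_def)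

lemma pre_young_col: "pre_young D (col v n)"
  unfolding pre_young_def
proof (intro conjI exI[of _ "4 * (n + 1) + 3"] ballI)
  have "(lz, n - 2) \<in> col v n" using in_col_low by (simp add: col_iff)
  then show "col v n \<noteq> {}" by blast
  fix x assume x: "x \<in> col v n"
  obtain l m where lm: "x = (l, m)" by (cases x)
  have "m - n \<le> 1" using x in_col_high[of "m - n" v l] by (force simp: lm col_iff)
  then show "block_row D x \<le> 4 * (n + 1) + 3" using block_row_bound(1)[where l = l and m = m] by (simp add: lm)
qed (use down in blast)

lemma rests_on_rank: "(l', m') \<in> rests_on D (l, m) \<Longrightarrow> 5 * m' + rank l' < 5 * m + rank l"
  using support_range by (force simp: rests_on_iff)

lemma rests_on_irrefl: "x \<notin> rests_on D x"
  using rests_on_rank[of "fst x" "snd x" "fst x" "snd x"] by auto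

lemma pre_young_insert:
  assumes y: "pre_young D y" and x: "x \<notin> y"
  shows "pre_young D (insert x y) \<longleftrightarrow> rests_on D x \<subseteq> y"
proof
  assume "pre_young D (insert x y)"
  then have "rests_on D x \<subseteq> insert x y" unfolding pre_young_def by blast
  then show "rests_on D x \<subseteq> y" using rests_on_irrefl by blast
next
  assume *: "rests_on D x \<subseteq> y"
  obtain h where h: "\<forall>w\<in>y. block_row D w \<le> h" using y unfolding pre_young_def by blast
  have "\<forall>w\<in>insert x y. block_row D w \<le> max h (block_row D x)" using h by auto
  then show "pre_young D (insert x y)" using y * unfolding pre_young_def by blast
qed

text \<open>By \<open>below\<close> one block forces all letters two and three indices lower. Two
  consecutive indices are at hand at each stage, so repeated steps of 2 reach both parities.\<close>

lemma pre_young_contains: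
  assumes y: "pre_young D y"
  obtains N where "\<And>l m. m \<le> N \<Longrightarrow> (l, m) \<in> y"
proof -
  obtain l0 m0 where x: "(l0, m0) \<in> y" using y unfolding pre_young_def by auto
  have b: "(l', m - 2) \<in> y \<and> (l', m - 3) \<in> y" if "(l, m) \<in> y" for l l' m
    using below[of y l m l'] that y unfolding pre_young_def by blast
  have "\<forall>l. (l, m0 - 2 - 2 * int k) \<in> y \<and> (l, m0 - 3 - 2 * int k) \<in> y" for k
  proof (induction k)
    case 0
    then show ?case using b[OF x] by simp
  next
    case (Suc k)
    have "m0 - 2 - 2 * int (Suc k) = m0 - 2 - 2 * int k - 2" "m0 - 3 - 2 * int (Suc k) = m0 - 2 - 2 * int k - 3"
      by simp_all
    then show ?case using b Suc by metis
  qed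
  then have k: "(l, m0 - 2 - 2 * int k) \<in> y" "(l, m0 - 3 - 2 * int k) \<in> y" for l k by blast+
  have "(l, m) \<in> y" if "m \<le> m0 - 2" for l m
  proof -
    define q where "q = nat ((m0 - 2 - m) div 2)"
    have q: "int q = (m0 - 2 - m) div 2" using that by (simp add: q_def)
    have "m = m0 - 2 - 2 * int q \<or> m = m0 - 3 - 2 * int q" unfolding q by presburger
    then show ?thesis using k by metis
  qed
  then show thesis by (rule that)
qed

lemma finite_letters: "finite (A :: 'l set)"
  using ls by (metis List.finite_set finite_subset subset_UNIV)

lemma finite_pre_young_diff:
  assumes y: "pre_young D y" and z: "pre_young D z"
  shows "finite (y - z)"
proof -
  obtain N where N: "\<And>l m. m \<le> N \<Longrightarrow> (l, m) \<in> z" using pre_young_contains[OF z] by blast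
  obtain h where h: "\<forall>x\<in>y. block_row D x \<le> h" using y unfolding pre_young_def by blast
  have "y - z \<subseteq> UNIV \<times> {N..h div 4}"
  proof
    fix x assume x: "x \<in> y - z"
    obtain l m where lm: "x = (l, m)" by (cases x)
    have "N \<le> m" using N[of m l] x lm by (cases "m \<le> N") auto
    moreover have "m \<le> h div 4" using h x lm block_row_bound(2)[where l = l and m = m] by force
    ultimately show "x \<in> UNIV \<times> {N..h div 4}" by (simp add: lm)
  qed
  then show ?thesis by (rule finite_subset) (simp add: finite_letters)
qed

text \<open>Add the missing blocks in the order of their rank.\<close>

lemma pre_young_induct [consumes 3, case_names base step]:
  assumes "pre_young D y" "pre_young D z" "z \<subseteq> y"
    and "Q z"
    and step: "\<And>u x. pre_young D u \<Longrightarrow> Q u \<Longrightarrow> x \<notin> u \<Longrightarrow> pre_young D (insert x u) \<Longrightarrow> Q (insert x u)"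
  shows "Q y"
  using assms(2-4)
proof (induction "card (y - z)" arbitrary: z)
  case 0
  then have "y - z = {}" using finite_pre_young_diff[OF assms(1)] by simp
  then show ?case using 0 by (metis Diff_eq_empty_iff subset_antisym)
next
  case (Suc k)
  have fin: "finite (y - z)" by (rule finite_pre_young_diff[OF assms(1) Suc.prems(1)])
  have ne: "y - z \<noteq> {}" using Suc.hyps(2) by (metis Zero_not_Suc card.empty)
  let ?r = "\<lambda>x. 5 * snd x + rank (fst x)"
  obtain x where x: "x \<in> y - z" "?r x = Min (?r ` (y - z))"
    using Min_in[of "?r ` (y - z)"] fin ne by (metis (no_types, lifting) finite_imageI image_iff image_is_empty)
  then have min: "?r x \<le> ?r w" if "w \<in> y - z" for w
    using Min_le[of "?r ` (y - z)" "?r w"] fin that by (simp del: Diff_iff)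
  have "rests_on D x \<subseteq> z"
  proof
    fix w assume w: "w \<in> rests_on D x"
    then have "w \<in> y" using assms(1) x(1) unfolding pre_young_def by blast
    moreover have "?r w < ?r x"
      using w rests_on_rank[of "fst w" "snd w" "fst x" "snd x"] by simp
    ultimately show "w \<in> z" using min[of w] by force
  qed
  then have *: "pre_young D (insert x z)" using pre_young_insert[OF Suc.prems(1)] x(1) by blast
  have "card (y - insert x z) = k"
  proof -
    have "y - insert x z = (y - z) - {x}" by blast
    then show ?thesis using Suc.hyps(2) card_Diff_singleton[OF x(1)] by (metis diff_Suc_1)
  qed
  then show ?case
  proof (intro Suc.hyps(1)[of "insert x z"])
    show "insert x z \<subseteq> y" using Suc.prems(2) x(1) by blast
    show "Q (insert x z)" by (rule step[OF Suc.prems(1,3) _ *]) (use x(1) in blast)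
  qed (simp_all add: *)
qed

lemma pre_young_above:
  assumes "pre_young D y"
  obtains n where "col v0 n \<subseteq> y"
proof -
  obtain N where N: "\<And>l m. m \<le> N \<Longrightarrow> (l, m) \<in> y" using pre_young_contains[OF assms] by blast
  have "col v0 (N + 1) \<subseteq> y" using N by (auto simp: col_iff in_col_def v0)
  then show thesis by (rule that)
qed

lemma pre_young_step:
  assumes "x \<notin> col v n" "pre_young D (insert x (col v n))"
  obtains l m w where "x = (l, m + n)" "((l, m), w) \<in> set (covers (t v))"
    "insert x (col v n) = col w (n + zero_step l)"
proof -
  obtain l m where x: "x = (l, m)" by (cases x)
  have "rests_on D (l, m) \<subseteq> col v n" using pre_young_insert[OF pre_young_col] assms x by blast
  then obtain w where w: "((l, m - n), w) \<in> set (covers (t v))" using complete assms(1) x by blast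
  show thesis using that[of l "m - n" w] w cover(2)[OF w, of n] x by simp
qed

text \<open>Shifted down far enough, the column of \<open>v0\<close> lies inside any pre-Young
  column, and building upwards from it only meets covers of the table.\<close>

lemma pre_young_iff: "pre_young D y \<longleftrightarrow> (\<exists>v n. y = col v n)"
proof
  assume y: "pre_young D y"
  obtain n where "col v0 n \<subseteq> y" using pre_young_above[OF y] .
  with y pre_young_col[of v0 n] show "\<exists>v n. y = col v n"
  proof (induction rule: pre_young_induct)
    case (step u x)
    then show ?case using pre_young_step by metis
  qed blast
qed (use pre_young_col in blast)

lemma lz_col: "(lz, m) \<in> col v n \<longleftrightarrow> (if v = ve then m < n - 1 \<or> m = n else m < n)"
  by (auto simp: col_iff in_col_def lz_diff)

text \<open>The 0-blocks reveal the shift: they fill all indices below \<open>n\<close>, except for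
  \<open>ve\<close>, where \<open>n\<close> replaces \<open>n - 1\<close>. Once the shift is known,
  the set of remaining blocks determines the vertex.\<close>

lemma col_inj: "col v n = col w k \<longleftrightarrow> v = w \<and> n = k"
proof
  assume eq: "col v n = col w k"
  have lzs: "(lz, m) \<in> col v n \<longleftrightarrow> (lz, m) \<in> col w k" for m using eq by simp
  have "n = k"
    \<comment> \<open>The instances are the indices around the upper ends of the two patterns of
      0-blocks; there the patterns differ unless the shifts agree.\<close>
    using lzs[of n] lzs[of k] lzs[of "n - 1"] lzs[of "k - 1"] lzs[of "n - 2"] lzs[of "k - 2"] lzs[of "n + 1"]
      lzs[of "k + 1"]
    unfolding lz_col by (auto split: if_splits)
  then have "in_col (df v) x \<longleftrightarrow> in_col (df w) x" for x
    using eq by (cases x) (metis add_diff_cancel_right' col_iff)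
  then have "set (df v) = set (df w)" unfolding in_col_def by blast
  moreover have "df u = filter (\<lambda>x. x \<in> set (df u)) (window ls)" for u
    using all_vs[OF is_down, of u] unfolding is_down_def by blast
  ultimately have "df v = df w" by metis
  then have "v = w" using distinct_diff vs by (simp add: distinct_map inj_on_def)
  then show "v = w \<and> n = k" using \<open>n = k\<close> by simp
qed simp

lemma cocover_iff: "(x, w) \<in> set (cocovers (t v)) \<longleftrightarrow> (x, v) \<in> set (covers (t w))"
  using all_vs[OF cocovers_ok, of v] all_vs[OF cocovers_ok, of w]
  unfolding cocovers_ok_def list_all_iff by fast

text \<open>Removal is a cover read backwards. The table stores the index of a block relative to the
  column without it, whence the correction by \<open>zero_step\<close>.\<close>

lemma pre_young_remove:
  assumes "x \<in> col v n" "pre_young D (col v n - {x})"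
  obtains l m w where "x = (l, m + n - zero_step l)" "((l, m), w) \<in> set (cocovers (t v))"
    "col v n - {x} = col w (n - zero_step l)"
proof -
  obtain w k where w: "col v n - {x} = col w k" using assms(2) pre_young_iff by blast
  have "x \<notin> col w k" "insert x (col w k) = col v n" using w assms(1) by auto
  then obtain l m u where *: "x = (l, m + k)" "((l, m), u) \<in> set (covers (t w))"
    "col v n = col u (k + zero_step l)"
    using pre_young_step[of x w k] pre_young_col by metis
  then show thesis using that[of l m w] w by (simp add: col_inj cocover_iff)
qed

lemma cocover:
  assumes "((l, m), w) \<in> set (cocovers (t v))"
  shows "(l, m + n - zero_step l) \<in> col v n"
    "col v n - {(l, m + n - zero_step l)} = col w (n - zero_step l)"
proof -
  have c: "((l, m), v) \<in> set (covers (t w))" using assms by (simp add: cocover_iff)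
  note * = cover[OF c, of "n - zero_step l"]
  have "m + (n - zero_step l) = m + n - zero_step l" "n - zero_step l + zero_step l = n" by simp_all
  then show "(l, m + n - zero_step l) \<in> col v n"
    "col v n - {(l, m + n - zero_step l)} = col w (n - zero_step l)"
    using * by (metis insertI1, metis Diff_insert_absorb)
qed

end

lemma arg_max_eqI:
  fixes f :: "'a \<Rightarrow> 'b :: linorder"
  assumes "Q x" "\<And>y. Q y \<Longrightarrow> y \<noteq> x \<Longrightarrow> f y < f x"
  shows "arg_max f Q = x"
  unfolding arg_max_def
proof (rule some_equality)
  show "is_arg_max f Q x" unfolding is_arg_max_def using assms by (metis less_asym less_irrefl)
  show "y = x" if "is_arg_max f Q y" for y using that assms unfolding is_arg_max_def by metis
qed

lemma arg_min_eqI: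
  fixes f :: "'a \<Rightarrow> 'b :: linorder"
  assumes "Q x" "\<And>y. Q y \<Longrightarrow> y \<noteq> x \<Longrightarrow> f x < f y"
  shows "arg_min f Q = x"
  unfolding arg_min_def
proof (rule some_equality)
  show "is_arg_min f Q x" unfolding is_arg_min_def using assms by (metis less_asym less_irrefl)
  show "y = x" if "is_arg_min f Q y" for y using that assms unfolding is_arg_min_def by metis
qed

section \<open>Exceptional columns and column operators through the table\<close>

context column_model
begin

abbreviation "F \<equiv> vertex_f (colour D) t"
abbreviation "E \<equiv> vertex_e (colour D) t"
abbreviation "W \<equiv> weight_of (colour D) t"
abbreviation delta0 :: "ind \<Rightarrow> int" where "delta0 i \<equiv> if i = I0 then 1 else 0"

lemma all_inds: "list_all Q inds \<Longrightarrow> Q i"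
  by (cases i) (simp_all add: inds_def)

lemma free_iff: "free_block D (col v n) x \<longleftrightarrow>
    (\<exists>l m w. x = (l, m + n - zero_step l) \<and> ((l, m), w) \<in> set (cocovers (t v)))"
proof
  assume "free_block D (col v n) x"
  then have "x \<in> col v n" "pre_young D (col v n - {x})" unfolding free_block_def by simp_all
  then show "\<exists>l m w. x = (l, m + n - zero_step l) \<and> ((l, m), w) \<in> set (cocovers (t v))"
    by (rule pre_young_remove) blast
next
  assume "\<exists>l m w. x = (l, m + n - zero_step l) \<and> ((l, m), w) \<in> set (cocovers (t v))"
  then obtain l m w where x: "x = (l, m + n - zero_step l)" and c: "((l, m), w) \<in> set (cocovers (t v))" by blast
  show "free_block D (col v n) x"
    using cocover[OF c, of n] pre_young_col[of w "n - zero_step l"] unfolding free_block_def x by simp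
qed

lemma cocover_window:
  assumes "(x, w) \<in> set (cocovers (t v))"
  shows "x \<in> set (window ls)"
proof -
  have "(x, v) \<in> set (covers (t w))" using assms cocover_iff by simp
  then show ?thesis
    using all_vs[OF covers_sound, of w] unfolding covers_sound_def list_all_iff by fast
qed

lemma block_row_shift: "block_row D (l, m + n) = row_of (row D) (l, m) + 4 * n"
  by (simp add: block_row_def row_of_def)

text \<open>Blocks below the window cannot compete for the top row, since they lie in rows under all
  those of relative index -1.\<close>

lemma top_iff:
  assumes x: "(l, m) \<in> set (window ls)" and in_col: "(l, m + n) \<in> col v n"
  shows "(l, m + n) \<in> top_blocks D (col v n) \<longleftrightarrow>
    list_all (\<lambda>w. in_col (df v) w \<longrightarrow> row_of (row D) w \<le> row_of (row D) (l, m)) (window ls)"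
    (is "?L \<longleftrightarrow> ?R")
proof
  assume top: ?L
  show ?R
    unfolding list_all_iff
  proof (intro ballI impI)
    fix w assume w: "w \<in> set (window ls)" "in_col (df v) w"
    obtain l' m' where lm: "w = (l', m')" by (cases w)
    have "(l', m' + n) \<in> col v n" using w by (simp add: lm col_iff)
    then have "block_row D (l', m' + n) \<le> block_row D (l, m + n)" using top unfolding top_blocks_def by blast
    then show "row_of (row D) w \<le> row_of (row D) (l, m)" by (simp add: block_row_shift lm)
  qed
next
  assume R: ?R
  have "block_row D w \<le> block_row D (l, m + n)" if w: "w \<in> col v n" for w
  proof -
    obtain l' m' where lm: "w = (l', m' + n)" by (metis diff_add_cancel prod.collapse)
    have c: "in_col (df v) (l', m')" using w by (simp add: lm col_iff)
    have "m' \<le> 1" using in_col_high[of m' v l'] c by linarith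
    show ?thesis
    proof (cases "m' < -1")
      case True
      have "-1 \<le> m" using x by (simp add: window_iff)
      then show ?thesis using True row_range[of l] row_range[of l'] by (simp add: lm block_row_def)
    next
      case False
      then have "(l', m') \<in> set (window ls)" using \<open>m' \<le> 1\<close> by (simp add: window_iff)
      then show ?thesis using R c by (simp add: list_all_iff lm block_row_shift)
    qed
  qed
  then show ?L using in_col unfolding top_blocks_def by blast
qed

lemma exceptional_iff: "exceptional D (col v n) \<longleftrightarrow> v = vx"
proof -
  define top2 where "top2 = filter (\<lambda>x. colour D (fst x) = I2 \<and>
    list_all (\<lambda>w. in_col (df v) w \<longrightarrow> row_of (row D) w \<le> row_of (row D) x) (window ls)) (map fst (cocovers (t v)))"
  define free1 where "free1 \<longleftrightarrow> list_ex (\<lambda>(x, w). colour D (fst x) = I1) (cocovers (t v))"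
  have ok: "if v = vx then length top2 = 1 \<and> free1 else free1 \<longrightarrow> top2 = []"
    using all_vs[OF exceptional_ok, of v] name_vx[of v]
    unfolding exceptional_ok_def Let_def top2_def free1_def by simp
  have free1: "(\<exists>x. free_block D (col v n) x \<and> block_colour D x = I1) \<longleftrightarrow> free1"
    unfolding free1_def list_ex_iff free_iff block_colour_def by fastforce
  have top2: "x \<in> top_blocks D (col v n) \<and> free_block D (col v n) x \<and> block_colour D x = I2 \<longleftrightarrow>
      (fst x, snd x - n) \<in> set top2" for x
  proof
    assume x: "x \<in> top_blocks D (col v n) \<and> free_block D (col v n) x \<and> block_colour D x = I2"
    then obtain l m w where lm: "x = (l, m + n - zero_step l)" "((l, m), w) \<in> set (cocovers (t v))"
      unfolding free_iff by blast
    have l: "colour D l = I2" using x lm(1) by (simp add: block_colour_def)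
    then have xe: "x = (l, m + n)" using lm(1) by simp
    have "(l, m + n) \<in> col v n" using x unfolding xe top_blocks_def by blast
    then have "list_all (\<lambda>w. in_col (df v) w \<longrightarrow> row_of (row D) w \<le> row_of (row D) (l, m)) (window ls)"
      using top_iff[OF cocover_window[OF lm(2)]] x xe by blast
    moreover have "(l, m) \<in> set (map fst (cocovers (t v)))" using lm(2) by force
    ultimately show "(fst x, snd x - n) \<in> set top2" using l by (simp add: xe top2_def)
  next
    assume x: "(fst x, snd x - n) \<in> set top2"
    obtain l m where lm: "x = (l, m + n)" by (metis diff_add_cancel prod.collapse)
    have *: "colour D l = I2" "(l, m) \<in> fst ` set (cocovers (t v))"
      "list_all (\<lambda>w. in_col (df v) w \<longrightarrow> row_of (row D) w \<le> row_of (row D) (l, m)) (window ls)"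
      using x by (simp_all add: lm top2_def)
    then obtain w where w: "((l, m), w) \<in> set (cocovers (t v))" by auto
    have "(l, m + n) \<in> col v n" using cocover(1)[OF w, of n] *(1) by simp
    then have "x \<in> top_blocks D (col v n)" using top_iff[OF cocover_window[OF w]] *(3) lm by blast
    moreover have "free_block D (col v n) x"
      unfolding free_iff using w *(1) lm by (intro exI[of _ l] exI[of _ m] exI[of _ w]) simp
    ultimately show "x \<in> top_blocks D (col v n) \<and> free_block D (col v n) x \<and> block_colour D x = I2"
      using *(1) by (simp add: lm block_colour_def)
  qed
  show ?thesis
  proof
    assume "exceptional D (col v n)"
    then have "free1" "top2 \<noteq> []" unfolding exceptional_def free1 top2 by auto
    then show "v = vx" using ok by (auto split: if_splits)
  next
    assume "v = vx"
    then have "length top2 = 1" "free1" using ok by simp_all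
    then obtain a where a: "top2 = [a]" by (metis One_nat_def length_0_conv length_Suc_conv)
    have "(fst x, snd x - n) \<in> set top2 \<longleftrightarrow> x = (fst a, snd a + n)" for x
      by (cases x; cases a) (auto simp: a)
    then show "exceptional D (col v n)" unfolding exceptional_def free1 top2 using \<open>free1\<close> by simp
  qed
qed

lemma young_col: "young_column D (col v n) \<longleftrightarrow> v \<noteq> vx"
  by (simp add: young_column_def pre_young_col exceptional_iff)

lemma young_iff: "young_column D y \<longleftrightarrow> (\<exists>v n. v \<noteq> vx \<and> y = col v n)"
  using pre_young_iff young_col unfolding young_column_def by metis

lemma set_moves: "(x, w) \<in> set (moves (colour D) t i cs) \<longleftrightarrow> (x, w) \<in> set cs \<and> colour D (fst x) = i \<and> w \<noteq> vx"
  by (auto simp: moves_def name_vx)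

lemma addable_iff: "addable D i (col v n) x \<longleftrightarrow>
    (\<exists>l m w. x = (l, m + n) \<and> ((l, m), w) \<in> set (moves (colour D) t i (covers (t v))))"
proof
  assume a: "addable D i (col v n) x"
  then have "x \<notin> col v n" "pre_young D (insert x (col v n))" unfolding addable_def young_column_def by simp_all
  then obtain l m w where *: "x = (l, m + n)" "((l, m), w) \<in> set (covers (t v))"
      "insert x (col v n) = col w (n + zero_step l)"
    by (rule pre_young_step)
  have "w \<noteq> vx" "colour D l = i" using a *(1) unfolding addable_def *(3) young_col by (simp_all add: block_colour_def)
  then show "\<exists>l m w. x = (l, m + n) \<and> ((l, m), w) \<in> set (moves (colour D) t i (covers (t v)))"
    using * set_moves by fastforce
next
  assume "\<exists>l m w. x = (l, m + n) \<and> ((l, m), w) \<in> set (moves (colour D) t i (covers (t v)))"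
  then obtain l m w where *: "x = (l, m + n)" "((l, m), w) \<in> set (covers (t v))" "colour D l = i" "w \<noteq> vx"
    using set_moves by fastforce
  show "addable D i (col v n) x"
    using cover[OF *(2), of n] *(3,4) unfolding addable_def *(1) by (simp add: block_colour_def young_col)
qed

lemma removable_iff: "removable D i (col v n) x \<longleftrightarrow>
    (\<exists>l m w. x = (l, m + n - delta0 i) \<and> ((l, m), w) \<in> set (moves (colour D) t i (cocovers (t v))))"
proof
  assume a: "removable D i (col v n) x"
  then have "x \<in> col v n" "pre_young D (col v n - {x})" unfolding removable_def young_column_def by simp_all
  then obtain l m w where *: "x = (l, m + n - zero_step l)" "((l, m), w) \<in> set (cocovers (t v))"
      "col v n - {x} = col w (n - zero_step l)"
    by (rule pre_young_remove)
  have "w \<noteq> vx" "colour D l = i" using a *(1) unfolding removable_def *(3) young_col by (simp_all add: block_colour_def)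
  then show "\<exists>l m w. x = (l, m + n - delta0 i) \<and> ((l, m), w) \<in> set (moves (colour D) t i (cocovers (t v)))"
    using * set_moves by fastforce
next
  assume "\<exists>l m w. x = (l, m + n - delta0 i) \<and> ((l, m), w) \<in> set (moves (colour D) t i (cocovers (t v)))"
  then obtain l m w where *: "x = (l, m + n - delta0 i)" "((l, m), w) \<in> set (cocovers (t v))" "colour D l = i" "w \<noteq> vx"
    using set_moves by fastforce
  show "removable D i (col v n) x"
    using cocover[OF *(2), of n] *(3,4) unfolding removable_def *(1) by (simp add: block_colour_def young_col)
qed

lemma blocked_iff: "v \<noteq> vx \<Longrightarrow> blocked D i (col v n) \<longleftrightarrow> blocked_name i (name (t v))"
proof -
  assume v: "v \<noteq> vx"
  have eq: "{(l, m). in_col (df w) (l, m - 1)} = col w 1" for w by (simp add: col_def)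
  have "col v n \<in> shift_class (col w 1) \<longleftrightarrow> v = w" for w
  proof
    assume "v = w"
    then have "col v n = shift (n - 1) (col w 1)" by (simp add: shift_col)
    then show "col v n \<in> shift_class (col w 1)" unfolding shift_class_def by blast
  qed (auto simp: shift_class_def shift_col col_inj)
  then have "blocked D i (col v n) \<longleftrightarrow> (\<exists>j. j \<noteq> i \<and> j \<noteq> I0 \<and> name (t v) = R j)"
    unfolding blocked_def col_r eq by metis
  then show ?thesis using v name_vx[of v] by (auto simp: blocked_name_def split: pelem.split)
qed

lemma sorted_moves:
  "sorted_wrt (\<lambda>(x, _) (y, _). row_of (row D) x < row_of (row D) y) (moves (colour D) t i (covers (t v)))"
  "sorted_wrt (\<lambda>(x, _) (y, _). row_of (row D) x < row_of (row D) y) (moves (colour D) t i (cocovers (t v)))"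
  using all_inds[OF all_vs[OF sorted_rows, of v, unfolded sorted_rows_def], of i] by simp_all

text \<open>The addable blocks are the moves of the table, and their rows increase strictly along
  the list; so \<open>arg_max\<close> is unambiguous and equals the last move.\<close>

lemma col_f_col:
  assumes v: "v \<noteq> vx"
  shows "col_f D i (col v n) = map_option (\<lambda>w. col w (n + delta0 i)) (F i v)"
proof (cases "blocked_name i (name (t v))")
  case True
  then show ?thesis using v by (simp add: col_f_def blocked_iff vertex_f_def)
next
  case nb: False
  let ?ms = "moves (colour D) t i (covers (t v))"
  show ?thesis
  proof (cases "rev ?ms")
    case Nil
    then show ?thesis using v nb by (simp add: col_f_def blocked_iff vertex_f_def addable_iff)
  next
    case (Cons a ms)
    obtain l m w where a: "a = ((l, m), w)" by (metis prod.collapse)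
    have ms: "?ms = rev ms @ [((l, m), w)]" using Cons a by (metis rev.simps(2) rev_rev_ident)
    then have c: "((l, m), w) \<in> set ?ms" by simp
    have less: "row_of (row D) x < row_of (row D) (l, m)" if "(x, u) \<in> set ms" for x u
      using sorted_moves(1)[of i v] that unfolding ms sorted_wrt_append by fastforce
    have "arg_max (block_row D) (addable D i (col v n)) = (l, m + n)"
    proof (rule arg_max_eqI)
      show "addable D i (col v n) (l, m + n)" using c addable_iff by blast
      fix y assume y: "addable D i (col v n) y" "y \<noteq> (l, m + n)"
      then obtain l' m' u where u: "y = (l', m' + n)" "((l', m'), u) \<in> set ?ms" using addable_iff by blast
      then have "((l', m'), u) \<in> set ms" using y(2) ms by auto
      then show "block_row D y < block_row D (l, m + n)" using less u(1) by (simp add: block_row_shift)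
    qed
    moreover have "F i v = Some w" using v nb Cons by (simp add: vertex_f_def name_vx a)
    moreover have "insert (l, m + n) (col v n) = col w (n + delta0 i)"
      using cover(2)[of l m w v n] c set_moves by simp
    moreover have "\<exists>x. addable D i (col v n) x" using c addable_iff by blast
    ultimately show ?thesis using v nb by (simp add: col_f_def blocked_iff)
  qed
qed

lemma col_e_col:
  assumes v: "v \<noteq> vx"
  shows "col_e D i (col v n) = map_option (\<lambda>w. col w (n - delta0 i)) (E i v)"
proof (cases "blocked_name i (name (t v))")
  case True
  then show ?thesis using v by (simp add: col_e_def blocked_iff vertex_e_def)
next
  case nb: False
  let ?ms = "moves (colour D) t i (cocovers (t v))"
  show ?thesis
  proof (cases ?ms)
    case Nil
    then show ?thesis using v nb by (simp add: col_e_def blocked_iff vertex_e_def removable_iff)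
  next
    case (Cons a ms)
    obtain l m w where a: "a = ((l, m), w)" by (metis prod.collapse)
    have ms: "?ms = ((l, m), w) # ms" using Cons a by simp
    then have c: "((l, m), w) \<in> set ?ms" by simp
    have less: "row_of (row D) (l, m) < row_of (row D) x" if "(x, u) \<in> set ms" for x u
      using sorted_moves(2)[of i v] that unfolding ms by fastforce
    have row: "block_row D (l', m' + n - delta0 i) = row_of (row D) (l', m') + 4 * (n - delta0 i)" for l' m'
      by (simp add: block_row_def row_of_def)
    have "arg_min (block_row D) (removable D i (col v n)) = (l, m + n - delta0 i)"
    proof (rule arg_min_eqI)
      show "removable D i (col v n) (l, m + n - delta0 i)" using c removable_iff by blast
      fix y assume y: "removable D i (col v n) y" "y \<noteq> (l, m + n - delta0 i)"
      then obtain l' m' u where u: "y = (l', m' + n - delta0 i)" "((l', m'), u) \<in> set ?ms" using removable_iff by blast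
      then have "((l', m'), u) \<in> set ms" using y(2) ms by auto
      then show "block_row D (l, m + n - delta0 i) < block_row D y" using less u(1) row by simp
    qed
    moreover have "E i v = Some w" using v nb Cons by (simp add: vertex_e_def name_vx a)
    moreover have "col v n - {(l, m + n - delta0 i)} = col w (n - delta0 i)"
      using cocover(2)[of l m w v n] c set_moves by simp
    moreover have "\<exists>x. removable D i (col v n) x" using c removable_iff by blast
    ultimately show ?thesis using v nb by (simp add: col_e_def blocked_iff)
  qed
qed

lemma F_move:
  assumes "F i v = Some w"
  obtains x where "(x, w) \<in> set (moves (colour D) t i (covers (t v)))"
proof (cases "rev (moves (colour D) t i (covers (t v)))")
  case Nil
  then show thesis using assms by (simp add: vertex_f_def split: if_splits)
next
  case (Cons a ms)
  then have "a \<in> set (moves (colour D) t i (covers (t v)))" by (metis list.set_intros(1) set_rev)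
  moreover have "snd a = w" using assms Cons by (cases a) (simp add: vertex_f_def split: if_splits)
  ultimately show thesis using that[of "fst a"] by (metis prod.collapse)
qed

lemma E_move:
  assumes "E i v = Some w"
  obtains x where "(x, w) \<in> set (moves (colour D) t i (cocovers (t v)))"
proof (cases "moves (colour D) t i (cocovers (t v))")
  case Nil
  then show thesis using assms by (simp add: vertex_e_def split: if_splits)
next
  case (Cons a ms)
  moreover have "snd a = w" using assms Cons by (cases a) (simp add: vertex_e_def split: if_splits)
  ultimately show thesis using that[of "fst a"] by (metis list.set_intros(1) prod.collapse)
qed

lemma F_not_vx: "F i v = Some w \<Longrightarrow> w \<noteq> vx"
  using F_move set_moves by metis

lemma E_not_vx: "E i v = Some w \<Longrightarrow> w \<noteq> vx"
  using E_move set_moves by metis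

lemma F_cover:
  assumes "F i v = Some w"
  obtains l m where "((l, m), w) \<in> set (covers (t v))" "colour D l = i"
  using F_move[OF assms] set_moves that by (metis prod.collapse)

lemma strings:
  "F i v = Some w \<Longrightarrow> E i w = Some v \<and> steps (F i) v = 1 + steps (F i) w"
  "E i v = Some w \<Longrightarrow> F i w = Some v \<and> steps (E i) v = 1 + steps (E i) w"
  using all_inds[OF all_vs[OF strings_ok, of v, unfolded strings_ok_def], of i] by auto

lemma steps_nonneg: "0 \<le> steps h v"
  by (simp add: steps_def split: option.split)

lemma string_length_F: "string_length (F i) v = steps (F i) v"
proof -
  have "string_length (F i) v = int (nat (steps (F i) v))"
  proof (rule string_length_eqI[where S = UNIV])
    show "nat (steps (F i) x) = (case F i x of None \<Rightarrow> 0 | Some y \<Rightarrow> Suc (nat (steps (F i) y)))" for x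
      using strings(1)[of i x] steps_nonneg[of "F i"]
      by (cases "F i x") (simp add: steps_def, simp add: Suc_nat_eq_nat_zadd1)
  qed simp_all
  then show ?thesis by (simp add: steps_nonneg)
qed

lemma string_length_E: "string_length (E i) v = steps (E i) v"
proof -
  have "string_length (E i) v = int (nat (steps (E i) v))"
  proof (rule string_length_eqI[where S = UNIV])
    show "nat (steps (E i) x) = (case E i x of None \<Rightarrow> 0 | Some y \<Rightarrow> Suc (nat (steps (E i) y)))" for x
      using strings(2)[of i x] steps_nonneg[of "E i"]
      by (cases "E i x") (simp add: steps_def, simp add: Suc_nat_eq_nat_zadd1)
  qed simp_all
  then show ?thesis by (simp add: steps_nonneg)
qed

text \<open>Well defined by \<open>col_inj\<close>. This map intertwines the operators on columns
  and on vertices, which carries over the string lengths.\<close>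

definition vertex :: "'l block set \<Rightarrow> 'v" where
  "vertex y = (THE v. \<exists>n. y = col v n)"

lemma vertex_col: "vertex (col v n) = v"
  unfolding vertex_def by (rule the_equality) (auto simp: col_inj)

lemma col_phi_col: "v \<noteq> vx \<Longrightarrow> col_phi D i (col v n) = steps (F i) v"
proof -
  assume v: "v \<noteq> vx"
  have "string_length (F i) (vertex (col v n)) = string_length (col_f D i) (col v n)"
  proof (rule string_length_map[where S = "{y. young_column D y}"])
    fix x assume "x \<in> {y. young_column D y}"
    then obtain u k where u: "u \<noteq> vx" "x = col u k" using young_iff by blast
    show "F i (vertex x) = map_option vertex (col_f D i x)"
      using u by (cases "F i u") (simp_all add: col_f_col vertex_col)
    show "y \<in> {y. young_column D y}" if "col_f D i x = Some y" for y
      using that u F_not_vx[of i u] by (auto simp: col_f_col young_col)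
  qed (use v young_col in simp)
  then show ?thesis by (simp add: col_phi_def string_length_F vertex_col)
qed

lemma col_eps_col: "v \<noteq> vx \<Longrightarrow> col_eps D i (col v n) = steps (E i) v"
proof -
  assume v: "v \<noteq> vx"
  have "string_length (E i) (vertex (col v n)) = string_length (col_e D i) (col v n)"
  proof (rule string_length_map[where S = "{y. young_column D y}"])
    fix x assume "x \<in> {y. young_column D y}"
    then obtain u k where u: "u \<noteq> vx" "x = col u k" using young_iff by blast
    show "E i (vertex x) = map_option vertex (col_e D i x)"
      using u by (cases "E i u") (simp_all add: col_e_col vertex_col)
    show "y \<in> {y. young_column D y}" if "col_e D i x = Some y" for y
      using that u E_not_vx[of i u] by (auto simp: col_e_col young_col)
  qed (use v young_col in simp)
  then show ?thesis by (simp add: col_eps_def string_length_E vertex_col)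
qed

section \<open>Counting blocks by colour\<close>

lemma W_cover: "((l, m), w) \<in> set (covers (t v)) \<Longrightarrow> W w j = W v j - cartan D j (colour D l)"
proof -
  assume c: "((l, m), w) \<in> set (covers (t v))"
  have "list_all (\<lambda>(x, w). list_all (\<lambda>j. W w j = W v j - cartan D j (colour D (fst x))) inds) (covers (t v))"
    using all_vs[OF weights_ok, of v] unfolding weights_ok_def by blast
  then have "list_all (\<lambda>j. W w j = W v j - cartan D j (colour D l)) inds"
    using c unfolding list_all_iff[of _ "covers (t v)"] by fastforce
  then show ?thesis by (rule all_inds)
qed

lemma W_name: "(case name (t v) of X \<alpha> \<Rightarrow> fst (root_wt (cartan D) \<alpha>) j | _ \<Rightarrow> 0) = W v j"
  using all_inds[of "\<lambda>j. (case name (t v) of X \<alpha> \<Rightarrow> fst (root_wt (cartan D) \<alpha>) j | _ \<Rightarrow> 0) = W v j"]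
    all_vs[OF weights_ok, of v] unfolding weights_ok_def by blast

lemma colour_count_insert:
  assumes u: "pre_young D u" and g: "pre_young D g" and x: "x \<notin> u"
  shows "colour_count D g i (insert x u) = colour_count D g i u + (if block_colour D x = i then 1 else 0)"
proof -
  have fin: "finite {x \<in> u - g. block_colour D x = i}" "finite {x \<in> g - u. block_colour D x = i}"
    by (rule finite_subset[OF _ finite_pre_young_diff[OF u g]], blast,
        rule finite_subset[OF _ finite_pre_young_diff[OF g u]], blast)
  show ?thesis
  proof (cases "block_colour D x = i")
    case False
    then have "{w \<in> insert x u - g. block_colour D w = i} = {w \<in> u - g. block_colour D w = i}"
      "{w \<in> g - insert x u. block_colour D w = i} = {w \<in> g - u. block_colour D w = i}" by auto
    then show ?thesis using False unfolding colour_count_def by simp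
  next
    case True
    show ?thesis
    proof (cases "x \<in> g")
      case g: True
      have "{w \<in> insert x u - g. block_colour D w = i} = {w \<in> u - g. block_colour D w = i}" using g by auto
      moreover have "{w \<in> g - u. block_colour D w = i} = insert x {w \<in> g - insert x u. block_colour D w = i}"
        using g x True by auto
      moreover have "finite {w \<in> g - insert x u. block_colour D w = i}"
        by (rule finite_subset[OF _ fin(2)]) blast
      ultimately show ?thesis using True unfolding colour_count_def by simp
    next
      case g: False
      have "{w \<in> insert x u - g. block_colour D w = i} = insert x {w \<in> u - g. block_colour D w = i}"
        using g True by auto
      moreover have "{w \<in> g - insert x u. block_colour D w = i} = {w \<in> g - u. block_colour D w = i}"
        using g by auto
      ultimately show ?thesis using True x fin unfolding colour_count_def by simp
    qed
  qed
qed

text \<open>Both sides change in the same way when a block is added.\<close>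

lemma counts_from_base:
  assumes g: "pre_young D g" and sub: "col v0 N \<subseteq> col v n"
  shows "colour_count D g I0 (col v n) - n = colour_count D g I0 (col v0 N) - N"
    and "(\<Sum>i\<in>UNIV. colour_count D g i (col v n) * cartan D j i) + W v j =
      (\<Sum>i\<in>UNIV. colour_count D g i (col v0 N) * cartan D j i) + W v0 j"
proof -
  let ?C = "\<lambda>u. \<Sum>i\<in>UNIV. colour_count D g i u * cartan D j i"
  have "\<exists>w k. u = col w k \<and> colour_count D g I0 u - k = colour_count D g I0 (col v0 N) - N \<and>
      ?C u + W w j = ?C (col v0 N) + W v0 j" if "pre_young D u" "col v0 N \<subseteq> u" for u
    using that(1) pre_young_col[of v0 N] that(2)
  proof (induction rule: pre_young_induct)
    case base
    show ?case by blast
  next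
    case (step u x)
    then obtain w k where w: "u = col w k" "colour_count D g I0 u - k = colour_count D g I0 (col v0 N) - N"
      "?C u + W w j = ?C (col v0 N) + W v0 j" by blast
    then obtain l m w' where x: "x = (l, m + k)" "((l, m), w') \<in> set (covers (t w))"
        "insert x (col w k) = col w' (k + zero_step l)"
      using pre_young_step[of x w k] step.hyps by metis
    have col: "block_colour D x = colour D l" by (simp add: x(1) block_colour_def)
    note cc = colour_count_insert[OF step.hyps(1) g step.hyps(2), unfolded col]
    have "?C (insert x u) = (\<Sum>i\<in>UNIV. colour_count D g i u * cartan D j i +
        (if i = colour D l then cartan D j i else 0))"
      unfolding cc by (rule sum.cong) (auto simp: algebra_simps)
    also have "\<dots> = ?C u + cartan D j (colour D l)" by (simp add: sum.distrib)
    finally have "?C (insert x u) + W w' j = ?C (col v0 N) + W v0 j"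
      using w(3) W_cover[OF x(2), of j] by simp
    moreover have "colour_count D g I0 (insert x u) - (k + zero_step l) = colour_count D g I0 (col v0 N) - N"
      using w(2) cc[of I0] by simp
    ultimately show ?case using x(3) w(1) by blast
  qed
  then obtain w k where "col v n = col w k" "colour_count D g I0 (col v n) - k = colour_count D g I0 (col v0 N) - N"
      "?C (col v n) + W w j = ?C (col v0 N) + W v0 j"
    using pre_young_col sub by blast
  then show "colour_count D g I0 (col v n) - n = colour_count D g I0 (col v0 N) - N"
    "?C (col v n) + W v j = ?C (col v0 N) + W v0 j"
    by (simp_all add: col_inj)
qed

lemma W_ve: "W ve j = 0"
  using W_name[where v = ve and j = j] by (simp add: ve)

text \<open>Counts relative to \<open>col ve n0\<close> are obtained by comparing both columns with
  one low column contained in each; the minimum \<open>min n1 n2\<close> provides it, and the weight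
  of \<open>ve\<close> is 0.\<close>

lemma counts:
  shows "colour_count D (col ve n0) I0 (col v n) = n - n0"
    and "(\<Sum>i\<in>UNIV. colour_count D (col ve n0) i (col v n) * cartan D j i) = - W v j"
proof -
  obtain n1 n2 where "col v0 n1 \<subseteq> col v n" "col v0 n2 \<subseteq> col ve n0"
    using pre_young_above[OF pre_young_col[of v n]] pre_young_above[OF pre_young_col[of ve n0]] by metis
  moreover have "col v0 (min n1 n2) \<subseteq> col v0 n1" "col v0 (min n1 n2) \<subseteq> col v0 n2"
    by (auto simp: col_iff in_col_def v0)
  ultimately have "col v0 (min n1 n2) \<subseteq> col v n" "col v0 (min n1 n2) \<subseteq> col ve n0" by blast+
  note b = counts_from_base[OF pre_young_col[of ve n0] this(1)] counts_from_base[OF pre_young_col[of ve n0] this(2)]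
  have self: "colour_count D (col ve n0) i (col ve n0) = 0" for i by (simp add: colour_count_def)
  show "colour_count D (col ve n0) I0 (col v n) = n - n0" using b(1,3) self by simp
  show "(\<Sum>i\<in>UNIV. colour_count D (col ve n0) i (col v n) * cartan D j i) = - W v j"
    using b(2,4)[of j] self W_ve by simp
qed

lemma zero_count_col: "zero_count D (col ve n0) (col v n) = n - n0"
  using counts(1)[of n0 v n] by (simp add: colour_count_def zero_count_def)

end

section \<open>Crystals from a table\<close>

lemma columns_nth:
  "k < length vs \<Longrightarrow> \<forall>r\<in>set rows. length r = length vs \<Longrightarrow> columns vs rows ! k = map (\<lambda>r. r ! k) rows"
proof (induction vs arbitrary: rows k)
  case (Cons v vs)
  have ne: "r \<noteq> []" if "r \<in> set rows" for r using Cons.prems(2) that by force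
  show ?case
  proof (cases k)
    case 0
    then show ?thesis using ne by (simp add: hd_conv_nth)
  next
    case (Suc j)
    have "columns vs (map tl rows) ! j = map (\<lambda>r. r ! j) (map tl rows)"
      by (rule Cons.IH) (use Cons.prems Suc in auto)
    then show ?thesis using Suc Cons.prems by (simp add: nth_tl)
  qed
qed simp

lemma length_columns: "length (columns vs rows) = length vs"
  by (induction vs rows rule: columns.induct) auto

lemma choose_opt_eqI: "(\<And>x. Q x \<longleftrightarrow> x \<in> set (opt_list o')) \<Longrightarrow> choose_opt Q = o'"
  by (cases o') (auto simp: choose_opt_def opt_list_def)

lemma roots_iff: "\<alpha> \<in> roots D \<longleftrightarrow> \<alpha> \<in> pos_roots D \<or> - \<alpha> \<in> pos_roots D"
proof -
  have "\<alpha> \<in> uminus ` pos_roots D \<longleftrightarrow> - \<alpha> \<in> pos_roots D"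
  proof
    assume "- \<alpha> \<in> pos_roots D"
    then have "- (- \<alpha>) \<in> uminus ` pos_roots D" by (rule imageI)
    then show "\<alpha> \<in> uminus ` pos_roots D" by (simp only: minus_minus)
  qed (metis imageE minus_minus)
  then show ?thesis unfolding roots_def by blast
qed

lemma arrow_from: "arrow D i b b' \<longleftrightarrow> b' \<in> set (arrows_from (pos_roots D) (theta D) i b)"
proof
  assume "arrow D i b b'"
  then show "b' \<in> set (arrows_from (pos_roots D) (theta D) i b)"
    by cases (simp_all add: arrows_from_def roots_iff[symmetric])
next
  assume b': "b' \<in> set (arrows_from (pos_roots D) (theta D) i b)"
  show "arrow D i b b'"
  proof (cases b)
    case (X \<alpha>)
    show ?thesis
      using b' arrow.intros(1)[of i \<alpha> D "\<alpha> - alpha_root i"] arrow.intros(2)[of i D]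
        arrow.intros(4)[of \<alpha> D "\<alpha> + theta D"] arrow.intros(5)[of D]
      unfolding X arrows_from_def roots_iff[symmetric] by (auto split: if_splits)
  next
    case (R j)
    then show ?thesis using b' arrow.intros(3)[of i D] by (auto simp: arrows_from_def split: if_splits)
  next
    case Emp
    then show ?thesis using b' arrow.intros(6)[of D] by (auto simp: arrows_from_def split: if_splits)
  qed
qed

lemma arrow_to: "arrow D i b' b \<longleftrightarrow> b' \<in> set (arrows_to (pos_roots D) (theta D) i b)"
proof
  assume "arrow D i b' b"
  then show "b' \<in> set (arrows_to (pos_roots D) (theta D) i b)"
  proof cases
    case (1 \<alpha> \<beta>)
    then have "\<beta> + alpha_root i = \<alpha>" by (metis diff_add_cancel)
    then show ?thesis using 1 by (simp add: arrows_to_def roots_iff[symmetric])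
  next
    case (4 \<alpha> \<beta>)
    then have "\<beta> - theta D = \<alpha>" by (metis add_diff_cancel_right')
    then show ?thesis using 4 by (simp add: arrows_to_def roots_iff[symmetric])
  qed (simp_all add: arrows_to_def roots_iff[symmetric])
next
  assume b': "b' \<in> set (arrows_to (pos_roots D) (theta D) i b)"
  show "arrow D i b' b"
  proof (cases b)
    case (X \<alpha>)
    have "arrow D i (X (\<alpha> + alpha_root i)) (X \<alpha>)"
      if "i \<noteq> I0" "\<alpha> \<in> roots D" "\<alpha> + alpha_root i \<in> roots D"
      by (rule arrow.intros(1)) (use that in simp_all)
    moreover have "arrow D I0 (X (\<alpha> - theta D)) (X \<alpha>)"
      if "\<alpha> \<in> roots D" "\<alpha> - theta D \<in> roots D" "\<alpha> \<notin> {theta D, - theta D}" "\<alpha> - theta D \<notin> {theta D, - theta D}"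
      by (rule arrow.intros(4)) (use that in simp_all)
    ultimately show ?thesis
      using b' arrow.intros(3)[of i D] arrow.intros(6)[of D]
      unfolding X arrows_to_def roots_iff[symmetric] by (auto split: if_splits)
  next
    case (R j)
    then show ?thesis using b' arrow.intros(2)[of i D] by (auto simp: arrows_to_def split: if_splits)
  next
    case Emp
    then show ?thesis using b' arrow.intros(5)[of D] by (auto simp: arrows_to_def split: if_splits)
  qed
qed

lemma sum_cl_root:
  "finite K \<Longrightarrow> (\<Sum>i\<in>K. smul (a i) (cl_root A i)) = ((\<lambda>j. \<Sum>i\<in>K. a i * A j i), 0)"
  by (induction K rule: finite_induct)
    (auto simp: smul_def cl_root_def zero_prod_def zero_fun_def fun_eq_iff)

lemma root_wt_snd: "snd (root_wt A \<alpha>) = 0"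
  by (cases \<alpha>) (simp add: smul_def cl_root_def)

text \<open>Extends the height of roots so that every classical raising operator adds 1, also along
  the strings through \<open>R i\<close>, where the heights are -1, 0, 1.\<close>

fun height :: "pelem \<Rightarrow> int" where
  "height (X (a1, a2, a3, a4)) = a1 + a2 + a3 + a4"
| "height _ = 0"

text \<open>\<open>height\<close> and \<open>highest\<close> make classical raising terminate, and
  only at \<emptyset> and at the vertex \<open>vt\<close> of the highest root; together with the
  data at these two vertices this gives uniqueness of the energy function.\<close>

locale crystal_model = column_model D ls vs t rank vx v0 ve lz
  for D :: "'l type_data" and ls vs and t :: "'v \<Rightarrow> ('l, 'v) table_row" and rank vx v0 ve lz +
  fixes vt :: 'v
  assumes arrows_ok: "list_all (arrows_ok (colour D) (pos_roots D) (theta D) t) vs"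
    and carrier: "carr (perfect_crystal D) = (\<lambda>v. name (t v)) ` {v. v \<noteq> vx}"
    and distinct_name: "distinct (map (\<lambda>v. name (t v)) vs)"
    and energy_ok: "energy_ok (colour D) t (filter (\<lambda>v. name (t v) \<noteq> R I0) vs)"
    and energy_ve: "energy_of t (filter (\<lambda>v. name (t v) \<noteq> R I0) vs) ve ve = 0"
    and height: "list_all (\<lambda>v. list_all (\<lambda>i. i = I0 \<or> (case vertex_e (colour D) t i v of None \<Rightarrow> True
        | Some w \<Rightarrow> height (name (t w)) = height (name (t v)) + 1)) inds) vs"
    and highest: "list_all (\<lambda>v. name (t v) \<in> {R I0, Emp, X (theta D)} \<or>
        list_ex (\<lambda>i. i \<noteq> I0 \<and> vertex_e (colour D) t i v \<noteq> None) inds) vs"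
    and vt: "name (t vt) = X (theta D)" "steps (vertex_f (colour D) t I0) vt = 0"
        "vertex_e (colour D) t I0 vt = Some ve"
    and steps_ve: "list_all (\<lambda>i. steps (vertex_e (colour D) t i) ve = (if i = I0 then 1 else 0) \<and>
        steps (vertex_f (colour D) t i) ve = (if i = I0 then 1 else 0)) inds"
begin

section \<open>The perfect crystal through the table\<close>

abbreviation "B \<equiv> perfect_crystal D"
abbreviation nm :: "'v \<Rightarrow> pelem" where "nm v \<equiv> name (t v)"

lemma nm_inj: "nm v = nm w \<longleftrightarrow> v = w"
  using distinct_name vs by (auto simp: distinct_map inj_on_def)

lemma nm_carr: "v \<noteq> vx \<Longrightarrow> nm v \<in> carr B"
  using carrier by blast

lemma B_ft: "v \<noteq> vx \<Longrightarrow> ft B i (nm v) = map_option nm (F i v)"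
  and B_et: "v \<noteq> vx \<Longrightarrow> et B i (nm v) = map_option nm (E i v)"
proof -
  assume v: "v \<noteq> vx"
  have "arrows_from (pos_roots D) (theta D) i (nm v) = opt_list (map_option nm (F i v)) \<and>
     arrows_to (pos_roots D) (theta D) i (nm v) = opt_list (map_option nm (E i v))"
    using all_inds[of "\<lambda>i. arrows_from (pos_roots D) (theta D) i (nm v) = opt_list (map_option nm (F i v)) \<and>
     arrows_to (pos_roots D) (theta D) i (nm v) = opt_list (map_option nm (E i v))"]
      all_vs[OF arrows_ok, of v] v unfolding arrows_ok_def name_vx by blast
  then have "choose_opt (arrow D i (nm v)) = map_option nm (F i v)"
    "choose_opt (\<lambda>b. arrow D i b (nm v)) = map_option nm (E i v)"
    by (intro choose_opt_eqI, simp add: arrow_from, intro choose_opt_eqI, simp add: arrow_to)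
  then show "ft B i (nm v) = map_option nm (F i v)" "et B i (nm v) = map_option nm (E i v)"
    by (simp_all add: perfect_crystal_def Let_def)
qed

lemma B_phi: "v \<noteq> vx \<Longrightarrow> phi B i (nm v) = steps (F i) v"
proof -
  assume v: "v \<noteq> vx"
  have "string_length (ft B i) (nm v) = string_length (F i) v"
    by (rule string_length_map[where S = "{v. v \<noteq> vx}"]) (use v F_not_vx B_ft in auto)
  then show ?thesis by (simp add: perfect_crystal_phi string_length_F)
qed

lemma B_eps: "v \<noteq> vx \<Longrightarrow> eps B i (nm v) = steps (E i) v"
proof -
  assume v: "v \<noteq> vx"
  have "string_length (et B i) (nm v) = string_length (E i) v"
    by (rule string_length_map[where S = "{v. v \<noteq> vx}"]) (use v E_not_vx B_et in auto)
  then show ?thesis by (simp add: perfect_crystal_eps string_length_E)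
qed

lemma B_wt: "wt B (nm v) = (W v, 0)"
proof -
  have "fst (wt B (nm v)) j = W v j" for j
    using W_name[where v = v and j = j]
    by (cases "nm v") (simp_all add: perfect_crystal_def Let_def)
  moreover have "snd (wt B (nm v)) = 0"
    by (cases "nm v") (simp_all add: perfect_crystal_def Let_def root_wt_snd)
  ultimately show ?thesis by (simp add: prod_eq_iff fun_eq_iff)
qed

lemma W_F: "F i v = Some w \<Longrightarrow> W w j = W v j - cartan D j i"
  using F_cover W_cover by metis

lemma W_eq: "W v i = steps (F i) v - steps (E i) v"
  by (simp add: weight_of_def)

lemma kashiwara_B: "kashiwara_crystal classical_weights (cl_root (cartan D)) B"
  unfolding kashiwara_crystal_def
proof (intro conjI allI ballI impI)
  fix b assume "b \<in> carr B"
  then show "wt B b \<in> classical_weights" using carrier B_wt by (auto simp: classical_weights_def)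
next
  fix i b assume "b \<in> carr B"
  then obtain v where "v \<noteq> vx" "b = nm v" using carrier by auto
  then show "phi B i b = eps B i b + pairing i (wt B b)"
    by (simp add: B_phi B_eps B_wt pairing_def W_eq)
next
  fix i b b' assume "b \<in> carr B" and b': "et B i b = Some b'"
  then obtain v where v: "v \<noteq> vx" "b = nm v" using carrier by auto
  then obtain w where w: "E i v = Some w" "b' = nm w" using b' B_et by auto
  note wx = E_not_vx[OF w(1)] and str = strings(2)[OF w(1)]
  show "b' \<in> carr B" using nm_carr wx w by simp
  show "eps B i b' = eps B i b - 1" using v w wx str by (simp add: B_eps)
  show "phi B i b' = phi B i b + 1" using v w wx str strings(1)[of i w v] by (simp add: B_phi)
  have "W v j = W w j - cartan D j i" for j using str W_F by blast
  then show "wt B b' = wt B b + cl_root (cartan D) i"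
    using v w by (simp add: B_wt cl_root_def fun_eq_iff)
next
  fix i b b' assume "b \<in> carr B" and b': "ft B i b = Some b'"
  then obtain v where v: "v \<noteq> vx" "b = nm v" using carrier by auto
  then obtain w where w: "F i v = Some w" "b' = nm w" using b' B_ft by auto
  note wx = F_not_vx[OF w(1)] and str = strings(1)[OF w(1)]
  show "b' \<in> carr B" using nm_carr wx w by simp
  show "eps B i b' = eps B i b + 1" using v w wx str strings(2)[of i w v] by (simp add: B_eps)
  show "phi B i b' = phi B i b - 1" using v w wx str by (simp add: B_phi)
  have "W w j = W v j - cartan D j i" for j using w(1) W_F by blast
  then show "wt B b' = wt B b - cl_root (cartan D) i"
    using v w by (simp add: B_wt cl_root_def fun_eq_iff)
next
  fix i b b' assume "b \<in> carr B" "b' \<in> carr B"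
  then obtain v w where v: "v \<noteq> vx" "b = nm v" "w \<noteq> vx" "b' = nm w" using carrier by auto
  have "F i v = Some w \<longleftrightarrow> E i w = Some v" using strings by blast
  then show "ft B i b = Some b' \<longleftrightarrow> et B i b' = Some b"
    using v by (simp add: B_ft B_et nm_inj)
qed

section \<open>The crystal of classes of columns\<close>

abbreviation "C \<equiv> column_crystal D"

lemma shift_class_col: "shift_class (col v n) = range (col v)"
proof -
  have "col v k = shift (k - n) (col v n)" for k by (simp add: shift_col)
  then show ?thesis unfolding shift_class_def shift_col by blast
qed

lemma range_col_inj: "range (col v) = range (col w) \<longleftrightarrow> v = w"
proof
  assume "range (col v) = range (col w)"
  then have "col v 0 \<in> range (col w)" by blast
  then show "v = w" by (auto simp: col_inj)
qed simp

lemma representative: obtains k where "(SOME y. y \<in> range (col v)) = col v k"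
proof -
  have "(SOME y. y \<in> range (col v)) \<in> range (col v)" by (rule someI) (rule rangeI)
  then show thesis using that by blast
qed

lemma C_carr: "carr C = (\<lambda>v. range (col v)) ` {v. v \<noteq> vx}"
proof -
  have "{y. young_column D y} = (\<lambda>(v, n). col v n) ` ({v. v \<noteq> vx} \<times> UNIV)"
    using young_iff by auto
  then show ?thesis by (auto simp: column_crystal_def Let_def shift_class_col image_iff)
qed

text \<open>The representative chosen by \<open>SOME\<close> is \<open>col v k\<close> for an
  unknown shift \<open>k\<close>, and none of these values depends on the shift.\<close>

lemma C_ops:
  assumes v: "v \<noteq> vx"
  shows "eps C i (range (col v)) = steps (E i) v" "phi C i (range (col v)) = steps (F i) v"
    "et C i (range (col v)) = map_option (\<lambda>w. range (col w)) (E i v)"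
    "ft C i (range (col v)) = map_option (\<lambda>w. range (col w)) (F i v)"
    "wt C (range (col v)) = (W v, 0)"
proof -
  obtain k where k: "(SOME y. y \<in> range (col v)) = col v k" using representative by blast
  show "eps C i (range (col v)) = steps (E i) v" "phi C i (range (col v)) = steps (F i) v"
    "et C i (range (col v)) = map_option (\<lambda>w. range (col w)) (E i v)"
    "ft C i (range (col v)) = map_option (\<lambda>w. range (col w)) (F i v)"
    "wt C (range (col v)) = (W v, 0)"
    using v by (simp_all add: column_crystal_def Let_def k col_eps_col col_phi_col col_e_col col_f_col
        option.map_comp comp_def shift_class_col W_eq[symmetric])
qed

text \<open>\<open>column_iso\<close> is an arbitrary choice, so exhibiting one isomorphism with the
  required value shows that the chosen one has both properties. The witness sends a class to the
  name of its vertex.\<close>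

lemma column_iso: "crystal_iso classical_weights (cl_root (cartan D)) C B (column_iso D) \<and>
    column_iso D (shift_class (col_empty D)) = Emp"
proof -
  let ?\<psi> = "\<lambda>c. nm (vertex (SOME y. y \<in> c))"
  have \<psi>: "vertex (SOME y. y \<in> range (col v)) = v" for v
    using representative[of v] vertex_col by metis
  have "col_empty D = col ve 1" by (simp add: col_empty col_def)
  then have "?\<psi> (shift_class (col_empty D)) = Emp" using \<psi>[of ve] ve by (simp add: shift_class_col)
  moreover have "crystal_iso classical_weights (cl_root (cartan D)) C B ?\<psi>"
  proof (rule crystal_iso_transfer[OF kashiwara_B])
    show "bij_betw ?\<psi> (carr C) (carr B)"
      unfolding bij_betw_def inj_on_def C_carr carrier by (auto simp: \<psi> nm_inj image_image)
  next
    fix c i assume "c \<in> carr C"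
    then obtain v where v: "v \<noteq> vx" "c = range (col v)" unfolding C_carr by blast
    show "wt B (?\<psi> c) = wt C c" "eps B i (?\<psi> c) = eps C i c" "phi B i (?\<psi> c) = phi C i c"
      using v by (simp_all add: \<psi> B_wt B_eps B_phi C_ops)
    show "et B i (?\<psi> c) = map_option ?\<psi> (et C i c)" "ft B i (?\<psi> c) = map_option ?\<psi> (ft C i c)"
      using v by (simp_all add: \<psi> B_et B_ft C_ops option.map_comp comp_def)
    show "c' \<in> carr C" if "et C i c = Some c'" for c'
      using that v E_not_vx by (auto simp: C_ops C_carr)
    show "c' \<in> carr C" if "ft C i c = Some c'" for c'
      using that v F_not_vx by (auto simp: C_ops C_carr)
  qed
  ultimately have "\<exists>\<psi>. crystal_iso classical_weights (cl_root (cartan D)) C B \<psi> \<and>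
      \<psi> (shift_class (col_empty D)) = Emp" by blast
  then show ?thesis unfolding column_iso_def by (rule someI_ex)
qed

subsection \<open>The energy function\<close>

definition reals where "reals = filter (\<lambda>v. nm v \<noteq> R I0) vs"

abbreviation "H \<equiv> energy_of t reals"

lemma reals: "set reals = {v. v \<noteq> vx}" "distinct reals"
  using vs distinct_name by (auto simp: reals_def name_vx distinct_map)

lemma length_energies: "v \<noteq> vx \<Longrightarrow> length (energies (t v)) = length reals"
  using energy_ok reals unfolding energy_ok_def reals_def[symmetric] by (simp add: list_all_iff)

lemma H_nth: "v \<noteq> vx \<Longrightarrow> k < length reals \<Longrightarrow> H v (reals ! k) = energies (t v) ! k"
  using length_energies[of v] reals(2) by (simp add: energy_of_def map_of_zip_nth)

lemma reals_nth:
  assumes "v \<noteq> vx"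
  obtains k where "k < length reals" "reals ! k = v"
proof -
  have "v \<in> set reals" using assms by (simp add: reals(1))
  then show thesis using that unfolding in_set_conv_nth by blast
qed

lemma list_all_zip3:
  assumes "list_all Q (zip as (zip bs cs))" "k < length as" "k < length bs" "k < length cs"
  shows "Q (as ! k, bs ! k, cs ! k)"
  using assms by (simp add: list_all_length)

lemma H_left:
  assumes v: "v \<noteq> vx" and w: "w \<noteq> vx" and less: "steps (E i) w < steps (F i) v" and F: "F i v = Some v'"
  shows "H v' w = H v w - delta0 i"
proof -
  have "list_all (energy_left (colour D) t i (map (steps (E i)) reals)) reals"
    using energy_ok unfolding energy_ok_def reals_def[symmetric] using all_inds by blast
  then have "energy_left (colour D) t i (map (steps (E i)) reals) v" using v reals by (simp add: list_all_iff)
  then have *: "list_all (\<lambda>(n, h, h'). n < steps (F i) v \<longrightarrow> h' = h - delta0 i)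
      (zip (map (steps (E i)) reals) (zip (energies (t v)) (energies (t v'))))"
    using F by (simp add: energy_left_def)
  obtain k where k: "k < length reals" "reals ! k = w" using reals_nth[OF w] .
  note v' = F_not_vx[OF F]
  show ?thesis
    using list_all_zip3[OF *, of k] less k H_nth[OF v k(1)] H_nth[OF v' k(1)] length_energies[OF v] length_energies[OF v']
    by simp
qed

lemma H_right:
  assumes v: "v \<noteq> vx" and w: "w \<noteq> vx" and le: "steps (F i) v \<le> steps (E i) w" and F: "F i w = Some w'"
  shows "H v w' = H v w + delta0 i"
proof -
  let ?rows = "map (\<lambda>v. energies (t v)) reals"
  let ?cs = "zip reals (columns reals ?rows)"
  have "list_all (energy_right (colour D) t i (map (steps (F i)) reals) ?cs) reals"
    using energy_ok unfolding energy_ok_def reals_def[symmetric] using all_inds by blast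
  then have "energy_right (colour D) t i (map (steps (F i)) reals) ?cs w" using w reals by (simp add: list_all_iff)
  then have *: "list_all (\<lambda>(n, h, h'). n \<le> steps (E i) w \<longrightarrow> h' = h + delta0 i)
      (zip (map (steps (F i)) reals) (zip (the (map_of ?cs w)) (the (map_of ?cs w'))))"
    using F by (simp add: energy_right_def)
  have col: "the (map_of ?cs (reals ! k)) = map (\<lambda>v. energies (t v) ! k) reals" if "k < length reals" for k
  proof -
    have "columns reals ?rows ! k = map (\<lambda>r. r ! k) ?rows"
      by (rule columns_nth) (use that length_energies reals in auto)
    then show ?thesis using that reals(2) by (simp add: map_of_zip_nth length_columns comp_def)
  qed
  obtain k where k: "k < length reals" "reals ! k = w" using reals_nth[OF w] .
  obtain k' where k': "k' < length reals" "reals ! k' = w'" using reals_nth[OF F_not_vx[OF F]] .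
  obtain j where j: "j < length reals" "reals ! j = v" using reals_nth[OF v] .
  show ?thesis
    using list_all_zip3[OF *, of j] le j k k' col[OF k(1)] col[OF k'(1)] H_nth[OF v k(1)] H_nth[OF v k'(1)]
    by simp
qed

lemma tensor_ft:
  assumes "v \<noteq> vx" "w \<noteq> vx"
  shows "ft (tensor B B) i (nm v, nm w) = (if steps (E i) w < steps (F i) v then
    map_option (\<lambda>v'. (nm v', nm w)) (F i v) else map_option (\<lambda>w'. (nm v, nm w')) (F i w))"
  using assms by (simp add: tensor_def B_ft B_phi B_eps option.map_comp comp_def)

text \<open>The definition in terms of vertices, split by the factor on which the operator acts;
  both the table and the uniqueness argument come in this form.\<close>

lemma is_energy_iff: "is_energy D G \<longleftrightarrow> G \<in> extensional (carr B \<times> carr B) \<and> G (Emp, Emp) = 0 \<and>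
    (\<forall>i v w v'. v \<noteq> vx \<longrightarrow> w \<noteq> vx \<longrightarrow> steps (E i) w < steps (F i) v \<longrightarrow> F i v = Some v' \<longrightarrow>
      G (nm v', nm w) = G (nm v, nm w) - delta0 i) \<and>
    (\<forall>i v w w'. v \<noteq> vx \<longrightarrow> w \<noteq> vx \<longrightarrow> steps (F i) v \<le> steps (E i) w \<longrightarrow> F i w = Some w' \<longrightarrow>
      G (nm v, nm w') = G (nm v, nm w) + delta0 i)" (is "_ \<longleftrightarrow> _ \<and> _ \<and> ?L \<and> ?R")
proof -
  have "(\<forall>i. \<forall>a\<in>carr B. \<forall>b\<in>carr B. \<forall>c. ft (tensor B B) i (a, b) = Some c \<longrightarrow>
      G c - G (a, b) = (if i \<noteq> I0 then 0 else if phi B I0 a > eps B I0 b then -1 else 1)) \<longleftrightarrow>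
    (\<forall>i v w c. v \<noteq> vx \<longrightarrow> w \<noteq> vx \<longrightarrow> ft (tensor B B) i (nm v, nm w) = Some c \<longrightarrow>
      G c - G (nm v, nm w) = (if i \<noteq> I0 then 0 else if steps (F I0) v > steps (E I0) w then -1 else 1))"
    unfolding carrier using B_phi B_eps by auto
  also have "\<dots> \<longleftrightarrow> ?L \<and> ?R"
  proof (intro iffI conjI allI impI)
    fix i v w v'
    assume "\<forall>i v w c. v \<noteq> vx \<longrightarrow> w \<noteq> vx \<longrightarrow> ft (tensor B B) i (nm v, nm w) = Some c \<longrightarrow>
      G c - G (nm v, nm w) = (if i \<noteq> I0 then 0 else if steps (F I0) v > steps (E I0) w then -1 else 1)"
      and *: "v \<noteq> vx" "w \<noteq> vx" "steps (E i) w < steps (F i) v" "F i v = Some v'"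
    moreover have "ft (tensor B B) i (nm v, nm w) = Some (nm v', nm w)" using * by (simp add: tensor_ft)
    ultimately have "G (nm v', nm w) - G (nm v, nm w) =
        (if i \<noteq> I0 then 0 else if steps (F I0) v > steps (E I0) w then -1 else 1)" by blast
    then show "G (nm v', nm w) = G (nm v, nm w) - delta0 i" using * by (auto split: if_splits)
  next
    fix i v w w'
    assume "\<forall>i v w c. v \<noteq> vx \<longrightarrow> w \<noteq> vx \<longrightarrow> ft (tensor B B) i (nm v, nm w) = Some c \<longrightarrow>
      G c - G (nm v, nm w) = (if i \<noteq> I0 then 0 else if steps (F I0) v > steps (E I0) w then -1 else 1)"
      and *: "v \<noteq> vx" "w \<noteq> vx" "steps (F i) v \<le> steps (E i) w" "F i w = Some w'"
    moreover have "ft (tensor B B) i (nm v, nm w) = Some (nm v, nm w')" using * by (simp add: tensor_ft)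
    ultimately have "G (nm v, nm w') - G (nm v, nm w) =
        (if i \<noteq> I0 then 0 else if steps (F I0) v > steps (E I0) w then -1 else 1)" by blast
    then show "G (nm v, nm w') = G (nm v, nm w) + delta0 i" using * by (auto split: if_splits)
  next
    fix i v w c
    assume LR: "?L \<and> ?R" and vw: "v \<noteq> vx" "w \<noteq> vx" and c: "ft (tensor B B) i (nm v, nm w) = Some c"
    show "G c - G (nm v, nm w) = (if i \<noteq> I0 then 0 else if steps (F I0) v > steps (E I0) w then -1 else 1)"
    proof (cases "steps (E i) w < steps (F i) v")
      case True
      then obtain v' where v': "F i v = Some v'" "c = (nm v', nm w)" using c vw by (auto simp: tensor_ft)
      have "G (nm v', nm w) = G (nm v, nm w) - delta0 i" using LR vw True v'(1) by blast
      then show ?thesis using v'(2) True by auto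
    next
      case False
      then obtain w' where w': "F i w = Some w'" "c = (nm v, nm w')" using c vw by (auto simp: tensor_ft)
      have "steps (F i) v \<le> steps (E i) w" using False by simp
      then have "G (nm v, nm w') = G (nm v, nm w) + delta0 i" using LR vw w'(1) by blast
      then show ?thesis using w'(2) False by auto
    qed
  qed
  finally show ?thesis unfolding is_energy_def Let_def by blast
qed

lemma energy_exists: "\<exists>G. is_energy D G"
proof -
  define G where "G = (\<lambda>(a, b). if a \<in> carr B \<and> b \<in> carr B then H (THE v. nm v = a) (THE v. nm v = b) else undefined)"
  have inv: "(THE v. nm v = nm w) = w" for w by (rule the_equality) (auto simp: nm_inj)
  have G: "G (nm v, nm w) = H v w" if "v \<noteq> vx" "w \<noteq> vx" for v w
    using that nm_carr by (simp add: G_def inv)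
  have "ve \<noteq> vx" using name_vx[of ve] ve by simp
  then have "G (Emp, Emp) = 0" using G[of ve ve] energy_ve ve by (simp add: reals_def)
  moreover have "G \<in> extensional (carr B \<times> carr B)" by (auto simp: extensional_def G_def)
  ultimately show ?thesis
    unfolding is_energy_iff using G H_left H_right F_not_vx by (intro exI[of _ G]) auto
qed

lemma steps_ve': "steps (E i) ve = delta0 i" "steps (F i) ve = delta0 i"
  using all_inds[OF steps_ve, of i] by blast+

lemma steps_pos: "h v = Some w \<Longrightarrow> 0 < steps h v"
  by (simp add: steps_def split: option.split)

lemma height_E: "i \<noteq> I0 \<Longrightarrow> E i v = Some w \<Longrightarrow> height (nm w) = height (nm v) + 1"
  using all_inds[OF all_vs[OF height, of v], of i] by simp

lemma highest': "v \<noteq> vx \<Longrightarrow> v \<noteq> ve \<Longrightarrow> v \<noteq> vt \<Longrightarrow> \<exists>i w. i \<noteq> I0 \<and> E i v = Some w"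
  using all_vs[OF highest, of v] name_vx[of v] ve vt(1) nm_inj[of v ve] nm_inj[of v vt]
  by (auto simp: list_ex_iff)

text \<open>The distance below the greatest height, a natural number that classical raising
  decreases.\<close>

definition depth :: "'v \<Rightarrow> nat" where
  "depth v = nat (Max ((\<lambda>v. height (nm v)) ` set vs) - height (nm v))"

lemma depth_E:
  assumes "i \<noteq> I0" "E i v = Some w"
  shows "depth w < depth v"
proof -
  have "height (nm w) \<le> Max ((\<lambda>v. height (nm v)) ` set vs)"
    by (rule Max_ge) (simp, simp only: vs, blast)
  then show ?thesis using height_E[OF assms] by (simp add: depth_def)
qed

text \<open>The tensor square is connected: classical raising operators lead from \<open>v \<otimes> w\<close> to some
  \<open>v' \<otimes> w'\<close> with \<open>v'\<close> equal to \<open>\<emptyset>\<close> or \<open>x\<^sub>\<theta>\<close>, in the second case \<open>e\<^sub>0\<close> leads on to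
  \<open>\<emptyset> \<otimes> w''\<close>, and then classical raising operators acting on \<open>w''\<close> finish.\<close>

lemma energy_unique:
  assumes "is_energy D G" "is_energy D G'"
  shows "G = G'"
proof -
  have vx: "ve \<noteq> vx" "vt \<noteq> vx" using name_vx[of ve] name_vx[of vt] ve vt(1) by auto
  \<comment> \<open>Both functions change by the same amount along every arrow, so their difference
    is constant on connected components.\<close>
  define \<Delta> where "\<Delta> v w = G (nm v, nm w) - G' (nm v, nm w)" for v w
  have left: "\<Delta> v' w = \<Delta> v w"
    if "v \<noteq> vx" "w \<noteq> vx" "steps (E i) w < steps (F i) v" "F i v = Some v'" for i v v' w
  proof -
    have "G (nm v', nm w) = G (nm v, nm w) - delta0 i" "G' (nm v', nm w) = G' (nm v, nm w) - delta0 i"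
      using assms that unfolding is_energy_iff by blast+
    then show ?thesis by (simp add: \<Delta>_def)
  qed
  have right: "\<Delta> v w' = \<Delta> v w"
    if "v \<noteq> vx" "w \<noteq> vx" "steps (F i) v \<le> steps (E i) w" "F i w = Some w'" for i v w w'
  proof -
    have "G (nm v, nm w') = G (nm v, nm w) + delta0 i" "G' (nm v, nm w') = G' (nm v, nm w) + delta0 i"
      using assms that unfolding is_energy_iff by blast+
    then show ?thesis by (simp add: \<Delta>_def)
  qed
  have e_left: "\<Delta> v' w = \<Delta> v w"
    if "w \<noteq> vx" "steps (E i) w \<le> steps (F i) v" "E i v = Some v'" for i v v' w
    using left[of v' w i v] strings(2)[OF that(3)] strings(1)[of i v' v] E_not_vx[OF that(3)] that by simp
  have e_right: "\<Delta> v w' = \<Delta> v w"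
    if "v \<noteq> vx" "steps (F i) v < steps (E i) w" "E i w = Some w'" for i v w w'
    using right[of v w' i w] strings(2)[OF that(3)] E_not_vx[OF that(3)] that by simp
  have ee: "\<Delta> ve ve = 0" using assms unfolding is_energy_iff \<Delta>_def by (simp add: ve)
  have "F I0 ve = Some vt" using strings(2)[OF vt(3)] by blast
  \<comment> \<open>For two factors \<emptyset> phi_0 = eps_0 = 1, and in a tie f_0 acts on the
    right factor.\<close>
  then have et: "\<Delta> ve vt = 0" using right[of ve ve I0 vt] vx steps_ve' ee by simp
  have e: "\<Delta> ve w = 0" if "w \<noteq> vx" for w
    using that
  proof (induction "depth w" arbitrary: w rule: less_induct)
    case less
    show ?case
    proof (cases "w = ve \<or> w = vt")
      case False
      then obtain i w' where i: "i \<noteq> I0" "E i w = Some w'" using highest' less.prems by blast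
      \<comment> \<open>For classical i phi of \<emptyset> is 0, so raising acts on \<open>w\<close>
        as soon as \<open>w\<close> can be raised.\<close>
      have "steps (F i) ve < steps (E i) w" using steps_ve'(2)[of i] steps_pos[of "E i", OF i(2)] i(1) by simp
      then have "\<Delta> ve w = \<Delta> ve w'" using e_right[of ve i w w'] vx i by simp
      then show ?thesis using less.hyps[OF depth_E[OF i] E_not_vx[OF i(2)]] by simp
    qed (use ee et in auto)
  qed
  have t: "\<Delta> vt w = 0" if "w \<noteq> vx" for w
    using that
  proof (induction "nat (steps (E I0) w)" arbitrary: w rule: less_induct)
    case less
    show ?case
    proof (cases "E I0 w")
      case None
      then have "steps (E I0) w = 0" by (simp add: steps_def)
      then show ?thesis using e_left[of w I0 vt ve] less.prems vt e by simp
    next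
      case (Some w')
      then have "steps (F I0) vt < steps (E I0) w" using steps_pos[of "E I0", OF Some] vt by simp
      then have "\<Delta> vt w = \<Delta> vt w'" using e_right[of vt I0 w w'] vx Some by simp
      moreover have "nat (steps (E I0) w') < nat (steps (E I0) w)"
        using strings(2)[OF Some] steps_nonneg[of "E I0" w'] by simp
      ultimately show ?thesis using less.hyps[of w'] E_not_vx[OF Some] by simp
    qed
  qed
  have all: "\<Delta> v w = 0" if "v \<noteq> vx" "w \<noteq> vx" for v w
    using that
  proof (induction "depth v + depth w" arbitrary: v w rule: less_induct)
    case less
    show ?case
    proof (cases "v = ve \<or> v = vt")
      case False
      then obtain i v' where i: "i \<noteq> I0" "E i v = Some v'" using highest' less.prems by blast
      \<comment> \<open>Whichever factor the rule selects is raised, and the sum of the depths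
        falls. If it selects \<open>w\<close>, then eps of \<open>w\<close> exceeds phi of
        \<open>v\<close>, hence is positive, and \<open>w\<close> can indeed be raised.\<close>
      show ?thesis
      proof (cases "steps (E i) w \<le> steps (F i) v")
        case True
        then have "\<Delta> v w = \<Delta> v' w" using e_left[of w i v v'] less.prems i by simp
        then show ?thesis using less.hyps[of v' w] depth_E[OF i] E_not_vx[OF i(2)] less.prems by simp
      next
        case False
        then have "steps (E i) w \<noteq> 0" using steps_nonneg[of "F i" v] by simp
        then have "E i w \<noteq> None" by (cases "E i w") (simp_all add: steps_def)
        then obtain w' where w': "E i w = Some w'" by blast
        then have "\<Delta> v w = \<Delta> v w'" using e_right[of v i w w'] less.prems False by simp
        then show ?thesis using less.hyps[of v w'] depth_E[OF i(1) w'] E_not_vx[OF w'] less.prems by simp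
      qed
    qed (use e t less.prems in auto)
  qed
  show ?thesis
  proof (rule extensionalityI)
    show "G \<in> extensional (carr B \<times> carr B)" "G' \<in> extensional (carr B \<times> carr B)"
      using assms unfolding is_energy_iff by blast+
    fix x assume "x \<in> carr B \<times> carr B"
    then obtain v w where "v \<noteq> vx" "w \<noteq> vx" "x = (nm v, nm w)" unfolding carrier by auto
    then show "G x = G' x" using all[of v w] by (simp add: \<Delta>_def)
  qed
qed

lemma energy: "is_energy D (energy D)"
  unfolding energy_def using energy_exists energy_unique by (metis (no_types, lifting) theI)

theorem wall_iso_exists:
  assumes g: "g \<in> shift_class (col_empty D)"
  shows "\<exists>\<Psi>. affine_crystal_iso D (wall_crystal D g (Lam I0)) (fock_crystal D (Lam I0)) \<Psi> \<and>
    \<Psi> (ground_wall g) = ground_sequence"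
proof -
  have vx: "ve \<noteq> vx" using name_vx[of ve] ve by simp
  have empty: "col_empty D = col ve 1" by (simp add: col_empty col_def)
  \<comment> \<open>Choosing another ground-state column in the class only moves the origin of the
    count of 0-blocks.\<close>
  obtain n0 where n0: "g = col ve n0" using g unfolding empty shift_class_col by blast
  have class_carr: "v \<noteq> vx \<Longrightarrow> range (col v) \<in> carr C" for v unfolding C_carr by blast
  have lam: "pairing i (Lam I0) = delta0 i" for i by (simp add: pairing_def Lam_def)
  have \<psi>_wt: "wt B (column_iso D (range (col v))) = (W v, 0)" if "v \<noteq> vx" for v
    using column_iso class_carr[OF that] C_ops(5)[OF that] unfolding crystal_iso_def by simp
  interpret wall_model D "Lam I0" "column_iso D" g
  proof
    show "kashiwara_crystal classical_weights (cl_root (cartan D)) B" by (rule kashiwara_B)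
    show "eps B i Emp = pairing i (Lam I0)" "phi B i Emp = pairing i (Lam I0)" for i
      using B_eps[OF vx] B_phi[OF vx] steps_ve' by (simp_all add: ve lam)
    show "is_energy D (energy D)" by (rule energy)
    show "crystal_iso classical_weights (cl_root (cartan D)) C B (column_iso D)" using column_iso by blast
    show "column_iso D (shift_class g) = Emp" using column_iso by (simp add: n0 empty shift_class_col)
    show "col_energy D y y' = energy D (column_iso D (shift_class y), column_iso D (shift_class y'))" for y y'
      by (rule col_energy_def)
    show "young_column D g" using n0 vx young_col by simp
  next
    fix y assume "young_column D y"
    then obtain v n where y: "v \<noteq> vx" "y = col v n" using young_iff by blast
    show "et C i (shift_class y) = map_option shift_class (col_e D i y)"
      "ft C i (shift_class y) = map_option shift_class (col_f D i y)"
      "eps C i (shift_class y) = col_eps D i y" "phi C i (shift_class y) = col_phi D i y" for i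
      using y by (simp_all add: shift_class_col C_ops col_e_col col_f_col col_eps_col col_phi_col
          option.map_comp comp_def)
    show "young_column D y' \<and> zero_count D g y' = zero_count D g y - delta0 i" if "col_e D i y = Some y'" for i y'
      using that y E_not_vx[of i v] by (auto simp: col_e_col young_col n0 zero_count_col)
    show "young_column D y' \<and> zero_count D g y' = zero_count D g y + delta0 i" if "col_f D i y = Some y'" for i y'
      using that y F_not_vx[of i v] by (auto simp: col_f_col young_col n0 zero_count_col)
    show "\<exists>y'. young_column D y' \<and> shift_class y' = shift_class y \<and> zero_count D g y' = n" for n
      by (rule exI[of _ "col v (n + n0)"]) (simp add: y young_col shift_class_col n0 zero_count_col)
    show "(\<Sum>i\<in>UNIV. smul (colour_count D g i y) (cl_root (cartan D) i)) =
        - wt B (column_iso D (shift_class y))"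
      using y by (simp add: sum_cl_root \<psi>_wt shift_class_col n0 counts(2) fun_eq_iff)
    show "finite (y - g) \<and> finite (g - y)"
      using finite_pre_young_diff pre_young_col unfolding y(2) n0 by blast
  next
    fix y y' assume "young_column D y" "young_column D y'"
    then obtain v n w k where y: "y = col v n" "y' = col w k"
      unfolding young_iff[of y] young_iff[of y'] by blast
    assume *: "shift_class y = shift_class y'" "zero_count D g y = zero_count D g y'"
    have "v = w" using *(1) unfolding y shift_class_col range_col_inj .
    moreover have "n = k" using *(2) unfolding y n0 zero_count_col by simp
    ultimately show "y = y'" by (simp add: y)
  qed
  show ?thesis using wall_iso by blast
qed

end

section \<open>Type twisted affine E6\<close>

datatype vertex_E =
  Ep1000 | Ep0100 | Ep1100 | Ep0110 | Ep1110 | Ep0111 | Ep1111 | Ep1210 | Ep1211 | Ep1221 | Ep1321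
   | Ep2321 | Em1000 | Em0100 | Em1100 | Em0110 | Em1110 | Em0111 | Em1111 | Em1210 | Em1211 |
   Em1221 | Em1321 | Em2321 | E_r1 | E_r2 | E_emp | E_exc

definition verts_E :: "vertex_E list" where
  "verts_E =
  [Ep1000, Ep0100, Ep1100, Ep0110, Ep1110, Ep0111, Ep1111, Ep1210, Ep1211, Ep1221, Ep1321, Ep2321,
   Em1000, Em0100, Em1100, Em0110, Em1110, Em0111, Em1111, Em1210, Em1211, Em1221, Em1321, Em2321,
   E_r1, E_r2, E_emp, E_exc]"

text \<open>Adding an i-block subtracts the classical \<alpha>_i, so a class of nonzero weight is
  named by its weight. The classes of weight 0 are \<emptyset>, r_1, r_2 and the exceptional one.
  The energies follow the order of \<open>verts_E\<close> without its last entry, the exceptional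
  class: 24 roots, two r_j and \<emptyset>.\<close>

primrec tab_E :: "vertex_E \<Rightarrow> (letter_E, vertex_E) table_row" where
  "tab_E Ep1000 = Row (X (1,0,0,0))
   [(Eb,0), (Ec,0)]
   [((Ea,0),E_exc),((Ea',0),E_r1)]
   [((Eb,0),Ep1100),((Ez,0),Em1321)]
   [2, 1, 2, 1, 2, 1, 2, 2, 2, 2, 2, 2, 1, 1, 1, 1, 1, 1, 1, 1, 1, 1, 1, 0, 1, 1, 1]"
| "tab_E Ep0100 = Row (X (0,1,0,0))
   [(Ea,0), (Ec,0)]
   [((Eb,0),E_exc),((Eb',0),E_r2)]
   [((Ea,0),Ep1100),((Ec,0),Ep0110)]
   [1, 2, 2, 2, 2, 2, 2, 2, 2, 2, 2, 2, 1, 1, 1, 1, 1, 1, 1, 1, 1, 1, 0, 0, 1, 1, 1]"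
| "tab_E Ep1100 = Row (X (1,1,0,0))
   [(Ec,0)]
   [((Ea,0),Ep0100),((Eb,0),Ep1000)]
   [((Ec,0),Ep1110),((Ez,0),Em1221)]
   [1, 1, 2, 1, 2, 1, 2, 2, 2, 2, 2, 2, 1, 1, 1, 1, 1, 1, 1, 1, 1, 1, 0, 0, 1, 1, 1]"
| "tab_E Ep0110 = Row (X (0,1,1,0))
   [(Ea,0)]
   [((Ec,0),Ep0100)]
   [((Ed,-1),Ep0111),((Ea,0),Ep1110)]
   [1, 1, 1, 2, 2, 2, 2, 2, 2, 2, 2, 2, 1, 1, 1, 1, 1, 1, 1, 1, 1, 0, 0, 0, 1, 1, 1]"
| "tab_E Ep1110 = Row (X (1,1,1,0))
   []
   [((Ea,0),Ep0110),((Ec,0),Ep1100)]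
   [((Ed,-1),Ep1111),((Eb'',-1),Ep1210),((Ez,0),Em1211)]
   [1, 1, 1, 1, 2, 1, 2, 2, 2, 2, 2, 2, 1, 1, 1, 1, 1, 1, 1, 1, 1, 0, 0, 0, 1, 1, 1]"
| "tab_E Ep0111 = Row (X (0,1,1,1))
   [(Ed,-1), (Ea,0)]
   [((Ed,-1),Ep0110)]
   [((Ea,0),Ep1111)]
   [1, 1, 1, 1, 1, 2, 2, 1, 2, 2, 2, 2, 1, 1, 1, 1, 1, 0, 0, 1, 0, 0, 0, 0, 1, 1, 1]"
| "tab_E Ep1111 = Row (X (1,1,1,1))
   [(Ed,-1)]
   [((Ed,-1),Ep1110),((Ea,0),Ep0111)]
   [((Eb'',-1),Ep1211),((Ez,0),Em1210)]
   [1, 1, 1, 1, 1, 1, 2, 1, 2, 2, 2, 2, 1, 1, 1, 1, 1, 0, 0, 1, 0, 0, 0, 0, 1, 1, 1]"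
| "tab_E Ep1210 = Row (X (1,2,1,0))
   [(Eb'',-1)]
   [((Eb'',-1),Ep1110)]
   [((Ed,-1),Ep1211),((Ez,0),Em1111)]
   [1, 1, 1, 1, 1, 1, 1, 2, 2, 2, 2, 2, 1, 1, 1, 1, 1, 1, 1, 0, 0, 0, 0, 0, 1, 1, 1]"
| "tab_E Ep1211 = Row (X (1,2,1,1))
   [(Eb'',-1), (Ed,-1)]
   [((Eb'',-1),Ep1111),((Ed,-1),Ep1210)]
   [((Ec',-1),Ep1221),((Ez,0),Em1110)]
   [1, 1, 1, 1, 1, 1, 1, 1, 2, 2, 2, 2, 1, 1, 1, 1, 1, 0, 0, 0, 0, 0, 0, 0, 1, 1, 1]"
| "tab_E Ep1221 = Row (X (1,2,2,1))
   [(Eb'',-1), (Ec',-1), (Ed,-1)]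
   [((Ec',-1),Ep1211)]
   [((Eb',-1),Ep1321),((Ez,0),Em1100)]
   [1, 1, 1, 1, 1, 1, 1, 1, 1, 2, 2, 2, 1, 1, 1, 0, 0, 0, 0, 0, 0, 0, 0, 0, 1, 1, 1]"
| "tab_E Ep1321 = Row (X (1,3,2,1))
   [(Eb',-1), (Eb'',-1), (Ec',-1), (Ed,-1)]
   [((Eb',-1),Ep1221)]
   [((Ea,-1),Ep2321),((Ez,0),Em1000)]
   [1, 1, 1, 1, 1, 1, 1, 1, 1, 1, 2, 2, 1, 0, 0, 0, 0, 0, 0, 0, 0, 0, 0, 0, 1, 0, 1]"
| "tab_E Ep2321 = Row (X (2,3,2,1))
   [(Ea,-1), (Eb',-1), (Eb'',-1), (Ec',-1), (Ed,-1)]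
   [((Ea,-1),Ep1321)]
   [((Ez,-1),E_emp),((Ez,0),E_r1)]
   [1, 0, 1, 0, 1, 0, 1, 1, 1, 1, 1, 2, 0, 0, 0, 0, 0, 0, 0, 0, 0, 0, 0, 0, 0, 0, 1]"
| "tab_E Em1000 = Row (X (-1,0,0,0))
   [(Ea,0), (Ea',0), (Eb,0), (Ec,0)]
   [((Eb',0),Em1100),((Ez,0),Ep1321)]
   [((Ea,0),E_r1),((Ea',0),E_exc)]
   [2, 2, 2, 2, 2, 2, 2, 2, 2, 2, 2, 2, 2, 1, 1, 1, 1, 1, 1, 1, 1, 1, 1, 1, 2, 1, 1]"
| "tab_E Em0100 = Row (X (0,-1,0,0))
   [(Ea,0), (Eb,0), (Eb',0), (Ec,0)]
   [((Ea',0),Em1100),((Ec',0),Em0110)]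
   [((Eb,0),E_r2),((Eb',0),E_exc)]
   [2, 2, 2, 2, 2, 2, 2, 2, 2, 2, 2, 2, 1, 2, 1, 1, 1, 1, 1, 1, 1, 1, 1, 0, 1, 2, 1]"
| "tab_E Em1100 = Row (X (-1,-1,0,0))
   [(Ea,0), (Ea',0), (Eb,0), (Eb',0), (Ec,0)]
   [((Ec',0),Em1110),((Ez,0),Ep1221)]
   [((Eb',0),Em1000),((Ea',0),Em0100)]
   [2, 2, 2, 2, 2, 2, 2, 2, 2, 2, 2, 2, 2, 2, 2, 1, 1, 1, 1, 1, 1, 1, 1, 1, 2, 2, 1]"
| "tab_E Em0110 = Row (X (0,-1,-1,0))
   [(Ea,0), (Eb,0), (Eb',0), (Ec,0), (Ec',0)]
   [((Ea',0),Em1110),((Ed,0),Em0111)]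
   [((Ec',0),Em0100)]
   [2, 2, 2, 2, 2, 2, 2, 2, 2, 2, 2, 2, 1, 2, 1, 2, 1, 1, 1, 1, 1, 1, 1, 0, 1, 2, 1]"
| "tab_E Em1110 = Row (X (-1,-1,-1,0))
   [(Ea,0), (Ea',0), (Eb,0), (Eb',0), (Ec,0), (Ec',0)]
   [((Eb'',0),Em1210),((Ed,0),Em1111),((Ez,0),Ep1211)]
   [((Ec',0),Em1100),((Ea',0),Em0110)]
   [2, 2, 2, 2, 2, 2, 2, 2, 2, 2, 2, 2, 2, 2, 2, 2, 2, 1, 1, 1, 1, 1, 1, 1, 2, 2, 1]"
| "tab_E Em0111 = Row (X (0,-1,-1,-1))
   [(Ea,0), (Eb,0), (Eb',0), (Ec,0), (Ec',0), (Ed,0)]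
   [((Ea',0),Em1111)]
   [((Ed,0),Em0110)]
   [2, 2, 2, 2, 2, 2, 2, 2, 2, 2, 2, 2, 1, 2, 1, 2, 1, 2, 1, 1, 1, 1, 1, 0, 1, 2, 1]"
| "tab_E Em1111 = Row (X (-1,-1,-1,-1))
   [(Ea,0), (Ea',0), (Eb,0), (Eb',0), (Ec,0), (Ec',0), (Ed,0)]
   [((Eb'',0),Em1211),((Ez,0),Ep1210)]
   [((Ea',0),Em0111),((Ed,0),Em1110)]
   [2, 2, 2, 2, 2, 2, 2, 2, 2, 2, 2, 2, 2, 2, 2, 2, 2, 2, 2, 1, 1, 1, 1, 1, 2, 2, 1]"
| "tab_E Em1210 = Row (X (-1,-2,-1,0))
   [(Ea,0), (Ea',0), (Eb,0), (Eb',0), (Eb'',0), (Ec,0), (Ec',0)]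
   [((Ed,0),Em1211),((Ez,0),Ep1111)]
   [((Eb'',0),Em1110)]
   [2, 2, 2, 2, 2, 2, 2, 2, 2, 2, 2, 2, 2, 2, 2, 2, 2, 1, 1, 2, 1, 1, 1, 1, 2, 2, 1]"
| "tab_E Em1211 = Row (X (-1,-2,-1,-1))
   [(Ea,0), (Ea',0), (Eb,0), (Eb',0), (Eb'',0), (Ec,0), (Ec',0), (Ed,0)]
   [((Ez,0),Ep1110),((Ec,1),Em1221)]
   [((Eb'',0),Em1111),((Ed,0),Em1210)]
   [2, 2, 2, 2, 2, 2, 2, 2, 2, 2, 2, 2, 2, 2, 2, 2, 2, 2, 2, 2, 2, 1, 1, 1, 2, 2, 1]"
| "tab_E Em1221 = Row (X (-1,-2,-2,-1))
   [(Ea,0), (Ea',0), (Eb,0), (Eb',0), (Eb'',0), (Ec,0), (Ec',0), (Ed,0), (Ec,1)]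
   [((Ez,0),Ep1100),((Eb,1),Em1321)]
   [((Ec,1),Em1211)]
   [2, 2, 2, 2, 2, 2, 2, 2, 2, 2, 2, 2, 2, 2, 2, 2, 2, 2, 2, 2, 2, 2, 1, 1, 2, 2, 1]"
| "tab_E Em1321 = Row (X (-1,-3,-2,-1))
   [(Ea,0), (Ea',0), (Eb,0), (Eb',0), (Eb'',0), (Ec,0), (Ec',0), (Ed,0), (Eb,1), (Ec,1)]
   [((Ez,0),Ep1000),((Ea',1),Em2321)]
   [((Eb,1),Em1221)]
   [2, 2, 2, 2, 2, 2, 2, 2, 2, 2, 2, 2, 2, 2, 2, 2, 2, 2, 2, 2, 2, 2, 2, 1, 2, 2, 1]"
| "tab_E Em2321 = Row (X (-2,-3,-2,-1))
   [(Ea,0), (Ea',0), (Eb,0), (Eb',0), (Eb'',0), (Ec,0), (Ec',0), (Ed,0), (Ea',1), (Eb,1), (Ec,1)]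
   [((Ez,0),E_r1),((Ez,1),E_emp)]
   [((Ea',1),Em1321)]
   [2, 2, 2, 2, 2, 2, 2, 2, 2, 2, 2, 2, 2, 2, 2, 2, 2, 2, 2, 2, 2, 2, 2, 2, 2, 2, 1]"
| "tab_E E_r1 = Row (R I1)
   [(Ea',0), (Eb,0), (Ec,0)]
   [((Ea,0),Em1000),((Ez,0),Ep2321)]
   [((Ea',0),Ep1000),((Ez,0),Em2321)]
   [2, 1, 2, 1, 2, 1, 2, 2, 2, 2, 2, 2, 1, 1, 1, 1, 1, 1, 1, 1, 1, 1, 1, 0, 1, 1, 1]"
| "tab_E E_r2 = Row (R I2)
   [(Ea,0), (Eb',0), (Ec,0)]
   [((Eb,0),Em0100)]
   [((Eb',0),Ep0100)]
   [1, 2, 2, 2, 2, 2, 2, 2, 2, 2, 2, 2, 1, 1, 1, 1, 1, 1, 1, 1, 1, 1, 0, 0, 1, 1, 1]"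
| "tab_E E_emp = Row (Emp)
   [(Ez,-1), (Ea',0), (Eb,0), (Ec,0), (Ez,0)]
   [((Ez,-1),Ep2321)]
   [((Ez,1),Em2321)]
   [1, 1, 1, 1, 1, 1, 1, 1, 1, 1, 1, 1, 1, 1, 1, 1, 1, 1, 1, 1, 1, 1, 1, 1, 1, 1, 0]"
| "tab_E E_exc = Row (R I0)
   [(Ea,0), (Eb,0), (Ec,0)]
   [((Eb',0),Em0100),((Ea',0),Em1000)]
   [((Ea,0),Ep1000),((Eb,0),Ep0100)]
   []"

definition letters_E :: "letter_E list" where
  "letters_E = [Ea, Ea', Eb, Eb', Eb'', Ec, Ec', Ed, Ez]"

definition positive_E :: "root list" where
  "positive_E =
    [(1,0,0,0), (0,1,0,0), (1,1,0,0), (0,1,1,0), (1,1,1,0), (0,1,1,1), (1,1,1,1), (1,2,1,0), (1,2,1,1), (1,2,2,1), (1,3,2,1), (2,3,2,1)]"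

lemma type_E_simps:
  "cartan type_E = cartan_E" "pos_roots type_E = set positive_E" "theta type_E = (2,3,2,1)"
  "colour type_E = colour_E" "row type_E = row_E" "support type_E = support_E"
  by (simp_all add: type_E_def positive_E_def)

lemma verts_E: "set verts_E = UNIV"
proof -
  have "v \<in> set verts_E" for v by (cases v) (simp_all add: verts_E_def)
  then show ?thesis by blast
qed

lemma letters_E: "set letters_E = UNIV"
proof -
  have "l \<in> set letters_E" for l by (cases l) (simp_all add: letters_E_def)
  then show ?thesis by blast
qed

section \<open>Finite checks of the table, twisted E6\<close>

lemma is_down_E: "list_all (\<lambda>v. is_down support_E (window letters_E) (diff (tab_E v))) verts_E"
  by code_simp

lemma covers_sound_E: "list_all (covers_sound colour_E (window letters_E) tab_E) verts_E"
  by code_simp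

lemma covers_complete_E: "list_all (covers_complete support_E (window letters_E) tab_E) verts_E"
  by code_simp

lemma cocovers_ok_E: "list_all (cocovers_ok tab_E) verts_E"
  by code_simp

lemma sorted_rows_E: "list_all (sorted_rows colour_E row_E tab_E) verts_E"
  by code_simp

lemma exceptional_ok_E:
  "list_all (exceptional_ok colour_E row_E (window letters_E) tab_E) verts_E"
  by code_simp

lemma strings_ok_E: "list_all (strings_ok colour_E tab_E) verts_E"
  by code_simp

lemma weights_ok_E: "list_all (weights_ok colour_E cartan_E tab_E) verts_E"
  by code_simp

lemma arrows_ok_E: "list_all (arrows_ok colour_E (set positive_E) (2,3,2,1) tab_E) verts_E"
  by code_simp

lemma distinct_E: "distinct (map (\<lambda>v. diff (tab_E v)) verts_E)"
    "distinct (map (\<lambda>v. name (tab_E v)) verts_E)"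
  by code_simp+

lemma energy_ok_E: "energy_ok colour_E tab_E (filter (\<lambda>v. name (tab_E v) \<noteq> R I0) verts_E)"
  by code_simp

lemma energy_emp_E:
  "energy_of tab_E (filter (\<lambda>v. name (tab_E v) \<noteq> R I0) verts_E) E_emp E_emp = 0"
  by code_simp

lemma height_E: "list_all (\<lambda>v. list_all (\<lambda>i. i = I0 \<or> (case vertex_e colour_E tab_E i v of None \<Rightarrow> True
    | Some w \<Rightarrow> height (name (tab_E w)) = height (name (tab_E v)) + 1)) inds) verts_E"
  by code_simp

lemma highest_E: "list_all (\<lambda>v. name (tab_E v) \<in> {R I0, Emp, X (2,3,2,1)} \<or>
    list_ex (\<lambda>i. i \<noteq> I0 \<and> vertex_e colour_E tab_E i v \<noteq> None) inds) verts_E"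
  by code_simp

lemma theta_E: "name (tab_E Ep2321) = X (2,3,2,1)" "steps (vertex_f colour_E tab_E I0) Ep2321 = 0"
    "vertex_e colour_E tab_E I0 Ep2321 = Some E_emp"
  by code_simp+

lemma steps_emp_E: "list_all (\<lambda>i.
    steps (vertex_e colour_E tab_E i) E_emp = (if i = I0 then 1 else 0) \<and>
    steps (vertex_f colour_E tab_E i) E_emp = (if i = I0 then 1 else 0)) inds"
  by code_simp

lemma names_E:
  "X ` (set positive_E \<union> uminus ` set positive_E) \<union>
    R ` set (filter (\<lambda>i. i \<noteq> I0 \<and> alpha_root i \<in> set positive_E) inds) \<union> {Emp} =
   (\<lambda>v. name (tab_E v)) ` set (filter (\<lambda>v. name (tab_E v) \<noteq> R I0) verts_E)"
  by code_simp

section \<open>Carrier and distinguished columns, twisted E6\<close>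

lemma name_exc_E: "name (tab_E v) = R I0 \<longleftrightarrow> v = E_exc"
  by (cases v) simp_all

lemma carrier_E: "carr (perfect_crystal type_E) = (\<lambda>v. name (tab_E v)) ` {v. v \<noteq> E_exc}"
proof -
  have "set inds = UNIV" by (simp add: inds_def UNIV_ind)
  then have "{R i | i. i \<noteq> I0 \<and> alpha_root i \<in> set positive_E} =
      R ` set (filter (\<lambda>i. i \<noteq> I0 \<and> alpha_root i \<in> set positive_E) inds)" by auto
  moreover have "{v. v \<noteq> E_exc} = set (filter (\<lambda>v. name (tab_E v) \<noteq> R I0) verts_E)"
    by (simp add: verts_E name_exc_E)
  ultimately show ?thesis
    using names_E by (simp add: perfect_crystal_def Let_def roots_def type_E_simps)
qed

lemma ve_E: "name (tab_E E_emp) = Emp"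
  and base_vertex_E: "diff (tab_E Ep1110) = []"
  by simp_all

lemma zero_block_E: "(Ez, m) \<in> set (diff (tab_E v)) \<longleftrightarrow> v = E_emp \<and> (m = -1 \<or> m = 0)"
  by (cases v) simp_all

text \<open>The columns singled out by the definition are the representatives of the table moved up
  by one period, whence \<open>m - 1\<close>.\<close>

lemma col_empty_E: "col_empty type_E = {(l, m). in_col (diff (tab_E E_emp)) (l, m - 1)}"
proof -
  have "(l, m) \<in> col_empty type_E \<longleftrightarrow> in_col (diff (tab_E E_emp)) (l, m - 1)" for l m
    by (cases l) (auto simp: type_E_def base_E_def in_col_def)
  then show ?thesis by auto
qed

lemma col_r1_E: "col_r type_E I1 = Some {(l, m). in_col (diff (tab_E E_r1)) (l, m - 1)}"
    and name_r1_E: "name (tab_E v) = R I1 \<longleftrightarrow> v = E_r1"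
proof -
  have "(l, m) \<in> the (col_r type_E I1) \<longleftrightarrow> in_col (diff (tab_E E_r1)) (l, m - 1)" for l m
    by (cases l) (auto simp: type_E_def base_E_def in_col_def)
  then have "the (col_r type_E I1) = {(l, m). in_col (diff (tab_E E_r1)) (l, m - 1)}" by auto
  moreover have "col_r type_E I1 \<noteq> None" by (simp add: type_E_def)
  ultimately show "col_r type_E I1 = Some {(l, m). in_col (diff (tab_E E_r1)) (l, m - 1)}" by (metis option.collapse)
  show "name (tab_E v) = R I1 \<longleftrightarrow> v = E_r1" by (cases v) simp_all
qed

lemma col_r2_E: "col_r type_E I2 = Some {(l, m). in_col (diff (tab_E E_r2)) (l, m - 1)}"
    and name_r2_E: "name (tab_E v) = R I2 \<longleftrightarrow> v = E_r2"
proof -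
  have "(l, m) \<in> the (col_r type_E I2) \<longleftrightarrow> in_col (diff (tab_E E_r2)) (l, m - 1)" for l m
    by (cases l) (auto simp: type_E_def base_E_def in_col_def)
  then have "the (col_r type_E I2) = {(l, m). in_col (diff (tab_E E_r2)) (l, m - 1)}" by auto
  moreover have "col_r type_E I2 \<noteq> None" by (simp add: type_E_def)
  ultimately show "col_r type_E I2 = Some {(l, m). in_col (diff (tab_E E_r2)) (l, m - 1)}" by (metis option.collapse)
  show "name (tab_E v) = R I2 \<longleftrightarrow> v = E_r2" by (cases v) simp_all
qed

lemma col_r_none_E: "col_r type_E I0 = None" "col_r type_E I3 = None" "col_r type_E I4 = None"
    and name_r_none_E: "name (tab_E v) \<noteq> R I3" "name (tab_E v) \<noteq> R I4"
  by (simp_all add: type_E_def, (cases v, simp_all)+)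

lemma col_r_E: "col_r type_E j = Some y \<longleftrightarrow>
    j \<noteq> I0 \<and> (\<exists>v. name (tab_E v) = R j \<and> y = {(l, m). in_col (diff (tab_E v)) (l, m - 1)})"
  by (cases j) (auto simp: col_r1_E name_r1_E col_r2_E name_r2_E col_r_none_E name_r_none_E)

text \<open>A block \<open>Ec\<close> forces all letters except \<open>Ez\<close> one index lower,
  and \<open>Ea\<close> forces \<open>Ez\<close>. Any block of index \<open>m\<close> forces
  \<open>Ec\<close> and \<open>Ea\<close> at \<open>m - 1\<close>, which yield everything at
  \<open>m - 2\<close>, and their copies at \<open>m - 2\<close> yield everything at
  \<open>m - 3\<close>.\<close>

lemma below_E:
  assumes y: "\<forall>x\<in>y. rests_on type_E x \<subseteq> y" and lm: "(l, m) \<in> y"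
  shows "(l', m - 2) \<in> y \<and> (l', m - 3) \<in> y"
proof -
  have s: "(k', m + d) \<in> y" if "(k, m) \<in> y" "(k', d) \<in> support_E k" for k k' m d
  proof -
    have "(k', m + d) \<in> rests_on type_E (k, m)" using that(2) by (auto simp: rests_on_def type_E_simps)
    then show ?thesis using y that(1) by blast
  qed
  have z: "(Ea', m) \<in> y" if "(Ez, m) \<in> y" for m using s[OF that, of _ 0] by simp
  have b2: "(Ea', m) \<in> y \<and> (Ec', m) \<in> y" if "(Eb'', m) \<in> y" for m using s[OF that, of _ 0] by simp
  have d: "(Ec', m) \<in> y" if "(Ed, m) \<in> y" for m using s[OF that, of _ 0] by simp
  have a1: "(Eb, m) \<in> y" if "(Ea', m) \<in> y" for m using s[OF that, of _ 0] by simp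
  have c1: "(Eb, m) \<in> y \<and> (Eb', m) \<in> y" if "(Ec', m) \<in> y" for m using s[OF that, of _ 0] by simp
  have b: "(Ec, m) \<in> y" if "(Eb, m) \<in> y" for m using s[OF that, of _ 0] by simp
  have b1: "(Ec, m) \<in> y \<and> (Ea, m) \<in> y" if "(Eb', m) \<in> y" for m using s[OF that, of _ 0] by simp
  have a: "(Ez, m - 1) \<in> y \<and> (Eb'', m - 1) \<in> y" if "(Ea, m) \<in> y" for m using s[OF that, of _ "-1"] by simp
  have c: "(Eb'', m - 1) \<in> y \<and> (Ed, m - 1) \<in> y" if "(Ec, m) \<in> y" for m using s[OF that, of _ "-1"] by simp
  have hub: "(k, m - 1) \<in> y" if "(Ec, m) \<in> y" "k \<noteq> Ez" for k m
    using c[OF that(1)] that(2) b2[of "m - 1"] a1[of "m - 1"] c1[of "m - 1"] b1[of "m - 1"] b[of "m - 1"]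
    by (cases k) simp_all
  have all: "(Ec, m - 1) \<in> y \<and> (Ea, m - 1) \<in> y"
  proof (cases "l = Ea")
    case True
    then show ?thesis using lm a[of m] b2[of "m - 1"] c1[of "m - 1"] b1[of "m - 1"] by simp
  next
    case False
    then have "(Ec, m) \<in> y" using lm z[of m] b2[of m] d[of m] a1[of m] c1[of m] b[of m] b1[of m]
      by (cases l) simp_all
    then show ?thesis using hub by simp
  qed
  then have all': "(Ec, m - 2) \<in> y" "(Ea, m - 2) \<in> y" using hub[of "m - 1"] by simp_all
  show ?thesis
  proof (cases "l' = Ez")
    case True
    then show ?thesis using a[of "m - 1"] all a[OF all'(2)] by simp
  next
    case False
    then show ?thesis using hub[of "m - 1" l'] hub[OF all'(1), of l'] all by simp
  qed
qed

text \<open>In this type every block rests on blocks of strictly lower rows, so \<open>row_E\<close>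
  itself serves as rank.\<close>

interpretation E: crystal_model type_E letters_E verts_E tab_E row_E E_exc Ep1110 E_emp Ez Ep2321
proof
  fix l l' d
  show "0 \<le> row type_E l" "row type_E l \<le> 3" by (cases l; simp add: type_E_simps)+
  show "(d = 0 \<or> d = -1) \<and> 5 * d + row_E l' < row_E l" if "(l', d) \<in> support type_E l"
    using that by (cases l) (auto simp: type_E_simps)
  show "support type_E l \<noteq> {}" by (cases l) (simp_all add: type_E_simps)
  show "colour type_E l = I0 \<longleftrightarrow> l = Ez" by (cases l) (simp_all add: type_E_simps)
qed (unfold type_E_simps, (rule letters_E verts_E is_down_E covers_sound_E covers_complete_E cocovers_ok_E
    sorted_rows_E exceptional_ok_E strings_ok_E weights_ok_E arrows_ok_E distinct_E energy_ok_E
    energy_emp_E ve_E base_vertex_E height_E highest_E theta_E steps_emp_E name_exc_E carrier_E zero_block_E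
    col_empty_E col_r_E | erule (1) below_E)+)


section \<open>Type affine F4\<close>

datatype vertex_F =
  Fp1000 | Fp0100 | Fp0010 | Fp0001 | Fp1100 | Fp0110 | Fp0011 | Fp1110 | Fp0120 | Fp0111 | Fp1120
   | Fp1111 | Fp0121 | Fp1220 | Fp1121 | Fp0122 | Fp1221 | Fp1122 | Fp1231 | Fp1222 | Fp1232 |
   Fp1242 | Fp1342 | Fp2342 | Fm1000 | Fm0100 | Fm0010 | Fm0001 | Fm1100 | Fm0110 | Fm0011 | Fm1110
   | Fm0120 | Fm0111 | Fm1120 | Fm1111 | Fm0121 | Fm1220 | Fm1121 | Fm0122 | Fm1221 | Fm1122 |
   Fm1231 | Fm1222 | Fm1232 | Fm1242 | Fm1342 | Fm2342 | F_r1 | F_r2 | F_r3 | F_r4 | F_emp | F_exc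

definition verts_F :: "vertex_F list" where
  "verts_F =
  [Fp1000, Fp0100, Fp0010, Fp0001, Fp1100, Fp0110, Fp0011, Fp1110, Fp0120, Fp0111, Fp1120, Fp1111,
   Fp0121, Fp1220, Fp1121, Fp0122, Fp1221, Fp1122, Fp1231, Fp1222, Fp1232, Fp1242, Fp1342, Fp2342,
   Fm1000, Fm0100, Fm0010, Fm0001, Fm1100, Fm0110, Fm0011, Fm1110, Fm0120, Fm0111, Fm1120, Fm1111,
   Fm0121, Fm1220, Fm1121, Fm0122, Fm1221, Fm1122, Fm1231, Fm1222, Fm1232, Fm1242, Fm1342, Fm2342,
   F_r1, F_r2, F_r3, F_r4, F_emp, F_exc]"

text \<open>Here all four \<alpha>_j with j nonzero are among the roots, so there are 48 roots, four
  r_j and \<emptyset>. The empty \<open>diff\<close> belongs to \<open>Fp1121\<close>.\<close>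

primrec tab_F :: "vertex_F \<Rightarrow> (letter_F, vertex_F) table_row" where
  "tab_F Fp1000 = Row (X (1,0,0,0))
   [(Fb2,0), (Fc1,0), (Fc2,0), (Fd1,0)]
   [((Fa1,0),F_exc),((Fa2,0),F_r1)]
   [((Fb2,0),Fp1100),((Fz,0),Fm1342)]
   [2, 1, 1, 1, 2, 1, 1, 2, 1, 1, 2, 2, 1, 2, 2, 1, 2, 2, 2, 2, 2, 2, 2, 2, 1, 1, 1, 1, 1, 1, 1, 1,
   1, 1, 1, 1, 1, 1, 1, 1, 1, 1, 1, 1, 1, 1, 1, 0, 1, 1, 1, 1, 1]"
| "tab_F Fp0100 = Row (X (0,1,0,0))
   [(Fa1,0), (Fc1,0), (Fc2,0), (Fd1,0)]
   [((Fb1,0),F_r2),((Fb2,0),F_exc)]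
   [((Fa1,0),Fp1100),((Fc2,0),Fp0110)]
   [1, 2, 1, 1, 2, 2, 1, 2, 2, 2, 2, 2, 2, 2, 2, 2, 2, 2, 2, 2, 2, 2, 2, 2, 1, 1, 1, 1, 1, 1, 1, 1,
   1, 1, 1, 1, 1, 1, 1, 1, 1, 1, 1, 1, 1, 1, 0, 0, 1, 1, 1, 1, 1]"
| "tab_F Fp0010 = Row (X (0,0,1,0))
   [(Fa1,0), (Fb1,0), (Fc1,0), (Fd1,0)]
   [((Fc2,0),F_r2),((Fc3,0),F_r3)]
   [((Fd1,0),Fp0011),((Fb1,0),Fp0110)]
   [1, 1, 1, 1, 1, 1, 1, 1, 2, 1, 2, 1, 2, 2, 2, 2, 2, 2, 2, 2, 2, 2, 2, 2, 1, 1, 1, 1, 1, 1, 1, 1,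
   1, 1, 1, 1, 1, 1, 1, 1, 1, 1, 0, 1, 0, 0, 0, 0, 1, 1, 1, 1, 1]"
| "tab_F Fp0001 = Row (X (0,0,0,1))
   [(Fa1,0), (Fb1,0), (Fc1,0), (Fc3,0)]
   [((Fd1,0),F_r3),((Fd2,0),F_r4)]
   [((Fc3,0),Fp0011)]
   [1, 1, 1, 1, 1, 1, 1, 1, 1, 1, 1, 1, 1, 1, 1, 2, 1, 2, 1, 2, 2, 2, 2, 2, 1, 1, 1, 0, 1, 1, 0, 1,
   1, 0, 1, 0, 0, 1, 0, 0, 0, 0, 0, 0, 0, 0, 0, 0, 1, 1, 1, 0, 1]"
| "tab_F Fp1100 = Row (X (1,1,0,0))
   [(Fc1,0), (Fc2,0), (Fd1,0)]
   [((Fa1,0),Fp0100),((Fb2,0),Fp1000)]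
   [((Fc2,0),Fp1110),((Fz,0),Fm1242)]
   [1, 1, 1, 1, 2, 1, 1, 2, 1, 1, 2, 2, 1, 2, 2, 1, 2, 2, 2, 2, 2, 2, 2, 2, 1, 1, 1, 1, 1, 1, 1, 1,
   1, 1, 1, 1, 1, 1, 1, 1, 1, 1, 1, 1, 1, 1, 0, 0, 1, 1, 1, 1, 1]"
| "tab_F Fp0110 = Row (X (0,1,1,0))
   [(Fa1,0), (Fc1,0), (Fd1,0)]
   [((Fb1,0),Fp0010),((Fc2,0),Fp0100)]
   [((Fa1,0),Fp1110),((Fc1,0),Fp0120),((Fd1,0),Fp0111)]
   [1, 1, 1, 1, 1, 1, 1, 1, 2, 1, 2, 1, 2, 2, 2, 2, 2, 2, 2, 2, 2, 2, 2, 2, 1, 1, 1, 1, 1, 1, 1, 1,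
   1, 1, 1, 1, 1, 1, 1, 1, 1, 1, 0, 1, 0, 0, 0, 0, 1, 1, 1, 1, 1]"
| "tab_F Fp0011 = Row (X (0,0,1,1))
   [(Fa1,0), (Fb1,0), (Fc1,0)]
   [((Fd1,0),Fp0010),((Fc3,0),Fp0001)]
   [((Fb1,0),Fp0111)]
   [1, 1, 1, 1, 1, 1, 1, 1, 1, 1, 1, 1, 1, 1, 1, 2, 1, 2, 1, 2, 2, 2, 2, 2, 1, 1, 1, 0, 1, 1, 0, 1,
   1, 0, 1, 0, 0, 1, 0, 0, 0, 0, 0, 0, 0, 0, 0, 0, 1, 1, 1, 0, 1]"
| "tab_F Fp1110 = Row (X (1,1,1,0))
   [(Fc1,0), (Fd1,0)]
   [((Fa1,0),Fp0110),((Fc2,0),Fp1100)]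
   [((Fc1,0),Fp1120),((Fd1,0),Fp1111),((Fz,0),Fm1232)]
   [1, 1, 1, 1, 1, 1, 1, 1, 1, 1, 2, 1, 1, 2, 2, 1, 2, 2, 2, 2, 2, 2, 2, 2, 1, 1, 1, 1, 1, 1, 1, 1,
   1, 1, 1, 1, 1, 1, 1, 1, 1, 1, 0, 1, 0, 0, 0, 0, 1, 1, 1, 1, 1]"
| "tab_F Fp0120 = Row (X (0,1,2,0))
   [(Fa1,0), (Fd1,0)]
   [((Fc1,0),Fp0110)]
   [((Fa1,0),Fp1120),((Fd1,0),Fp0121)]
   [1, 1, 1, 1, 1, 1, 1, 1, 2, 1, 2, 1, 2, 2, 2, 2, 2, 2, 2, 2, 2, 2, 2, 2, 1, 1, 1, 1, 1, 1, 1, 1,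
   1, 1, 1, 1, 1, 1, 1, 1, 1, 1, 0, 1, 0, 0, 0, 0, 1, 1, 1, 1, 1]"
| "tab_F Fp0111 = Row (X (0,1,1,1))
   [(Fa1,0), (Fc1,0)]
   [((Fd1,0),Fp0110),((Fb1,0),Fp0011)]
   [((Fa1,0),Fp1111),((Fc1,0),Fp0121)]
   [1, 1, 1, 1, 1, 1, 1, 1, 1, 1, 1, 1, 1, 1, 1, 2, 1, 2, 1, 2, 2, 2, 2, 2, 1, 1, 1, 0, 1, 1, 0, 1,
   1, 0, 1, 0, 0, 1, 0, 0, 0, 0, 0, 0, 0, 0, 0, 0, 1, 1, 1, 0, 1]"
| "tab_F Fp1120 = Row (X (1,1,2,0))
   [(Fd1,0)]
   [((Fa1,0),Fp0120),((Fc1,0),Fp1110)]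
   [((Fb3,-1),Fp1220),((Fd1,0),Fp1121),((Fz,0),Fm1222)]
   [1, 1, 1, 1, 1, 1, 1, 1, 1, 1, 2, 1, 1, 2, 2, 1, 2, 2, 2, 2, 2, 2, 2, 2, 1, 1, 1, 1, 1, 1, 1, 1,
   1, 1, 1, 1, 1, 1, 1, 1, 1, 1, 0, 1, 0, 0, 0, 0, 1, 1, 1, 1, 1]"
| "tab_F Fp1111 = Row (X (1,1,1,1))
   [(Fc1,0)]
   [((Fa1,0),Fp0111),((Fd1,0),Fp1110)]
   [((Fc1,0),Fp1121),((Fz,0),Fm1231)]
   [1, 1, 1, 1, 1, 1, 1, 1, 1, 1, 1, 1, 1, 1, 1, 1, 1, 2, 1, 2, 2, 2, 2, 2, 1, 1, 1, 0, 1, 1, 0, 1,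
   1, 0, 1, 0, 0, 1, 0, 0, 0, 0, 0, 0, 0, 0, 0, 0, 1, 1, 1, 0, 1]"
| "tab_F Fp0121 = Row (X (0,1,2,1))
   [(Fa1,0)]
   [((Fc1,0),Fp0111),((Fd1,0),Fp0120)]
   [((Fd2,-1),Fp0122),((Fa1,0),Fp1121)]
   [1, 1, 1, 1, 1, 1, 1, 1, 1, 1, 1, 1, 1, 1, 1, 2, 1, 2, 1, 2, 2, 2, 2, 2, 1, 1, 1, 0, 1, 1, 0, 1,
   1, 0, 1, 0, 0, 1, 0, 0, 0, 0, 0, 0, 0, 0, 0, 0, 1, 1, 1, 0, 1]"
| "tab_F Fp1220 = Row (X (1,2,2,0))
   [(Fb3,-1), (Fd1,0)]
   [((Fb3,-1),Fp1120)]
   [((Fd1,0),Fp1221),((Fz,0),Fm1122)]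
   [1, 1, 1, 1, 1, 1, 1, 1, 1, 1, 1, 1, 1, 2, 1, 1, 2, 1, 2, 2, 2, 2, 2, 2, 1, 1, 1, 1, 1, 1, 1, 1,
   1, 1, 1, 1, 1, 0, 1, 1, 0, 1, 0, 0, 0, 0, 0, 0, 1, 1, 1, 1, 1]"
| "tab_F Fp1121 = Row (X (1,1,2,1))
   []
   [((Fa1,0),Fp0121),((Fc1,0),Fp1111),((Fd1,0),Fp1120)]
   [((Fb3,-1),Fp1221),((Fd2,-1),Fp1122),((Fz,0),Fm1221)]
   [1, 1, 1, 1, 1, 1, 1, 1, 1, 1, 1, 1, 1, 1, 1, 1, 1, 2, 1, 2, 2, 2, 2, 2, 1, 1, 1, 0, 1, 1, 0, 1,
   1, 0, 1, 0, 0, 1, 0, 0, 0, 0, 0, 0, 0, 0, 0, 0, 1, 1, 1, 0, 1]"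
| "tab_F Fp0122 = Row (X (0,1,2,2))
   [(Fd2,-1), (Fa1,0)]
   [((Fd2,-1),Fp0121)]
   [((Fa1,0),Fp1122)]
   [1, 1, 1, 1, 1, 1, 1, 1, 1, 1, 1, 1, 1, 1, 1, 2, 1, 2, 1, 2, 2, 2, 2, 2, 1, 1, 1, 0, 1, 1, 0, 1,
   1, 0, 1, 0, 0, 1, 0, 0, 0, 0, 0, 0, 0, 0, 0, 0, 1, 1, 1, 0, 1]"
| "tab_F Fp1221 = Row (X (1,2,2,1))
   [(Fb3,-1)]
   [((Fb3,-1),Fp1121),((Fd1,0),Fp1220)]
   [((Fc4,-1),Fp1231),((Fd2,-1),Fp1222),((Fz,0),Fm1121)]
   [1, 1, 1, 1, 1, 1, 1, 1, 1, 1, 1, 1, 1, 1, 1, 1, 1, 1, 1, 2, 2, 2, 2, 2, 1, 1, 1, 0, 1, 1, 0, 1,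
   1, 0, 1, 0, 0, 0, 0, 0, 0, 0, 0, 0, 0, 0, 0, 0, 1, 1, 1, 0, 1]"
| "tab_F Fp1122 = Row (X (1,1,2,2))
   [(Fd2,-1)]
   [((Fd2,-1),Fp1121),((Fa1,0),Fp0122)]
   [((Fb3,-1),Fp1222),((Fz,0),Fm1220)]
   [1, 1, 1, 1, 1, 1, 1, 1, 1, 1, 1, 1, 1, 1, 1, 1, 1, 2, 1, 2, 2, 2, 2, 2, 1, 1, 1, 0, 1, 1, 0, 1,
   1, 0, 1, 0, 0, 1, 0, 0, 0, 0, 0, 0, 0, 0, 0, 0, 1, 1, 1, 0, 1]"
| "tab_F Fp1231 = Row (X (1,2,3,1))
   [(Fb3,-1), (Fc4,-1)]
   [((Fc4,-1),Fp1221)]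
   [((Fd2,-1),Fp1232),((Fz,0),Fm1111)]
   [1, 1, 1, 0, 1, 1, 1, 1, 1, 1, 1, 1, 1, 1, 1, 1, 1, 1, 1, 1, 1, 2, 2, 2, 1, 1, 0, 0, 1, 0, 0, 0,
   0, 0, 0, 0, 0, 0, 0, 0, 0, 0, 0, 0, 0, 0, 0, 0, 1, 1, 0, 0, 1]"
| "tab_F Fp1222 = Row (X (1,2,2,2))
   [(Fb3,-1), (Fd2,-1)]
   [((Fb3,-1),Fp1122),((Fd2,-1),Fp1221)]
   [((Fc4,-1),Fp1232),((Fz,0),Fm1120)]
   [1, 1, 1, 1, 1, 1, 1, 1, 1, 1, 1, 1, 1, 1, 1, 1, 1, 1, 1, 2, 2, 2, 2, 2, 1, 1, 1, 0, 1, 1, 0, 1,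
   1, 0, 1, 0, 0, 0, 0, 0, 0, 0, 0, 0, 0, 0, 0, 0, 1, 1, 1, 0, 1]"
| "tab_F Fp1232 = Row (X (1,2,3,2))
   [(Fb3,-1), (Fc4,-1), (Fd2,-1)]
   [((Fc4,-1),Fp1222),((Fd2,-1),Fp1231)]
   [((Fc3,-1),Fp1242),((Fz,0),Fm1110)]
   [1, 1, 1, 0, 1, 1, 1, 1, 1, 1, 1, 1, 1, 1, 1, 1, 1, 1, 1, 1, 1, 2, 2, 2, 1, 1, 0, 0, 1, 0, 0, 0,
   0, 0, 0, 0, 0, 0, 0, 0, 0, 0, 0, 0, 0, 0, 0, 0, 1, 1, 0, 0, 1]"
| "tab_F Fp1242 = Row (X (1,2,4,2))
   [(Fb3,-1), (Fc3,-1), (Fc4,-1), (Fd2,-1)]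
   [((Fc3,-1),Fp1232)]
   [((Fb1,-1),Fp1342),((Fz,0),Fm1100)]
   [1, 1, 1, 0, 1, 1, 1, 1, 1, 1, 1, 1, 1, 1, 1, 1, 1, 1, 1, 1, 1, 2, 2, 2, 1, 1, 0, 0, 1, 0, 0, 0,
   0, 0, 0, 0, 0, 0, 0, 0, 0, 0, 0, 0, 0, 0, 0, 0, 1, 1, 0, 0, 1]"
| "tab_F Fp1342 = Row (X (1,3,4,2))
   [(Fb1,-1), (Fb3,-1), (Fc3,-1), (Fc4,-1), (Fd2,-1)]
   [((Fb1,-1),Fp1242)]
   [((Fa1,-1),Fp2342),((Fz,0),Fm1000)]
   [1, 1, 0, 0, 1, 1, 0, 1, 1, 1, 1, 1, 1, 1, 1, 1, 1, 1, 1, 1, 1, 1, 2, 2, 1, 0, 0, 0, 0, 0, 0, 0,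
   0, 0, 0, 0, 0, 0, 0, 0, 0, 0, 0, 0, 0, 0, 0, 0, 1, 0, 0, 0, 1]"
| "tab_F Fp2342 = Row (X (2,3,4,2))
   [(Fa1,-1), (Fb1,-1), (Fb3,-1), (Fc3,-1), (Fc4,-1), (Fd2,-1)]
   [((Fa1,-1),Fp1342)]
   [((Fz,-1),F_emp),((Fz,0),F_r1)]
   [1, 0, 0, 0, 1, 0, 0, 1, 0, 0, 1, 1, 0, 1, 1, 0, 1, 1, 1, 1, 1, 1, 1, 2, 0, 0, 0, 0, 0, 0, 0, 0,
   0, 0, 0, 0, 0, 0, 0, 0, 0, 0, 0, 0, 0, 0, 0, 0, 0, 0, 0, 0, 1]"
| "tab_F Fm1000 = Row (X (-1,0,0,0))
   [(Fa1,0), (Fa2,0), (Fb2,0), (Fc1,0), (Fc2,0), (Fd1,0)]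
   [((Fb1,0),Fm1100),((Fz,0),Fp1342)]
   [((Fa1,0),F_r1),((Fa2,0),F_exc)]
   [2, 2, 1, 1, 2, 2, 1, 2, 2, 2, 2, 2, 2, 2, 2, 2, 2, 2, 2, 2, 2, 2, 2, 2, 2, 1, 1, 1, 1, 1, 1, 1,
   1, 1, 1, 1, 1, 1, 1, 1, 1, 1, 1, 1, 1, 1, 1, 1, 2, 1, 1, 1, 1]"
| "tab_F Fm0100 = Row (X (0,-1,0,0))
   [(Fa1,0), (Fb1,0), (Fb2,0), (Fc1,0), (Fc2,0), (Fd1,0)]
   [((Fc3,0),Fm0110),((Fa2,0),Fm1100)]
   [((Fb1,0),F_exc),((Fb2,0),F_r2)]
   [2, 2, 2, 1, 2, 2, 2, 2, 2, 2, 2, 2, 2, 2, 2, 2, 2, 2, 2, 2, 2, 2, 2, 2, 1, 2, 1, 1, 1, 1, 1, 1,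
   1, 1, 1, 1, 1, 1, 1, 1, 1, 1, 1, 1, 1, 1, 1, 0, 1, 2, 1, 1, 1]"
| "tab_F Fm0010 = Row (X (0,0,-1,0))
   [(Fa1,0), (Fb1,0), (Fc1,0), (Fc2,0), (Fc3,0), (Fd1,0)]
   [((Fb2,0),Fm0110),((Fd2,0),Fm0011)]
   [((Fc2,0),F_r3),((Fc3,0),F_r2)]
   [1, 2, 1, 1, 2, 2, 1, 2, 2, 2, 2, 2, 2, 2, 2, 2, 2, 2, 2, 2, 2, 2, 2, 2, 1, 1, 1, 1, 1, 1, 1, 1,
   1, 1, 1, 1, 1, 1, 1, 1, 1, 1, 1, 1, 1, 1, 0, 0, 1, 1, 1, 1, 1]"
| "tab_F Fm0001 = Row (X (0,0,0,-1))
   [(Fa1,0), (Fb1,0), (Fc1,0), (Fc3,0), (Fd1,0), (Fd2,0)]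
   [((Fc2,0),Fm0011)]
   [((Fd1,0),F_r4),((Fd2,0),F_r3)]
   [1, 1, 1, 1, 1, 1, 1, 1, 2, 1, 2, 1, 2, 2, 2, 2, 2, 2, 2, 2, 2, 2, 2, 2, 1, 1, 1, 1, 1, 1, 1, 1,
   1, 1, 1, 1, 1, 1, 1, 1, 1, 1, 0, 1, 0, 0, 0, 0, 1, 1, 1, 1, 1]"
| "tab_F Fm1100 = Row (X (-1,-1,0,0))
   [(Fa1,0), (Fa2,0), (Fb1,0), (Fb2,0), (Fc1,0), (Fc2,0), (Fd1,0)]
   [((Fc3,0),Fm1110),((Fz,0),Fp1242)]
   [((Fb1,0),Fm1000),((Fa2,0),Fm0100)]
   [2, 2, 2, 1, 2, 2, 2, 2, 2, 2, 2, 2, 2, 2, 2, 2, 2, 2, 2, 2, 2, 2, 2, 2, 2, 2, 1, 1, 2, 1, 1, 1,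
   1, 1, 1, 1, 1, 1, 1, 1, 1, 1, 1, 1, 1, 1, 1, 1, 2, 2, 1, 1, 1]"
| "tab_F Fm0110 = Row (X (0,-1,-1,0))
   [(Fa1,0), (Fb1,0), (Fb2,0), (Fc1,0), (Fc2,0), (Fc3,0), (Fd1,0)]
   [((Fa2,0),Fm1110),((Fc4,0),Fm0120),((Fd2,0),Fm0111)]
   [((Fc3,0),Fm0100),((Fb2,0),Fm0010)]
   [2, 2, 2, 1, 2, 2, 2, 2, 2, 2, 2, 2, 2, 2, 2, 2, 2, 2, 2, 2, 2, 2, 2, 2, 1, 2, 1, 1, 1, 1, 1, 1,
   1, 1, 1, 1, 1, 1, 1, 1, 1, 1, 1, 1, 1, 1, 1, 0, 1, 2, 1, 1, 1]"
| "tab_F Fm0011 = Row (X (0,0,-1,-1))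
   [(Fa1,0), (Fb1,0), (Fc1,0), (Fc2,0), (Fc3,0), (Fd1,0), (Fd2,0)]
   [((Fb2,0),Fm0111)]
   [((Fc2,0),Fm0001),((Fd2,0),Fm0010)]
   [1, 2, 1, 1, 2, 2, 1, 2, 2, 2, 2, 2, 2, 2, 2, 2, 2, 2, 2, 2, 2, 2, 2, 2, 1, 1, 1, 1, 1, 1, 1, 1,
   1, 1, 1, 1, 1, 1, 1, 1, 1, 1, 1, 1, 1, 1, 0, 0, 1, 1, 1, 1, 1]"
| "tab_F Fm1110 = Row (X (-1,-1,-1,0))
   [(Fa1,0), (Fa2,0), (Fb1,0), (Fb2,0), (Fc1,0), (Fc2,0), (Fc3,0), (Fd1,0)]
   [((Fc4,0),Fm1120),((Fd2,0),Fm1111),((Fz,0),Fp1232)]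
   [((Fc3,0),Fm1100),((Fa2,0),Fm0110)]
   [2, 2, 2, 1, 2, 2, 2, 2, 2, 2, 2, 2, 2, 2, 2, 2, 2, 2, 2, 2, 2, 2, 2, 2, 2, 2, 1, 1, 2, 1, 1, 1,
   1, 1, 1, 1, 1, 1, 1, 1, 1, 1, 1, 1, 1, 1, 1, 1, 2, 2, 1, 1, 1]"
| "tab_F Fm0120 = Row (X (0,-1,-2,0))
   [(Fa1,0), (Fb1,0), (Fb2,0), (Fc1,0), (Fc2,0), (Fc3,0), (Fc4,0), (Fd1,0)]
   [((Fa2,0),Fm1120),((Fd2,0),Fm0121)]
   [((Fc4,0),Fm0110)]
   [2, 2, 2, 2, 2, 2, 2, 2, 2, 2, 2, 2, 2, 2, 2, 2, 2, 2, 2, 2, 2, 2, 2, 2, 1, 2, 2, 1, 1, 2, 1, 1,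
   2, 1, 1, 1, 1, 1, 1, 1, 1, 1, 1, 1, 1, 1, 1, 0, 1, 2, 2, 1, 1]"
| "tab_F Fm0111 = Row (X (0,-1,-1,-1))
   [(Fa1,0), (Fb1,0), (Fb2,0), (Fc1,0), (Fc2,0), (Fc3,0), (Fd1,0), (Fd2,0)]
   [((Fa2,0),Fm1111),((Fc4,0),Fm0121)]
   [((Fb2,0),Fm0011),((Fd2,0),Fm0110)]
   [2, 2, 2, 1, 2, 2, 2, 2, 2, 2, 2, 2, 2, 2, 2, 2, 2, 2, 2, 2, 2, 2, 2, 2, 1, 2, 1, 1, 1, 1, 1, 1,
   1, 1, 1, 1, 1, 1, 1, 1, 1, 1, 1, 1, 1, 1, 1, 0, 1, 2, 1, 1, 1]"
| "tab_F Fm1120 = Row (X (-1,-1,-2,0))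
   [(Fa1,0), (Fa2,0), (Fb1,0), (Fb2,0), (Fc1,0), (Fc2,0), (Fc3,0), (Fc4,0), (Fd1,0)]
   [((Fb3,0),Fm1220),((Fd2,0),Fm1121),((Fz,0),Fp1222)]
   [((Fc4,0),Fm1110),((Fa2,0),Fm0120)]
   [2, 2, 2, 2, 2, 2, 2, 2, 2, 2, 2, 2, 2, 2, 2, 2, 2, 2, 2, 2, 2, 2, 2, 2, 2, 2, 2, 1, 2, 2, 1, 2,
   2, 1, 2, 1, 1, 1, 1, 1, 1, 1, 1, 1, 1, 1, 1, 1, 2, 2, 2, 1, 1]"
| "tab_F Fm1111 = Row (X (-1,-1,-1,-1))
   [(Fa1,0), (Fa2,0), (Fb1,0), (Fb2,0), (Fc1,0), (Fc2,0), (Fc3,0), (Fd1,0), (Fd2,0)]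
   [((Fc4,0),Fm1121),((Fz,0),Fp1231)]
   [((Fd2,0),Fm1110),((Fa2,0),Fm0111)]
   [2, 2, 2, 1, 2, 2, 2, 2, 2, 2, 2, 2, 2, 2, 2, 2, 2, 2, 2, 2, 2, 2, 2, 2, 2, 2, 1, 1, 2, 1, 1, 1,
   1, 1, 1, 1, 1, 1, 1, 1, 1, 1, 1, 1, 1, 1, 1, 1, 2, 2, 1, 1, 1]"
| "tab_F Fm0121 = Row (X (0,-1,-2,-1))
   [(Fa1,0), (Fb1,0), (Fb2,0), (Fc1,0), (Fc2,0), (Fc3,0), (Fc4,0), (Fd1,0), (Fd2,0)]
   [((Fa2,0),Fm1121),((Fd1,1),Fm0122)]
   [((Fd2,0),Fm0120),((Fc4,0),Fm0111)]
   [2, 2, 2, 2, 2, 2, 2, 2, 2, 2, 2, 2, 2, 2, 2, 2, 2, 2, 2, 2, 2, 2, 2, 2, 1, 2, 2, 1, 1, 2, 1, 1,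
   2, 1, 1, 1, 1, 1, 1, 1, 1, 1, 1, 1, 1, 1, 1, 0, 1, 2, 2, 1, 1]"
| "tab_F Fm1220 = Row (X (-1,-2,-2,0))
   [(Fa1,0), (Fa2,0), (Fb1,0), (Fb2,0), (Fb3,0), (Fc1,0), (Fc2,0), (Fc3,0), (Fc4,0), (Fd1,0)]
   [((Fd2,0),Fm1221),((Fz,0),Fp1122)]
   [((Fb3,0),Fm1120)]
   [2, 2, 2, 2, 2, 2, 2, 2, 2, 2, 2, 2, 2, 2, 2, 2, 2, 2, 2, 2, 2, 2, 2, 2, 2, 2, 2, 1, 2, 2, 1, 2,
   2, 1, 2, 1, 1, 2, 1, 1, 1, 1, 1, 1, 1, 1, 1, 1, 2, 2, 2, 1, 1]"
| "tab_F Fm1121 = Row (X (-1,-1,-2,-1))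
   [(Fa1,0), (Fa2,0), (Fb1,0), (Fb2,0), (Fc1,0), (Fc2,0), (Fc3,0), (Fc4,0), (Fd1,0), (Fd2,0)]
   [((Fb3,0),Fm1221),((Fz,0),Fp1221),((Fd1,1),Fm1122)]
   [((Fd2,0),Fm1120),((Fc4,0),Fm1111),((Fa2,0),Fm0121)]
   [2, 2, 2, 2, 2, 2, 2, 2, 2, 2, 2, 2, 2, 2, 2, 2, 2, 2, 2, 2, 2, 2, 2, 2, 2, 2, 2, 1, 2, 2, 1, 2,
   2, 1, 2, 1, 1, 1, 1, 1, 1, 1, 1, 1, 1, 1, 1, 1, 2, 2, 2, 1, 1]"
| "tab_F Fm0122 = Row (X (0,-1,-2,-2))
   [(Fa1,0), (Fb1,0), (Fb2,0), (Fc1,0), (Fc2,0), (Fc3,0), (Fc4,0), (Fd1,0), (Fd2,0), (Fd1,1)]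
   [((Fa2,0),Fm1122)]
   [((Fd1,1),Fm0121)]
   [2, 2, 2, 2, 2, 2, 2, 2, 2, 2, 2, 2, 2, 2, 2, 2, 2, 2, 2, 2, 2, 2, 2, 2, 1, 2, 2, 2, 1, 2, 2, 1,
   2, 2, 1, 1, 2, 1, 1, 2, 1, 1, 1, 1, 1, 1, 1, 0, 1, 2, 2, 2, 1]"
| "tab_F Fm1221 = Row (X (-1,-2,-2,-1))
   [(Fa1,0), (Fa2,0), (Fb1,0), (Fb2,0), (Fb3,0), (Fc1,0), (Fc2,0), (Fc3,0), (Fc4,0), (Fd1,0),
   (Fd2,0)]
   [((Fz,0),Fp1121),((Fc1,1),Fm1231),((Fd1,1),Fm1222)]
   [((Fd2,0),Fm1220),((Fb3,0),Fm1121)]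
   [2, 2, 2, 2, 2, 2, 2, 2, 2, 2, 2, 2, 2, 2, 2, 2, 2, 2, 2, 2, 2, 2, 2, 2, 2, 2, 2, 1, 2, 2, 1, 2,
   2, 1, 2, 1, 1, 2, 1, 1, 1, 1, 1, 1, 1, 1, 1, 1, 2, 2, 2, 1, 1]"
| "tab_F Fm1122 = Row (X (-1,-1,-2,-2))
   [(Fa1,0), (Fa2,0), (Fb1,0), (Fb2,0), (Fc1,0), (Fc2,0), (Fc3,0), (Fc4,0), (Fd1,0), (Fd2,0),
   (Fd1,1)]
   [((Fb3,0),Fm1222),((Fz,0),Fp1220)]
   [((Fa2,0),Fm0122),((Fd1,1),Fm1121)]
   [2, 2, 2, 2, 2, 2, 2, 2, 2, 2, 2, 2, 2, 2, 2, 2, 2, 2, 2, 2, 2, 2, 2, 2, 2, 2, 2, 2, 2, 2, 2, 2,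
   2, 2, 2, 2, 2, 1, 2, 2, 1, 2, 1, 1, 1, 1, 1, 1, 2, 2, 2, 2, 1]"
| "tab_F Fm1231 = Row (X (-1,-2,-3,-1))
   [(Fa1,0), (Fa2,0), (Fb1,0), (Fb2,0), (Fb3,0), (Fc1,0), (Fc2,0), (Fc3,0), (Fc4,0), (Fd1,0),
   (Fd2,0), (Fc1,1)]
   [((Fz,0),Fp1111),((Fd1,1),Fm1232)]
   [((Fc1,1),Fm1221)]
   [2, 2, 2, 2, 2, 2, 2, 2, 2, 2, 2, 2, 2, 2, 2, 2, 2, 2, 2, 2, 2, 2, 2, 2, 2, 2, 2, 1, 2, 2, 1, 2,
   2, 1, 2, 1, 1, 2, 1, 1, 1, 1, 1, 1, 1, 1, 1, 1, 2, 2, 2, 1, 1]"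
| "tab_F Fm1222 = Row (X (-1,-2,-2,-2))
   [(Fa1,0), (Fa2,0), (Fb1,0), (Fb2,0), (Fb3,0), (Fc1,0), (Fc2,0), (Fc3,0), (Fc4,0), (Fd1,0),
   (Fd2,0), (Fd1,1)]
   [((Fz,0),Fp1120),((Fc1,1),Fm1232)]
   [((Fb3,0),Fm1122),((Fd1,1),Fm1221)]
   [2, 2, 2, 2, 2, 2, 2, 2, 2, 2, 2, 2, 2, 2, 2, 2, 2, 2, 2, 2, 2, 2, 2, 2, 2, 2, 2, 2, 2, 2, 2, 2,
   2, 2, 2, 2, 2, 2, 2, 2, 2, 2, 1, 2, 1, 1, 1, 1, 2, 2, 2, 2, 1]"
| "tab_F Fm1232 = Row (X (-1,-2,-3,-2))
   [(Fa1,0), (Fa2,0), (Fb1,0), (Fb2,0), (Fb3,0), (Fc1,0), (Fc2,0), (Fc3,0), (Fc4,0), (Fd1,0),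
   (Fd2,0), (Fc1,1), (Fd1,1)]
   [((Fz,0),Fp1110),((Fc2,1),Fm1242)]
   [((Fd1,1),Fm1231),((Fc1,1),Fm1222)]
   [2, 2, 2, 2, 2, 2, 2, 2, 2, 2, 2, 2, 2, 2, 2, 2, 2, 2, 2, 2, 2, 2, 2, 2, 2, 2, 2, 2, 2, 2, 2, 2,
   2, 2, 2, 2, 2, 2, 2, 2, 2, 2, 1, 2, 1, 1, 1, 1, 2, 2, 2, 2, 1]"
| "tab_F Fm1242 = Row (X (-1,-2,-4,-2))
   [(Fa1,0), (Fa2,0), (Fb1,0), (Fb2,0), (Fb3,0), (Fc1,0), (Fc2,0), (Fc3,0), (Fc4,0), (Fd1,0),
   (Fd2,0), (Fc1,1), (Fc2,1), (Fd1,1)]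
   [((Fz,0),Fp1100),((Fb2,1),Fm1342)]
   [((Fc2,1),Fm1232)]
   [2, 2, 2, 2, 2, 2, 2, 2, 2, 2, 2, 2, 2, 2, 2, 2, 2, 2, 2, 2, 2, 2, 2, 2, 2, 2, 2, 2, 2, 2, 2, 2,
   2, 2, 2, 2, 2, 2, 2, 2, 2, 2, 2, 2, 2, 2, 1, 1, 2, 2, 2, 2, 1]"
| "tab_F Fm1342 = Row (X (-1,-3,-4,-2))
   [(Fa1,0), (Fa2,0), (Fb1,0), (Fb2,0), (Fb3,0), (Fc1,0), (Fc2,0), (Fc3,0), (Fc4,0), (Fd1,0),
   (Fd2,0), (Fb2,1), (Fc1,1), (Fc2,1), (Fd1,1)]
   [((Fz,0),Fp1000),((Fa2,1),Fm2342)]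
   [((Fb2,1),Fm1242)]
   [2, 2, 2, 2, 2, 2, 2, 2, 2, 2, 2, 2, 2, 2, 2, 2, 2, 2, 2, 2, 2, 2, 2, 2, 2, 2, 2, 2, 2, 2, 2, 2,
   2, 2, 2, 2, 2, 2, 2, 2, 2, 2, 2, 2, 2, 2, 2, 1, 2, 2, 2, 2, 1]"
| "tab_F Fm2342 = Row (X (-2,-3,-4,-2))
   [(Fa1,0), (Fa2,0), (Fb1,0), (Fb2,0), (Fb3,0), (Fc1,0), (Fc2,0), (Fc3,0), (Fc4,0), (Fd1,0),
   (Fd2,0), (Fa2,1), (Fb2,1), (Fc1,1), (Fc2,1), (Fd1,1)]
   [((Fz,0),F_r1),((Fz,1),F_emp)]
   [((Fa2,1),Fm1342)]
   [2, 2, 2, 2, 2, 2, 2, 2, 2, 2, 2, 2, 2, 2, 2, 2, 2, 2, 2, 2, 2, 2, 2, 2, 2, 2, 2, 2, 2, 2, 2, 2,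
   2, 2, 2, 2, 2, 2, 2, 2, 2, 2, 2, 2, 2, 2, 2, 2, 2, 2, 2, 2, 1]"
| "tab_F F_r1 = Row (R I1)
   [(Fa2,0), (Fb2,0), (Fc1,0), (Fc2,0), (Fd1,0)]
   [((Fa1,0),Fm1000),((Fz,0),Fp2342)]
   [((Fa2,0),Fp1000),((Fz,0),Fm2342)]
   [2, 1, 1, 1, 2, 1, 1, 2, 1, 1, 2, 2, 1, 2, 2, 1, 2, 2, 2, 2, 2, 2, 2, 2, 1, 1, 1, 1, 1, 1, 1, 1,
   1, 1, 1, 1, 1, 1, 1, 1, 1, 1, 1, 1, 1, 1, 1, 0, 1, 1, 1, 1, 1]"
| "tab_F F_r2 = Row (R I2)
   [(Fa1,0), (Fb1,0), (Fc1,0), (Fc2,0), (Fd1,0)]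
   [((Fb2,0),Fm0100),((Fc3,0),Fm0010)]
   [((Fb1,0),Fp0100),((Fc2,0),Fp0010)]
   [1, 2, 1, 1, 2, 2, 1, 2, 2, 2, 2, 2, 2, 2, 2, 2, 2, 2, 2, 2, 2, 2, 2, 2, 1, 1, 1, 1, 1, 1, 1, 1,
   1, 1, 1, 1, 1, 1, 1, 1, 1, 1, 1, 1, 1, 1, 0, 0, 1, 1, 1, 1, 1]"
| "tab_F F_r3 = Row (R I3)
   [(Fa1,0), (Fb1,0), (Fc1,0), (Fc3,0), (Fd1,0)]
   [((Fc2,0),Fm0010),((Fd2,0),Fm0001)]
   [((Fd1,0),Fp0001),((Fc3,0),Fp0010)]
   [1, 1, 1, 1, 1, 1, 1, 1, 2, 1, 2, 1, 2, 2, 2, 2, 2, 2, 2, 2, 2, 2, 2, 2, 1, 1, 1, 1, 1, 1, 1, 1,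
   1, 1, 1, 1, 1, 1, 1, 1, 1, 1, 0, 1, 0, 0, 0, 0, 1, 1, 1, 1, 1]"
| "tab_F F_r4 = Row (R I4)
   [(Fa1,0), (Fb1,0), (Fc1,0), (Fc3,0), (Fd2,0)]
   [((Fd1,0),Fm0001)]
   [((Fd2,0),Fp0001)]
   [1, 1, 1, 1, 1, 1, 1, 1, 1, 1, 1, 1, 1, 1, 1, 2, 1, 2, 1, 2, 2, 2, 2, 2, 1, 1, 1, 0, 1, 1, 0, 1,
   1, 0, 1, 0, 0, 1, 0, 0, 0, 0, 0, 0, 0, 0, 0, 0, 1, 1, 1, 0, 1]"
| "tab_F F_emp = Row (Emp)
   [(Fz,-1), (Fa2,0), (Fb2,0), (Fc1,0), (Fc2,0), (Fd1,0), (Fz,0)]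
   [((Fz,-1),Fp2342)]
   [((Fz,1),Fm2342)]
   [1, 1, 1, 1, 1, 1, 1, 1, 1, 1, 1, 1, 1, 1, 1, 1, 1, 1, 1, 1, 1, 1, 1, 1, 1, 1, 1, 1, 1, 1, 1, 1,
   1, 1, 1, 1, 1, 1, 1, 1, 1, 1, 1, 1, 1, 1, 1, 1, 1, 1, 1, 1, 0]"
| "tab_F F_exc = Row (R I0)
   [(Fa1,0), (Fb2,0), (Fc1,0), (Fc2,0), (Fd1,0)]
   [((Fb1,0),Fm0100),((Fa2,0),Fm1000)]
   [((Fa1,0),Fp1000),((Fb2,0),Fp0100)]
   []"

definition letters_F :: "letter_F list" where
  "letters_F = [Fa1, Fa2, Fb1, Fb2, Fb3, Fc1, Fc2, Fc3, Fc4, Fd1, Fd2, Fz]"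

definition positive_F :: "root list" where
  "positive_F =
    [(1,0,0,0), (0,1,0,0), (0,0,1,0), (0,0,0,1), (1,1,0,0), (0,1,1,0), (0,0,1,1), (1,1,1,0), (0,1,2,0), (0,1,1,1), (1,1,2,0), (1,1,1,1), (0,1,2,1), (1,2,2,0), (1,1,2,1), (0,1,2,2), (1,2,2,1), (1,1,2,2), (1,2,3,1), (1,2,2,2), (1,2,3,2), (1,2,4,2), (1,3,4,2), (2,3,4,2)]"

text \<open>\<open>Fz\<close> and \<open>Fb3\<close> rest on blocks of their own double-height row
  and are lifted by 1. The factor 5 in \<open>support_range\<close> exceeds the largest rank 4, so
  blocks of the preceding period still come first.\<close>

fun rank_F :: "letter_F \<Rightarrow> int" where
  "rank_F Fz = 4"
| "rank_F Fb3 = 4"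
| "rank_F l = row_F l"

lemma type_F_simps:
  "cartan type_F = cartan_F" "pos_roots type_F = set positive_F" "theta type_F = (2,3,4,2)"
  "colour type_F = colour_F" "row type_F = row_F" "support type_F = support_F"
  by (simp_all add: type_F_def positive_F_def)

lemma verts_F: "set verts_F = UNIV"
proof -
  have "v \<in> set verts_F" for v by (cases v) (simp_all add: verts_F_def)
  then show ?thesis by blast
qed

lemma letters_F: "set letters_F = UNIV"
proof -
  have "l \<in> set letters_F" for l by (cases l) (simp_all add: letters_F_def)
  then show ?thesis by blast
qed

section \<open>Finite checks of the table, affine F4\<close>

lemma is_down_F: "list_all (\<lambda>v. is_down support_F (window letters_F) (diff (tab_F v))) verts_F"
  by code_simp

lemma covers_sound_F: "list_all (covers_sound colour_F (window letters_F) tab_F) verts_F"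
  by code_simp

lemma covers_complete_F: "list_all (covers_complete support_F (window letters_F) tab_F) verts_F"
  by code_simp

lemma cocovers_ok_F: "list_all (cocovers_ok tab_F) verts_F"
  by code_simp

lemma sorted_rows_F: "list_all (sorted_rows colour_F row_F tab_F) verts_F"
  by code_simp

lemma exceptional_ok_F:
  "list_all (exceptional_ok colour_F row_F (window letters_F) tab_F) verts_F"
  by code_simp

lemma strings_ok_F: "list_all (strings_ok colour_F tab_F) verts_F"
  by code_simp

lemma weights_ok_F: "list_all (weights_ok colour_F cartan_F tab_F) verts_F"
  by code_simp

lemma arrows_ok_F: "list_all (arrows_ok colour_F (set positive_F) (2,3,4,2) tab_F) verts_F"
  by code_simp

lemma distinct_F: "distinct (map (\<lambda>v. diff (tab_F v)) verts_F)"
    "distinct (map (\<lambda>v. name (tab_F v)) verts_F)"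
  by code_simp+

lemma energy_ok_F: "energy_ok colour_F tab_F (filter (\<lambda>v. name (tab_F v) \<noteq> R I0) verts_F)"
  by code_simp

lemma energy_emp_F:
  "energy_of tab_F (filter (\<lambda>v. name (tab_F v) \<noteq> R I0) verts_F) F_emp F_emp = 0"
  by code_simp

lemma height_F: "list_all (\<lambda>v. list_all (\<lambda>i. i = I0 \<or> (case vertex_e colour_F tab_F i v of None \<Rightarrow> True
    | Some w \<Rightarrow> height (name (tab_F w)) = height (name (tab_F v)) + 1)) inds) verts_F"
  by code_simp

lemma highest_F: "list_all (\<lambda>v. name (tab_F v) \<in> {R I0, Emp, X (2,3,4,2)} \<or>
    list_ex (\<lambda>i. i \<noteq> I0 \<and> vertex_e colour_F tab_F i v \<noteq> None) inds) verts_F"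
  by code_simp

lemma theta_F: "name (tab_F Fp2342) = X (2,3,4,2)" "steps (vertex_f colour_F tab_F I0) Fp2342 = 0"
    "vertex_e colour_F tab_F I0 Fp2342 = Some F_emp"
  by code_simp+

lemma steps_emp_F: "list_all (\<lambda>i.
    steps (vertex_e colour_F tab_F i) F_emp = (if i = I0 then 1 else 0) \<and>
    steps (vertex_f colour_F tab_F i) F_emp = (if i = I0 then 1 else 0)) inds"
  by code_simp

lemma names_F:
  "X ` (set positive_F \<union> uminus ` set positive_F) \<union>
    R ` set (filter (\<lambda>i. i \<noteq> I0 \<and> alpha_root i \<in> set positive_F) inds) \<union> {Emp} =
   (\<lambda>v. name (tab_F v)) ` set (filter (\<lambda>v. name (tab_F v) \<noteq> R I0) verts_F)"
  by code_simp

section \<open>Carrier and distinguished columns, affine F4\<close>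

lemma name_exc_F: "name (tab_F v) = R I0 \<longleftrightarrow> v = F_exc"
  by (cases v) simp_all

lemma carrier_F: "carr (perfect_crystal type_F) = (\<lambda>v. name (tab_F v)) ` {v. v \<noteq> F_exc}"
proof -
  have "set inds = UNIV" by (simp add: inds_def UNIV_ind)
  then have "{R i | i. i \<noteq> I0 \<and> alpha_root i \<in> set positive_F} =
      R ` set (filter (\<lambda>i. i \<noteq> I0 \<and> alpha_root i \<in> set positive_F) inds)" by auto
  moreover have "{v. v \<noteq> F_exc} = set (filter (\<lambda>v. name (tab_F v) \<noteq> R I0) verts_F)"
    by (simp add: verts_F name_exc_F)
  ultimately show ?thesis
    using names_F by (simp add: perfect_crystal_def Let_def roots_def type_F_simps)
qed

lemma ve_F: "name (tab_F F_emp) = Emp"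
  and base_vertex_F: "diff (tab_F Fp1121) = []"
  by simp_all

lemma zero_block_F: "(Fz, m) \<in> set (diff (tab_F v)) \<longleftrightarrow> v = F_emp \<and> (m = -1 \<or> m = 0)"
  by (cases v) simp_all

lemma col_empty_F: "col_empty type_F = {(l, m). in_col (diff (tab_F F_emp)) (l, m - 1)}"
proof -
  have "(l, m) \<in> col_empty type_F \<longleftrightarrow> in_col (diff (tab_F F_emp)) (l, m - 1)" for l m
    by (cases l) (auto simp: type_F_def base_F_def in_col_def)
  then show ?thesis by auto
qed

lemma col_r1_F: "col_r type_F I1 = Some {(l, m). in_col (diff (tab_F F_r1)) (l, m - 1)}"
    and name_r1_F: "name (tab_F v) = R I1 \<longleftrightarrow> v = F_r1"
proof -
  have "(l, m) \<in> the (col_r type_F I1) \<longleftrightarrow> in_col (diff (tab_F F_r1)) (l, m - 1)" for l m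
    by (cases l) (auto simp: type_F_def base_F_def in_col_def)
  then have "the (col_r type_F I1) = {(l, m). in_col (diff (tab_F F_r1)) (l, m - 1)}" by auto
  moreover have "col_r type_F I1 \<noteq> None" by (simp add: type_F_def)
  ultimately show "col_r type_F I1 = Some {(l, m). in_col (diff (tab_F F_r1)) (l, m - 1)}" by (metis option.collapse)
  show "name (tab_F v) = R I1 \<longleftrightarrow> v = F_r1" by (cases v) simp_all
qed

lemma col_r2_F: "col_r type_F I2 = Some {(l, m). in_col (diff (tab_F F_r2)) (l, m - 1)}"
    and name_r2_F: "name (tab_F v) = R I2 \<longleftrightarrow> v = F_r2"
proof -
  have "(l, m) \<in> the (col_r type_F I2) \<longleftrightarrow> in_col (diff (tab_F F_r2)) (l, m - 1)" for l m
    by (cases l) (auto simp: type_F_def base_F_def in_col_def)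
  then have "the (col_r type_F I2) = {(l, m). in_col (diff (tab_F F_r2)) (l, m - 1)}" by auto
  moreover have "col_r type_F I2 \<noteq> None" by (simp add: type_F_def)
  ultimately show "col_r type_F I2 = Some {(l, m). in_col (diff (tab_F F_r2)) (l, m - 1)}" by (metis option.collapse)
  show "name (tab_F v) = R I2 \<longleftrightarrow> v = F_r2" by (cases v) simp_all
qed

lemma col_r3_F: "col_r type_F I3 = Some {(l, m). in_col (diff (tab_F F_r3)) (l, m - 1)}"
    and name_r3_F: "name (tab_F v) = R I3 \<longleftrightarrow> v = F_r3"
proof -
  have "(l, m) \<in> the (col_r type_F I3) \<longleftrightarrow> in_col (diff (tab_F F_r3)) (l, m - 1)" for l m
    by (cases l) (auto simp: type_F_def base_F_def in_col_def)
  then have "the (col_r type_F I3) = {(l, m). in_col (diff (tab_F F_r3)) (l, m - 1)}" by auto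
  moreover have "col_r type_F I3 \<noteq> None" by (simp add: type_F_def)
  ultimately show "col_r type_F I3 = Some {(l, m). in_col (diff (tab_F F_r3)) (l, m - 1)}" by (metis option.collapse)
  show "name (tab_F v) = R I3 \<longleftrightarrow> v = F_r3" by (cases v) simp_all
qed

lemma col_r4_F: "col_r type_F I4 = Some {(l, m). in_col (diff (tab_F F_r4)) (l, m - 1)}"
    and name_r4_F: "name (tab_F v) = R I4 \<longleftrightarrow> v = F_r4"
proof -
  have "(l, m) \<in> the (col_r type_F I4) \<longleftrightarrow> in_col (diff (tab_F F_r4)) (l, m - 1)" for l m
    by (cases l) (auto simp: type_F_def base_F_def in_col_def)
  then have "the (col_r type_F I4) = {(l, m). in_col (diff (tab_F F_r4)) (l, m - 1)}" by auto
  moreover have "col_r type_F I4 \<noteq> None" by (simp add: type_F_def)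
  ultimately show "col_r type_F I4 = Some {(l, m). in_col (diff (tab_F F_r4)) (l, m - 1)}" by (metis option.collapse)
  show "name (tab_F v) = R I4 \<longleftrightarrow> v = F_r4" by (cases v) simp_all
qed

lemma col_r_none_F: "col_r type_F I0 = None"
  by (simp add: type_F_def)

lemma col_r_F: "col_r type_F j = Some y \<longleftrightarrow>
    j \<noteq> I0 \<and> (\<exists>v. name (tab_F v) = R j \<and> y = {(l, m). in_col (diff (tab_F v)) (l, m - 1)})"
  by (cases j) (auto simp: col_r1_F name_r1_F col_r2_F name_r2_F col_r3_F name_r3_F col_r4_F name_r4_F col_r_none_F)

text \<open>Now \<open>Fc1\<close> forces all letters except \<open>Fz\<close> one index lower and
  \<open>Fa1\<close> forces \<open>Fz\<close>. The letters \<open>Fa1\<close> and \<open>Fd1\<close>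
  do not lie above \<open>Fc1\<close> of the same index, but reach \<open>Fc1\<close> and
  \<open>Fa1\<close> of the preceding one through \<open>Fc4\<close>.\<close>

lemma below_F:
  assumes y: "\<forall>x\<in>y. rests_on type_F x \<subseteq> y" and lm: "(l, m) \<in> y"
  shows "(l', m - 2) \<in> y \<and> (l', m - 3) \<in> y"
proof -
  have s: "(k', m + d) \<in> y" if "(k, m) \<in> y" "(k', d) \<in> support_F k" for k k' m d
  proof -
    have "(k', m + d) \<in> rests_on type_F (k, m)" using that(2) by (auto simp: rests_on_def type_F_simps)
    then show ?thesis using y that(1) by blast
  qed
  have z: "(Fa2, m) \<in> y" if "(Fz, m) \<in> y" for m using s[OF that, of _ 0] by simp
  have b3: "(Fa2, m) \<in> y \<and> (Fc4, m) \<in> y" if "(Fb3, m) \<in> y" for m using s[OF that, of _ 0] by simp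
  have d2: "(Fc3, m) \<in> y" if "(Fd2, m) \<in> y" for m using s[OF that, of _ 0] by simp
  have c4: "(Fb2, m) \<in> y \<and> (Fc3, m) \<in> y" if "(Fc4, m) \<in> y" for m using s[OF that, of _ 0] by simp
  have a2: "(Fb2, m) \<in> y" if "(Fa2, m) \<in> y" for m using s[OF that, of _ 0] by simp
  have c3: "(Fb1, m) \<in> y" if "(Fc3, m) \<in> y" for m using s[OF that, of _ 0] by simp
  have b2: "(Fc2, m) \<in> y" if "(Fb2, m) \<in> y" for m using s[OF that, of _ 0] by simp
  have b1: "(Fc1, m) \<in> y \<and> (Fa1, m) \<in> y" if "(Fb1, m) \<in> y" for m using s[OF that, of _ 0] by simp
  have c2: "(Fc1, m) \<in> y \<and> (Fd1, m) \<in> y" if "(Fc2, m) \<in> y" for m using s[OF that, of _ 0] by simp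
  have a: "(Fz, m - 1) \<in> y \<and> (Fb3, m - 1) \<in> y" if "(Fa1, m) \<in> y" for m using s[OF that, of _ "-1"] by simp
  have d: "(Fc4, m - 1) \<in> y \<and> (Fd2, m - 1) \<in> y" if "(Fd1, m) \<in> y" for m using s[OF that, of _ "-1"] by simp
  have c: "(Fb3, m - 1) \<in> y \<and> (Fc4, m - 1) \<in> y \<and> (Fd2, m - 1) \<in> y" if "(Fc1, m) \<in> y" for m
    using s[OF that, of _ "-1"] by simp
  have hub: "(k, m - 1) \<in> y" if "(Fc1, m) \<in> y" "k \<noteq> Fz" for k m
    using c[OF that(1)] that(2) b3[of "m - 1"] c4[of "m - 1"] c3[of "m - 1"] b2[of "m - 1"] b1[of "m - 1"] c2[of "m - 1"]
    by (cases k) simp_all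
  have all: "(Fc1, m - 1) \<in> y \<and> (Fa1, m - 1) \<in> y"
  proof (cases "l = Fa1 \<or> l = Fd1")
    case True
    then have "(Fc4, m - 1) \<in> y" using lm a[of m] b3[of "m - 1"] d[of m] by auto
    then show ?thesis using c4[of "m - 1"] c3[of "m - 1"] b1[of "m - 1"] by simp
  next
    case False
    then have "(Fc1, m) \<in> y"
      using lm z[of m] b3[of m] d2[of m] c4[of m] a2[of m] c3[of m] b2[of m] b1[of m] c2[of m]
      by (cases l) simp_all
    then show ?thesis using hub by simp
  qed
  then have all': "(Fc1, m - 2) \<in> y" "(Fa1, m - 2) \<in> y" using hub[of "m - 1"] by simp_all
  show ?thesis
  proof (cases "l' = Fz")
    case True
    then show ?thesis using a[of "m - 1"] all a[OF all'(2)] by simp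
  next
    case False
    then show ?thesis using hub[of "m - 1" l'] hub[OF all'(1), of l'] all by simp
  qed
qed

interpretation F: crystal_model type_F letters_F verts_F tab_F rank_F F_exc Fp1121 F_emp Fz Fp2342
proof
  fix l l' d
  show "0 \<le> row type_F l" "row type_F l \<le> 3" by (cases l; simp add: type_F_simps)+
  show "(d = 0 \<or> d = -1) \<and> 5 * d + rank_F l' < rank_F l" if "(l', d) \<in> support type_F l"
    using that by (cases l) (auto simp: type_F_simps)
  show "support type_F l \<noteq> {}" by (cases l) (simp_all add: type_F_simps)
  show "colour type_F l = I0 \<longleftrightarrow> l = Fz" by (cases l) (simp_all add: type_F_simps)
qed (unfold type_F_simps, (rule letters_F verts_F is_down_F covers_sound_F covers_complete_F cocovers_ok_F
    sorted_rows_F exceptional_ok_F strings_ok_F weights_ok_F arrows_ok_F distinct_F energy_ok_F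
    energy_emp_F ve_F base_vertex_F height_F highest_F theta_F steps_emp_F name_exc_F carrier_F zero_block_F
    col_empty_F col_r_F | erule (1) below_F)+)


theorem theorem5p3:
  shows "(\<forall>g \<in> shift_class (col_empty type_E).
           \<exists>\<Psi>. affine_crystal_iso type_E
                 (wall_crystal type_E g (Lam I0)) (fock_crystal type_E (Lam I0)) \<Psi> \<and>
               \<Psi> (ground_wall g) = ground_sequence) \<and>
         (\<forall>g \<in> shift_class (col_empty type_F).
           \<exists>\<Psi>. affine_crystal_iso type_F
                 (wall_crystal type_F g (Lam I0)) (fock_crystal type_F (Lam I0)) \<Psi> \<and>
               \<Psi> (ground_wall g) = ground_sequence)"
  using E.wall_iso_exists F.wall_iso_exists by blast

end
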